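(* Let $F$ be a free group and $R$ a normal subgroup of $F$. Then (i) $F\cap(1+\mathfrak r^2+\mathfrak f^3)=\gamma_2(R)\gamma_3(F)$; (ii) $F\cap(1+\mathfrak r^2\mathbb Z[F]+\mathfrak f^4)\le R\,\gamma_4(F)$.
   Context: $\mathbb Z[F]$ is the integral group ring, $\mathfrak f$ its augmentation ideal, and $\mathfrak r$ denotes the augmentation ideal of $\mathbb Z[R]$, regarded inside $\mathbb Z[F]$; $\mathfrak r^2\mathbb Z[F]$ is the two-sided ideal of $\mathbb Z[F]$ spanned by products $abc$ with $a,b\in\mathfrak r$, $c\in\mathbb Z[F]$. $\gamma_n$ denotes the $n$th term of the lower central series. *)

theory Defs
  imports
    "HOL-Algebra.Generated_Groups"
    "HOL-Algebra.Ideal_Product"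
    "HOL-Library.Poly_Mapping"
begin

section \<open>Free groups\<close>

text \<open>
  A word over \<open>X\<close> is a list of letters \<open>(x, b)\<close> with \<open>x \<in> X\<close>; the letter \<open>(x, True)\<close> stands
  for \<open>x\<close> and \<open>(x, False)\<close> for its inverse.
\<close>

definition reduced_words :: "'a set \<Rightarrow> ('a \<times> bool) list set" where
  "reduced_words X =
     {w. fst ` set w \<subseteq> X \<and> successively (\<lambda>(x, b) (y, c). \<not> (x = y \<and> b \<noteq> c)) w}"

definition word_value :: "('a, 'b) monoid_scheme \<Rightarrow> ('a \<times> bool) list \<Rightarrow> 'a" where
  "word_value G w =
     foldr (\<lambda>(x, b) g. (if b then x else inv\<^bsub>G\<^esub> x) \<otimes>\<^bsub>G\<^esub> g) w \<one>\<^bsub>G\<^esub>"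

text \<open>\<open>G\<close> is free on \<open>X\<close> if every element is the value of exactly one reduced word over \<open>X\<close>.\<close>

definition free_on :: "('a, 'b) monoid_scheme \<Rightarrow> 'a set \<Rightarrow> bool" where
  "free_on G X \<longleftrightarrow>
     X \<subseteq> carrier G \<and> bij_betw (word_value G) (reduced_words X) (carrier G)"

definition free_group :: "('a, 'b) monoid_scheme \<Rightarrow> bool" where
  "free_group G \<longleftrightarrow> group G \<and> (\<exists>X. free_on G X)"


section \<open>Lower central series\<close>

definition commutator_subgroup :: "('a, 'b) monoid_scheme \<Rightarrow> 'a set \<Rightarrow> 'a set \<Rightarrow> 'a set" where
  "commutator_subgroup G H K =
     generate G (\<Union>h\<in>H. \<Union>k\<in>K. {h \<otimes>\<^bsub>G\<^esub> k \<otimes>\<^bsub>G\<^esub> inv\<^bsub>G\<^esub> h \<otimes>\<^bsub>G\<^esub> inv\<^bsub>G\<^esub> k})"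

text \<open>
  The numbering starts at \<open>1\<close>: the first term is \<open>G\<close> itself. The index \<open>0\<close> is not meaningful
  and gives \<open>G\<close> as well.
\<close>

definition lower_central :: "('a, 'b) monoid_scheme \<Rightarrow> nat \<Rightarrow> 'a set" where
  "lower_central G n = ((\<lambda>H. commutator_subgroup G H (carrier G)) ^^ (n - 1)) (carrier G)"


section \<open>Integral group rings\<close>

text \<open>
  An element of the group ring is a finitely supported integer-valued function on the carrier.
  The group element \<open>g\<close> is embedded as \<open>frag_of g\<close>, and the product is the biadditive extension
  of the product of \<open>G\<close>. For a subgroup \<open>H\<close>, the carrier of
  \<open>group_ring (G\<lparr>carrier := H\<rparr>)\<close> is a subset of that of \<open>group_ring G\<close>, with the
  same operations, so that no embedding is needed.
\<close>

definition group_ring :: "('a, 'b) monoid_scheme \<Rightarrow> ('a \<Rightarrow>\<^sub>0 int) ring" where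
  "group_ring G =
     \<lparr>carrier = {a. Poly_Mapping.keys a \<subseteq> carrier G},
      mult = (\<lambda>a b. frag_extend (\<lambda>g. frag_extend (\<lambda>h. frag_of (g \<otimes>\<^bsub>G\<^esub> h)) b) a),
      one = frag_of \<one>\<^bsub>G\<^esub>,
      zero = 0,
      add = (+)\<rparr>"

definition augmentation :: "('a \<Rightarrow>\<^sub>0 int) \<Rightarrow> int" where
  "augmentation a = (\<Sum>g\<in>Poly_Mapping.keys a. Poly_Mapping.lookup a g)"

definition augmentation_ideal :: "('a, 'b) monoid_scheme \<Rightarrow> ('a \<Rightarrow>\<^sub>0 int) set" where
  "augmentation_ideal G = {a \<in> carrier (group_ring G). augmentation a = 0}"

text \<open>
  \<open>ideal_prod\<close> is the set of finite nonempty sums of products, so it is the additive span of the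
  products also for additive subgroups that are not ideals.
\<close>

primrec ideal_power :: "('a, 'b) ring_scheme \<Rightarrow> 'a set \<Rightarrow> nat \<Rightarrow> 'a set" where
  "ideal_power A I 0 = carrier A"
| "ideal_power A I (Suc n) = ideal_power A I n \<cdot>\<^bsub>A\<^esub> I"

text \<open>The set usually written \<open>G \<inter> (1 + J)\<close>.\<close>

definition group_inter_one_plus ::
    "('a, 'b) monoid_scheme \<Rightarrow> ('a \<Rightarrow>\<^sub>0 int) set \<Rightarrow> 'a set" where
  "group_inter_one_plus G J =
     {g \<in> carrier G. frag_of g \<in> \<one>\<^bsub>group_ring G\<^esub> <+\<^bsub>group_ring G\<^esub> J}"

end

theory Submission
  imports Defs "HOL-Library.Function_Algebras" "HOL-Library.Product_Plus"
begin

text \<open>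
  The Magnus expansion \<open>g \<mapsto> 1 + d1 g + d2 g + d3 g\<close>, truncated after degree three, extends
  linearly to \<open>\<int>[F]\<close> and kills \<open>\<ff>\<^sup>4\<close>; its term of degree \<open>n\<close> detects \<open>\<gamma>\<^sub>n / \<gamma>\<^sub>n\<^sub>+\<^sub>1\<close>. Let \<open>A\<close> be the
  abelianisation of \<open>F\<close>, \<open>B\<close> the image of \<open>R\<close> in \<open>A\<close>, and \<open>B'\<close> the image of \<open>R \<inter> \<gamma>\<^sub>2\<close> in
  \<open>A \<otimes> A\<close>.

  For (i), an element of the left-hand side has an antisymmetric term of degree two lying in
  \<open>B \<otimes> B\<close>. After restriction to finitely many free generators there is a basis \<open>p\<^sub>i\<close> of \<open>A\<close> such that \<open>B\<close> is spanned by multiples \<open>e\<^sub>i p\<^sub>i\<close>; the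
  coefficient at \<open>(i, j)\<close> is then divisible by \<open>e\<^sub>i e\<^sub>j\<close>, so that the term is a sum of commutators of
  elements of \<open>B\<close>.

  For (ii), part (i) reduces to elements of \<open>\<gamma>\<^sub>3\<close>. Their terms of degree three lie in
  \<open>B' \<otimes> B + B \<otimes> A \<otimes> A\<close>, because \<open>B \<otimes> B\<close> embeds into \<open>A \<otimes> A\<close>. Subtracting commutators
  \<open>[B', B]\<close>, one is left with a Lie element in \<open>B \<otimes> A \<otimes> A\<close>. A Lie element of degree three is
  determined by its coefficients at words beginning with their smallest letter \<open>i\<close>, and here
  these are divisible by \<open>e\<^sub>i\<close>; hence the element lies in \<open>[[B, A], A]\<close>.
\<close>

section \<open>Homomorphisms from free groups\<close>

text \<open>The obstacle in both parts is that \<open>A / B\<close> may have torsion, so that a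
  basis of \<open>B\<close> need not extend to one of \<open>A\<close>. Being a combination of
  tensors over \<open>B\<close> is therefore a matter of divisibility, not only of vanishing, and
  the numbers e_i (some possibly 0) keep track of it. In degree three there is a second difficulty.
  The product (r - 1)(s - 1) has degree two term \<open>d1 r \<otimes> d1 s\<close>, but its degree
  three term also involves \<open>d2 r\<close> and \<open>d2 s\<close>, which the images in
  \<open>B\<close> do not determine; a combination of products whose degree two terms cancel might
  leave an uncontrolled remainder. Changing r by an element y of R and gamma_2 changes that term by
  \<open>d2 y \<otimes> d1 s\<close>, which is the degree three term of [y, s] up to an element of
  \<open>B \<otimes> A \<otimes> A\<close>. So modulo \<open>B \<otimes> A \<otimes> A\<close> and
  the terms of elements of R and gamma_3 the remainder is well defined on
  \<open>B \<otimes> B\<close>, and cancellation in degree two makes it vanish there. A third factor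
  c on the right contributes only \<open>d1 r \<otimes> d1 s \<otimes> d1 c\<close>, which again
  begins in \<open>B\<close>.\<close>

definition word_map :: "('c, 'd) monoid_scheme \<Rightarrow> ('a \<Rightarrow> 'c) \<Rightarrow> ('a \<times> bool) list \<Rightarrow> 'c" where
  "word_map H f w =
     foldr (\<lambda>(x, b) g. (if b then f x else inv\<^bsub>H\<^esub> (f x)) \<otimes>\<^bsub>H\<^esub> g) w \<one>\<^bsub>H\<^esub>"

lemma word_map_simps [simp]:
  "word_map H f [] = \<one>\<^bsub>H\<^esub>"
  "word_map H f ((x, b) # w) = (if b then f x else inv\<^bsub>H\<^esub> (f x)) \<otimes>\<^bsub>H\<^esub> word_map H f w"
  by (simp_all add: word_map_def)

lemma word_value_eq_word_map: "word_value G = word_map G (\<lambda>x. x)"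
  by (simp add: fun_eq_iff word_value_def word_map_def)

fun cancel_cons :: "'a \<times> bool \<Rightarrow> ('a \<times> bool) list \<Rightarrow> ('a \<times> bool) list" where
  "cancel_cons l [] = [l]"
| "cancel_cons (x, b) ((y, c) # w) = (if x = y \<and> b \<noteq> c then w else (x, b) # (y, c) # w)"

definition reduce :: "('a \<times> bool) list \<Rightarrow> ('a \<times> bool) list" where
  "reduce w = foldr cancel_cons w []"

lemma set_cancel_cons: "set (cancel_cons l w) \<subseteq> insert l (set w)"
  by (cases "(l, w)" rule: cancel_cons.cases) auto

lemma cancel_cons_reduced:
  "w \<in> reduced_words X \<Longrightarrow> x \<in> X \<Longrightarrow> cancel_cons (x, b) w \<in> reduced_words X"
  using set_cancel_cons[of "(x, b)" w]
  by (cases w) (force simp: reduced_words_def successively_Cons)+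

lemma reduce_reduced: "fst ` set w \<subseteq> X \<Longrightarrow> reduce w \<in> reduced_words X"
proof (induction w)
  case Nil
  then show ?case by (simp add: reduce_def reduced_words_def)
next
  case (Cons l w)
  then show ?case
    by (cases l) (auto simp: reduce_def intro!: cancel_cons_reduced)
qed

lemma word_map_closed:
  assumes "group H" "f \<in> X \<rightarrow> carrier H" "fst ` set w \<subseteq> X"
  shows "word_map H f w \<in> carrier H"
proof -
  interpret group H by fact
  show ?thesis
    using assms(3)
  proof (induction w)
    case (Cons l w)
    then show ?case using assms(2) by (cases l) (auto simp: Pi_iff)
  qed simp
qed

lemma word_map_append:
  assumes "group H" "f \<in> X \<rightarrow> carrier H" "fst ` set u \<subseteq> X" "fst ` set w \<subseteq> X"
  shows "word_map H f (u @ w) = word_map H f u \<otimes>\<^bsub>H\<^esub> word_map H f w"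
proof -
  interpret group H by fact
  note c = word_map_closed[OF assms(1,2)]
  show ?thesis
    using assms(3)
  proof (induction u)
    case Nil
    then show ?case using c[OF assms(4)] by simp
  next
    case (Cons l u)
    then have "fst l \<in> X" "fst ` set u \<subseteq> X" by auto
    then show ?case using assms(2) c[OF assms(4)] c[of u] Cons.IH
      by (cases l) (auto simp: Pi_iff m_assoc)
  qed
qed

lemma word_map_cancel_cons:
  assumes "group H" "f \<in> X \<rightarrow> carrier H" "fst ` set w \<subseteq> X" "x \<in> X"
  shows "word_map H f (cancel_cons (x, b) w) = word_map H f ((x, b) # w)"
proof (cases w)
  case (Cons l v)
  interpret group H by fact
  have "f x \<in> carrier H" "word_map H f v \<in> carrier H"
    using assms Cons word_map_closed[OF assms(1,2), of v] by auto
  then show ?thesis using Cons by (cases l) (auto simp: m_assoc[symmetric])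
qed simp

lemma word_map_reduce:
  assumes "group H" "f \<in> X \<rightarrow> carrier H" "fst ` set w \<subseteq> X"
  shows "word_map H f (reduce w) = word_map H f w"
  using assms(3)
proof (induction w)
  case (Cons l w)
  obtain x b where l: "l = (x, b)" by (cases l)
  have "fst ` set (reduce w) \<subseteq> X"
    using Cons.prems reduce_reduced[of w X] by (auto simp: reduced_words_def)
  then have "word_map H f (cancel_cons (x, b) (reduce w)) = word_map H f ((x, b) # reduce w)"
    using word_map_cancel_cons[OF assms(1,2), of "reduce w" x b] Cons.prems l by auto
  then show ?case using Cons l by (simp add: reduce_def)
qed (simp add: reduce_def)

text \<open>Freeness is given through unique reduced words only. An element is sent to the value in
  \<open>H\<close> of its reduced word. This is multiplicative because free reduction changes no
  value in any group: the concatenation of two reduced words and the reduced word of the product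
  have equal values in \<open>H\<close>.\<close>

lemma free_on_universal:
  assumes "group G" "group H" "free_on G X" "f \<in> X \<rightarrow> carrier H"
  shows "\<exists>h \<in> hom G H. \<forall>x\<in>X. h x = f x"
proof -
  interpret G: group G by fact
  interpret H: group H by fact
  have X: "(\<lambda>x. x) \<in> X \<rightarrow> carrier G" and bij: "bij_betw (word_map G (\<lambda>x. x)) (reduced_words X) (carrier G)"
    using assms(3) by (auto simp: free_on_def word_value_eq_word_map)
  define nf where "nf = inv_into (reduced_words X) (word_map G (\<lambda>x. x))"
  have nf: "nf g \<in> reduced_words X" "word_map G (\<lambda>x. x) (nf g) = g" if "g \<in> carrier G" for g
    using that bij by (auto simp: nf_def bij_betw_def inv_into_into f_inv_into_f)
  have nfX: "fst ` set (nf g) \<subseteq> X" if "g \<in> carrier G" for g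
    using nf(1)[OF that] by (auto simp: reduced_words_def)
  have key: "word_map H f (nf (word_map G (\<lambda>x. x) w)) = word_map H f w" if w: "fst ` set w \<subseteq> X" for w
  proof -
    have "nf (word_map G (\<lambda>x. x) w) = nf (word_map G (\<lambda>x. x) (reduce w))"
      using word_map_reduce[OF assms(1) X w] by simp
    also have "\<dots> = reduce w"
      using bij reduce_reduced[OF w] by (simp add: nf_def bij_betw_def)
    finally show ?thesis using word_map_reduce[OF assms(2,4) w] by simp
  qed
  show ?thesis
  proof (intro bexI ballI)
    show "(\<lambda>g. word_map H f (nf g)) \<in> hom G H"
    proof (rule homI)
      fix g g' assume g: "g \<in> carrier G" "g' \<in> carrier G"
      have "g \<otimes>\<^bsub>G\<^esub> g' = word_map G (\<lambda>x. x) (nf g @ nf g')"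
        using word_map_append[OF assms(1) X nfX nfX] g nf by simp
      then have "word_map H f (nf (g \<otimes>\<^bsub>G\<^esub> g')) = word_map H f (nf g @ nf g')"
        using key[of "nf g @ nf g'"] nfX g by auto
      then show "word_map H f (nf (g \<otimes>\<^bsub>G\<^esub> g')) = word_map H f (nf g) \<otimes>\<^bsub>H\<^esub> word_map H f (nf g')"
        using word_map_append[OF assms(2,4) nfX nfX] g by simp
    qed (use word_map_closed[OF assms(2,4)] nfX in auto)
  next
    fix x assume x: "x \<in> X"
    then have "x \<in> carrier G" "f x \<in> carrier H" using X assms(4) by auto
    then show "word_map H f (nf x) = f x"
      using key[of "[(x, True)]"] x by simp
  qed
qed

lemma (in group) free_on_generate:
  assumes "free_on G X"
  shows "generate G X = carrier G"
proof
  have X: "X \<subseteq> carrier G" and bij: "bij_betw (word_map G (\<lambda>x. x)) (reduced_words X) (carrier G)"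
    using assms by (auto simp: free_on_def word_value_eq_word_map)
  show "generate G X \<subseteq> carrier G" using generate_incl[OF X] .
  have "word_map G (\<lambda>x. x) w \<in> generate G X" if "fst ` set w \<subseteq> X" for w
    using that
  proof (induction w)
    case (Cons l w)
    obtain x b where l: "l = (x, b)" by (cases l)
    then have "(if b then x else inv x) \<in> generate G X"
      using Cons.prems by (auto intro: generate.incl generate.inv)
    then show ?case using Cons l by (auto intro: generate.eng)
  qed (simp add: generate.one)
  then have "word_map G (\<lambda>x. x) ` reduced_words X \<subseteq> generate G X"
    by (auto simp: reduced_words_def)
  then show "carrier G \<subseteq> generate G X"
    using bij by (simp add: bij_betw_def)
qed

section \<open>The Magnus expansion up to degree three\<close>

type_synonym 'a vec = "'a \<Rightarrow> int"
type_synonym 'a ten2 = "'a \<Rightarrow> 'a \<Rightarrow> int"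
type_synonym 'a ten3 = "'a \<Rightarrow> 'a \<Rightarrow> 'a \<Rightarrow> int"

definition t11 :: "'a vec \<Rightarrow> 'a vec \<Rightarrow> 'a ten2" where "t11 a b = (\<lambda>x y. a x * b y)"
definition t21 :: "'a ten2 \<Rightarrow> 'a vec \<Rightarrow> 'a ten3" where "t21 a b = (\<lambda>x y z. a x y * b z)"
definition t12 :: "'a vec \<Rightarrow> 'a ten2 \<Rightarrow> 'a ten3" where "t12 a b = (\<lambda>x y z. a x * b y z)"

definition supp1 :: "'a set \<Rightarrow> 'a vec \<Rightarrow> bool" where
  "supp1 Y a \<longleftrightarrow> (\<forall>x. x \<notin> Y \<longrightarrow> a x = 0)"
definition supp2 :: "'a set \<Rightarrow> 'a ten2 \<Rightarrow> bool" where
  "supp2 Y a \<longleftrightarrow> (\<forall>x y. x \<notin> Y \<or> y \<notin> Y \<longrightarrow> a x y = 0)"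
definition supp3 :: "'a set \<Rightarrow> 'a ten3 \<Rightarrow> bool" where
  "supp3 Y a \<longleftrightarrow> (\<forall>x y z. x \<notin> Y \<or> y \<notin> Y \<or> z \<notin> Y \<longrightarrow> a x y z = 0)"

text \<open>The triple \<open>(a, b, c)\<close> stands for the noncommutative power series \<open>1 + a + b + c\<close>,
  truncated after degree three, with terms \<open>a\<close>, \<open>b\<close>, \<open>c\<close> of degree one, two and three.\<close>

definition magnus_group :: "'a set \<Rightarrow> ('a vec \<times> 'a ten2 \<times> 'a ten3) monoid" where
  "magnus_group X =
     \<lparr>carrier = {(a, b, c). \<exists>Y. finite Y \<and> Y \<subseteq> X \<and> supp1 Y a \<and> supp2 Y b \<and> supp3 Y c},
      mult = (\<lambda>(a, b, c) (a', b', c').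
        (a + a', b + t11 a a' + b', c + t21 b a' + t12 a b' + c')),
      one = (0, 0, 0)\<rparr>"

lemma magnus_carrierI:
  assumes "finite Y" "Y \<subseteq> X" "supp1 Y a" "supp2 Y b" "supp3 Y c"
  shows "(a, b, c) \<in> carrier (magnus_group X)"
  using assms by (auto simp: magnus_group_def)

lemma magnus_carrierE:
  assumes "p \<in> carrier (magnus_group X)"
  obtains a b c Y where "p = (a, b, c)" "finite Y" "Y \<subseteq> X" "supp1 Y a" "supp2 Y b" "supp3 Y c"
  using assms by (auto simp: magnus_group_def)

lemma supp_mono:
  "supp1 Y a \<Longrightarrow> Y \<subseteq> Z \<Longrightarrow> supp1 Z a"
  "supp2 Y b \<Longrightarrow> Y \<subseteq> Z \<Longrightarrow> supp2 Z b"
  "supp3 Y c \<Longrightarrow> Y \<subseteq> Z \<Longrightarrow> supp3 Z c"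
  unfolding supp1_def supp2_def supp3_def by blast+

lemma supp_add:
  "supp1 Y a \<Longrightarrow> supp1 Y a' \<Longrightarrow> supp1 Y (a + a')"
  "supp2 Y b \<Longrightarrow> supp2 Y b' \<Longrightarrow> supp2 Y (b + b')"
  "supp3 Y c \<Longrightarrow> supp3 Y c' \<Longrightarrow> supp3 Y (c + c')"
  unfolding supp1_def supp2_def supp3_def by simp_all

lemma supp_diff:
  "supp1 Y a \<Longrightarrow> supp1 Y a' \<Longrightarrow> supp1 Y (a - a')"
  "supp2 Y b \<Longrightarrow> supp2 Y b' \<Longrightarrow> supp2 Y (b - b')"
  "supp3 Y c \<Longrightarrow> supp3 Y c' \<Longrightarrow> supp3 Y (c - c')"
  unfolding supp1_def supp2_def supp3_def by simp_all

lemma supp_zero [simp]: "supp1 Y 0" "supp2 Y 0" "supp3 Y 0"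
  by (auto simp: supp1_def supp2_def supp3_def)

lemma supp_tensor:
  "supp1 Y a \<Longrightarrow> supp1 Y a' \<Longrightarrow> supp2 Y (t11 a a')"
  "supp2 Y b \<Longrightarrow> supp1 Y a' \<Longrightarrow> supp3 Y (t21 b a')"
  "supp1 Y a \<Longrightarrow> supp2 Y b' \<Longrightarrow> supp3 Y (t12 a b')"
  unfolding supp1_def supp2_def supp3_def t11_def t21_def t12_def by auto

lemmas tensor_defs = t11_def t21_def t12_def

lemma group_magnus_group: "group (magnus_group X)"
proof (rule groupI)
  fix p q assume "p \<in> carrier (magnus_group X)" "q \<in> carrier (magnus_group X)"
  then obtain a b c Y a' b' c' Y' where *: "p = (a, b, c)" "finite Y" "Y \<subseteq> X" "supp1 Y a" "supp2 Y b" "supp3 Y c"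
    "q = (a', b', c')" "finite Y'" "Y' \<subseteq> X" "supp1 Y' a'" "supp2 Y' b'" "supp3 Y' c'"
    by (elim magnus_carrierE) blast
  have "supp1 (Y \<union> Y') a" "supp2 (Y \<union> Y') b" "supp3 (Y \<union> Y') c"
    "supp1 (Y \<union> Y') a'" "supp2 (Y \<union> Y') b'" "supp3 (Y \<union> Y') c'"
    using * supp_mono[of Y _ "Y \<union> Y'"] supp_mono[of Y' _ "Y \<union> Y'"] by auto
  then have "(a + a', b + t11 a a' + b', c + t21 b a' + t12 a b' + c') \<in> carrier (magnus_group X)"
    using * by (intro magnus_carrierI[of "Y \<union> Y'"] supp_add supp_tensor) auto
  then show "p \<otimes>\<^bsub>magnus_group X\<^esub> q \<in> carrier (magnus_group X)"
    using * by (simp add: magnus_group_def)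
next
  fix p assume "p \<in> carrier (magnus_group X)"
  then obtain a b c Y where *: "p = (a, b, c)" "finite Y" "Y \<subseteq> X" "supp1 Y a" "supp2 Y b" "supp3 Y c"
    by (elim magnus_carrierE) blast
  \<comment> \<open>The left inverse is solved for degree by degree. Writing \<open>0 - a\<close>
    instead of \<open>- a\<close> lets \<open>supp_diff\<close> settle the supports.\<close>
  define a' where "a' = 0 - a"
  define b' where "b' = 0 - b - t11 a' a"
  define c' where "c' = 0 - c - t21 b' a - t12 a' b"
  have "supp1 Y a'" "supp2 Y b'" "supp3 Y c'"
    using * unfolding a'_def b'_def c'_def by (auto intro!: supp_diff supp_tensor simp del: diff_0)
  then have "(a', b', c') \<in> carrier (magnus_group X)"
    using * by (intro magnus_carrierI[of Y]) auto
  moreover have "(a', b', c') \<otimes>\<^bsub>magnus_group X\<^esub> p = \<one>\<^bsub>magnus_group X\<^esub>"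
    using * by (simp add: magnus_group_def a'_def b'_def c'_def)
  ultimately show "\<exists>q\<in>carrier (magnus_group X). q \<otimes>\<^bsub>magnus_group X\<^esub> p = \<one>\<^bsub>magnus_group X\<^esub>"
    by blast
qed (auto simp: magnus_group_def fun_eq_iff tensor_defs algebra_simps)

definition delta :: "'a \<Rightarrow> 'a vec" where "delta x = (\<lambda>y. if y = x then 1 else 0)"

text \<open>The homomorphism to \<open>magnus_group X\<close> sending a generator \<open>x\<close>
  to \<open>1 + x\<close>, split into its components. The functions take values with finite support,
  which later permits bases of finite rank.\<close>

lemma magnus_expansion:
  assumes "group F" "free_on F X"
  shows "\<exists>d1 d2 d3.
     (\<forall>g\<in>carrier F. \<forall>h\<in>carrier F. 
        d1 (g \<otimes>\<^bsub>F\<^esub> h) = d1 g + d1 h \<and>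
        d2 (g \<otimes>\<^bsub>F\<^esub> h) = d2 g + t11 (d1 g) (d1 h) + d2 h \<and>
        d3 (g \<otimes>\<^bsub>F\<^esub> h) = d3 g + t21 (d2 g) (d1 h) + t12 (d1 g) (d2 h) + d3 h) \<and>
     (\<forall>x\<in>X. d1 x = delta x) \<and>
     (\<forall>g\<in>carrier F. \<exists>Y. finite Y \<and> Y \<subseteq> X \<and> supp1 Y (d1 g) \<and> supp2 Y (d2 g) \<and> supp3 Y (d3 g))"
proof -
  have "(\<lambda>x. (delta x, 0, 0)) \<in> X \<rightarrow> carrier (magnus_group X)"
    by (auto intro!: magnus_carrierI[of "{_}"] simp: supp1_def delta_def)
  from free_on_universal[OF assms(1) group_magnus_group assms(2) this]
  obtain h where h: "h \<in> hom F (magnus_group X)" "\<And>x. x \<in> X \<Longrightarrow> h x = (delta x, 0, 0)"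
    by blast
  have 1: "h g \<in> carrier (magnus_group X)" if "g \<in> carrier F" for g
    using h(1) that by (rule hom_in_carrier)
  have 2: "h (g \<otimes>\<^bsub>F\<^esub> g') = h g \<otimes>\<^bsub>magnus_group X\<^esub> h g'" if "g \<in> carrier F" "g' \<in> carrier F" for g g'
    using h(1) that by (rule hom_mult)
  show ?thesis
    apply (rule exI[of _ "\<lambda>g. fst (h g)"], rule exI[of _ "\<lambda>g. fst (snd (h g))"], rule exI[of _ "\<lambda>g. snd (snd (h g))"])
    using h(2) apply (simp add: 2)
    by (auto simp: magnus_group_def split: prod.splits dest!: 1)
qed

section \<open>Commutators and the lower central series\<close>

definition commutator :: "('a, 'b) monoid_scheme \<Rightarrow> 'a \<Rightarrow> 'a \<Rightarrow> 'a" where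
  "commutator G x y = x \<otimes>\<^bsub>G\<^esub> y \<otimes>\<^bsub>G\<^esub> inv\<^bsub>G\<^esub> x \<otimes>\<^bsub>G\<^esub> inv\<^bsub>G\<^esub> y"

lemma commutator_subgroup_eq:
  "commutator_subgroup G H K = generate G {commutator G h k | h k. h \<in> H \<and> k \<in> K}"
  unfolding commutator_subgroup_def commutator_def by (rule arg_cong[of _ _ "generate G"]) auto

context group
begin

lemma cancel_left_inv [simp]:
  "x \<in> carrier G \<Longrightarrow> y \<in> carrier G \<Longrightarrow> inv x \<otimes> (x \<otimes> y) = y"
  "x \<in> carrier G \<Longrightarrow> y \<in> carrier G \<Longrightarrow> x \<otimes> (inv x \<otimes> y) = y"
  by (simp_all add: m_assoc[symmetric])

lemmas group_normalize = commutator_def m_assoc inv_mult_group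

lemma commutator_closed [simp]:
  "x \<in> carrier G \<Longrightarrow> y \<in> carrier G \<Longrightarrow> commutator G x y \<in> carrier G"
  by (simp add: commutator_def)

lemma inv_commutator:
  "x \<in> carrier G \<Longrightarrow> y \<in> carrier G \<Longrightarrow> inv (commutator G x y) = commutator G y x"
  by (simp add: group_normalize)

lemma conj_eq_commutator:
  "x \<in> carrier G \<Longrightarrow> y \<in> carrier G \<Longrightarrow> x \<otimes> y \<otimes> inv x = commutator G x y \<otimes> y"
  by (simp add: group_normalize)

lemma mult_eq_commutator:
  "x \<in> carrier G \<Longrightarrow> y \<in> carrier G \<Longrightarrow> x \<otimes> y = commutator G x y \<otimes> (y \<otimes> x)"
  by (simp add: group_normalize)

lemma commutator_mult_left:
  assumes "u \<in> carrier G" "v \<in> carrier G" "x \<in> carrier G"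
  shows "commutator G (u \<otimes> v) x =
    commutator G u (commutator G v x) \<otimes> commutator G v x \<otimes> commutator G u x"
  using assms by (simp add: group_normalize)

lemma commutator_mult_right:
  assumes "u \<in> carrier G" "v \<in> carrier G" "x \<in> carrier G"
  shows "commutator G x (u \<otimes> v) =
    commutator G x u \<otimes> commutator G u (commutator G x v) \<otimes> commutator G x v"
  using assms by (simp add: group_normalize)

lemma commutator_inv_left:
  assumes "u \<in> carrier G" "x \<in> carrier G"
  shows "commutator G (inv u) x =
    commutator G (inv u) (commutator G x u) \<otimes> commutator G x u"
  using assms by (simp add: group_normalize)

lemma commutator_inv_right:
  assumes "u \<in> carrier G" "x \<in> carrier G"
  shows "commutator G x (inv u) =
    commutator G (inv u) (commutator G u x) \<otimes> commutator G u x"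
  using assms by (simp add: group_normalize)

text \<open>Serves to remove the conjugated arguments of \<open>hall_witt\<close>: conjugation of
  the second argument is traded for multiplying the first one by a commutator, which lies one step
  further down the lower central series.\<close>

lemma commutator_conj:
  assumes "c \<in> carrier G" "y \<in> carrier G" "z \<in> carrier G"
  shows "commutator G c (y \<otimes> z \<otimes> inv y) = y \<otimes> commutator G (commutator G (inv y) c \<otimes> c) z \<otimes> inv y"
  using assms by (simp add: group_normalize)

lemma hall_witt:
  assumes "x \<in> carrier G" "y \<in> carrier G" "z \<in> carrier G"
  shows "commutator G (commutator G x y) (y \<otimes> z \<otimes> inv y)
    \<otimes> commutator G (commutator G y z) (z \<otimes> x \<otimes> inv z)
    \<otimes> commutator G (commutator G z x) (x \<otimes> y \<otimes> inv x) = \<one>"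
  using assms by (simp add: group_normalize)

section \<open>Generation and bimultiplicativity in the lower central series\<close>

abbreviation lc :: "nat \<Rightarrow> 'a set" where "lc \<equiv> lower_central G"

lemma lc_1: "lc (Suc 0) = carrier G"
  by (simp add: lower_central_def)

lemma lc_Suc: "lc (Suc (Suc n)) = generate G {commutator G h k | h k. h \<in> lc (Suc n) \<and> k \<in> carrier G}"
  by (simp add: lower_central_def commutator_subgroup_eq)

lemma subgroup_lc: "subgroup (lc (Suc n)) G"
proof (induction n)
  case (Suc n)
  then have "lc (Suc n) \<subseteq> carrier G" by (rule subgroup.subset)
  then show ?case unfolding lc_Suc by (intro generate_is_subgroup) auto
qed (simp add: lc_1 subgroup_self)

lemma lc_carrier: "u \<in> lc (Suc n) \<Longrightarrow> u \<in> carrier G"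
  using subgroup.subset[OF subgroup_lc] by blast

lemma commutator_in_lc:
  assumes "u \<in> lc (Suc n)" "g \<in> carrier G"
  shows "commutator G u g \<in> lc (Suc (Suc n))" "commutator G g u \<in> lc (Suc (Suc n))"
proof -
  show "commutator G u g \<in> lc (Suc (Suc n))"
    unfolding lc_Suc using assms by (intro generate.incl) auto
  then have "inv (commutator G u g) \<in> lc (Suc (Suc n))"
    using subgroup.m_inv_closed[OF subgroup_lc] by blast
  then show "commutator G g u \<in> lc (Suc (Suc n))"
    using assms lc_carrier by (simp add: inv_commutator)
qed

lemma lc_mono: "lc (Suc (Suc n)) \<subseteq> lc (Suc n)"
proof (induction n)
  case 0
  then show ?case using subgroup.subset[OF subgroup_lc] by (simp add: lc_1)
next
  case (Suc n)
  then show ?case unfolding lc_Suc[of "Suc n"] lc_Suc[of n] by (intro mono_generate) auto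
qed

lemma generate_subset_subgroup: "subgroup H G \<Longrightarrow> K \<subseteq> H \<Longrightarrow> generate G K \<subseteq> H"
  using generate_subgroup_incl by blast

text \<open>Modulo \<open>lc (n + 3)\<close> the commutator is bimultiplicative on \<open>lc (n + 1) \<times> G\<close>.\<close>

lemma subgroup_commutator_left:
  assumes "subgroup K G" "lc (Suc (Suc (Suc n))) \<subseteq> K" "x \<in> carrier G"
  shows "subgroup {u \<in> lc (Suc n). commutator G u x \<in> K} G"
proof
  show "{u \<in> lc (Suc n). commutator G u x \<in> K} \<subseteq> carrier G" using lc_carrier by auto
  show "\<one> \<in> {u \<in> lc (Suc n). commutator G u x \<in> K}"
    using assms(1,3) subgroup.one_closed[OF subgroup_lc] subgroup.one_closed by (simp add: commutator_def)
  fix u assume u: "u \<in> {u \<in> lc (Suc n). commutator G u x \<in> K}"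
  have uc: "u \<in> carrier G" using u lc_carrier by auto
  have "commutator G x u \<in> lc (Suc (Suc n))" using u commutator_in_lc assms by auto
  then have "commutator G (inv u) (commutator G x u) \<in> K"
    using commutator_in_lc uc assms by blast
  moreover have "commutator G x u \<in> K"
    using u subgroup.m_inv_closed[OF assms(1)] inv_commutator[OF uc assms(3)] by fastforce
  ultimately have "commutator G (inv u) x \<in> K"
    unfolding commutator_inv_left[OF uc assms(3)] by (rule subgroup.m_closed[OF assms(1)])
  then show "inv u \<in> {u \<in> lc (Suc n). commutator G u x \<in> K}"
    using u subgroup.m_inv_closed[OF subgroup_lc] by blast
  fix v assume v: "v \<in> {u \<in> lc (Suc n). commutator G u x \<in> K}"
  have vc: "v \<in> carrier G" using v lc_carrier by auto
  have "commutator G v x \<in> lc (Suc (Suc n))" using v commutator_in_lc assms by auto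
  then have "commutator G u (commutator G v x) \<in> K"
    using commutator_in_lc uc assms by blast
  then have "commutator G (u \<otimes> v) x \<in> K"
    unfolding commutator_mult_left[OF uc vc assms(3)] using u v
    by (intro subgroup.m_closed[OF assms(1)]) auto
  then show "u \<otimes> v \<in> {u \<in> lc (Suc n). commutator G u x \<in> K}"
    using u v subgroup.m_closed[OF subgroup_lc] by blast
qed

lemma subgroup_commutator_right:
  assumes "subgroup K G" "lc (Suc (Suc (Suc n))) \<subseteq> K" "u \<in> lc (Suc n)"
  shows "subgroup {x \<in> carrier G. commutator G u x \<in> K} G"
proof
  have uc: "u \<in> carrier G" using assms lc_carrier by auto
  show "{x \<in> carrier G. commutator G u x \<in> K} \<subseteq> carrier G" by auto
  show "\<one> \<in> {x \<in> carrier G. commutator G u x \<in> K}"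
    using assms(1) uc subgroup.one_closed by (simp add: commutator_def)
  fix x assume x: "x \<in> {x \<in> carrier G. commutator G u x \<in> K}"
  have "commutator G x u \<in> lc (Suc (Suc n))" using x commutator_in_lc assms by auto
  then have "commutator G (inv x) (commutator G x u) \<in> K"
    using commutator_in_lc x assms by blast
  moreover have "commutator G x u \<in> K"
    using x subgroup.m_inv_closed[OF assms(1)] inv_commutator[OF uc, of x] by fastforce
  ultimately have "commutator G u (inv x) \<in> K"
    using x uc by (subst commutator_inv_right) (auto intro!: subgroup.m_closed[OF assms(1)])
  then show "inv x \<in> {x \<in> carrier G. commutator G u x \<in> K}"
    using x by blast
  fix y assume y: "y \<in> {x \<in> carrier G. commutator G u x \<in> K}"
  have "commutator G u y \<in> lc (Suc (Suc n))" using y commutator_in_lc assms by auto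
  then have "commutator G x (commutator G u y) \<in> K"
    using commutator_in_lc x assms by blast
  then have "commutator G u (x \<otimes> y) \<in> K"
    using x y by (subst commutator_mult_right) (auto intro!: subgroup.m_closed[OF assms(1)] uc)
  then show "x \<otimes> y \<in> {x \<in> carrier G. commutator G u x \<in> K}"
    using x y by blast
qed

text \<open>Bimultiplicativity modulo gamma_{n+3} reduces generators of gamma_{n+2} to commutators
  [t, x], with \<open>t\<close> from generators of gamma_{n+1} modulo gamma_{n+2} and
  \<open>x\<close> from generators of the group. The two arguments are extended one after the
  other.\<close>

lemma lc_Suc_subset:
  assumes "generate G X = carrier G" "X \<subseteq> carrier G"
    "lc (Suc n) \<subseteq> generate G (T \<union> lc (Suc (Suc n)))"
    "T \<subseteq> lc (Suc n)"
    "subgroup K G" "lc (Suc (Suc (Suc n))) \<subseteq> K"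
    "\<And>t x. t \<in> T \<Longrightarrow> x \<in> X \<Longrightarrow> commutator G t x \<in> K"
  shows "lc (Suc (Suc n)) \<subseteq> K"
proof -
  have 1: "commutator G u x \<in> K" if u: "u \<in> lc (Suc n)" and x: "x \<in> X" for u x
  proof -
    have "generate G (T \<union> lc (Suc (Suc n))) \<subseteq> {u \<in> lc (Suc n). commutator G u x \<in> K}"
    proof (rule generate_subset_subgroup)
      show "subgroup {u \<in> lc (Suc n). commutator G u x \<in> K} G"
        using assms(2,5,6) x by (intro subgroup_commutator_left) auto
      have "commutator G v x \<in> K" if "v \<in> lc (Suc (Suc n))" for v
        using commutator_in_lc(1)[OF that, of x] assms(2,6) x by auto
      then show "T \<union> lc (Suc (Suc n)) \<subseteq> {u \<in> lc (Suc n). commutator G u x \<in> K}"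
        using assms(4,7) x lc_mono[of n] by auto
    qed
    then show ?thesis using u assms by auto
  qed
  have 2: "commutator G u g \<in> K" if u: "u \<in> lc (Suc n)" and g: "g \<in> carrier G" for u g
  proof -
    have "generate G X \<subseteq> {x \<in> carrier G. commutator G u x \<in> K}"
      using assms 1 u by (intro generate_subset_subgroup subgroup_commutator_right) auto
    then show ?thesis using g assms by auto
  qed
  show ?thesis
    unfolding lc_Suc[of n] using 2 assms by (intro generate_subset_subgroup) auto
qed

lemma additive_int_pow:
  fixes D :: "'a \<Rightarrow> int"
  assumes "subgroup H G" "\<And>a b. a \<in> H \<Longrightarrow> b \<in> H \<Longrightarrow> D (a \<otimes> b) = D a + D b" "s \<in> H"
  shows "D (s [^] (k::int)) = k * D s"
proof -
  have sc: "s \<in> carrier G" using assms subgroup.mem_carrier by metis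
  have 0: "D \<one> = 0" using assms(2)[of \<one> \<one>] assms(1) subgroup.one_closed by fastforce
  have n: "s [^] (n::nat) \<in> H \<and> D (s [^] n) = int n * D s" for n
    by (induction n) (auto simp: 0 assms subgroup.one_closed subgroup.m_closed algebra_simps)
  show ?thesis
  proof (cases k)
    case (nonneg n)
    then show ?thesis using n by (simp add: int_pow_int)
  next
    case (neg n)
    have h: "s [^] Suc n \<in> H" "inv (s [^] Suc n) \<in> H"
      using n[of "Suc n"] subgroup.m_inv_closed[OF assms(1)] by (simp_all del: nat_pow_Suc)
    have "s [^] Suc n \<in> carrier G" using subgroup.mem_carrier[OF assms(1) h(1)] .
    then have "D (inv (s [^] Suc n)) = - D (s [^] Suc n)"
      using assms(2)[OF h] 0 by (simp del: nat_pow_Suc)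
    moreover have "s [^] k = inv (s [^] Suc n)"
      using int_pow_neg_int[OF sc, of "Suc n"] neg by metis
    ultimately have "D (s [^] k) = - (int (Suc n) * D s)" using n[of "Suc n"] by metis
    then show ?thesis using neg by (metis mult_minus_left)
  qed
qed

lemma generate_finite_index:
  assumes "w \<in> generate G (s ` I \<union> N)"
  shows "\<exists>J. finite J \<and> J \<subseteq> I \<and> w \<in> generate G (s ` J \<union> N)"
  using assms
proof induction
  case one
  then show ?case by (intro exI[of _ "{}"]) (auto intro: generate.one)
next
  case (incl h)
  then show ?case
  proof
    assume "h \<in> s ` I"
    then obtain i where "i \<in> I" "h = s i" by auto
    then show ?thesis by (intro exI[of _ "{i}"]) (auto intro: generate.incl)
  qed (intro exI[of _ "{}"], auto intro: generate.incl)
next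
  case (inv h)
  then show ?case
  proof
    assume "h \<in> s ` I"
    then obtain i where "i \<in> I" "h = s i" by auto
    then show ?thesis by (intro exI[of _ "{i}"]) (auto intro: generate.inv)
  qed (intro exI[of _ "{}"], auto intro: generate.inv)
next
  case (eng h1 h2)
  then obtain J1 J2 where J: "finite J1" "J1 \<subseteq> I" "h1 \<in> generate G (s ` J1 \<union> N)"
    "finite J2" "J2 \<subseteq> I" "h2 \<in> generate G (s ` J2 \<union> N)" by blast
  then have "h1 \<in> generate G (s ` (J1 \<union> J2) \<union> N)" "h2 \<in> generate G (s ` (J1 \<union> J2) \<union> N)"
    using mono_generate[of "s ` J1 \<union> N" "s ` (J1 \<union> J2) \<union> N"]
      mono_generate[of "s ` J2 \<union> N" "s ` (J1 \<union> J2) \<union> N"] by auto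
  then show ?case using J by (intro exI[of _ "J1 \<union> J2"]) (auto intro: generate.eng)
qed

lemma independent_generators:
  fixes D :: "'i \<Rightarrow> 'a \<Rightarrow> int"
  assumes H: "subgroup H G" and N: "subgroup N G" "N \<subseteq> H"
    and comm: "\<And>a b. a \<in> H \<Longrightarrow> b \<in> H \<Longrightarrow> commutator G a b \<in> N"
    and s: "\<And>i. i \<in> I \<Longrightarrow> s i \<in> H"
    and D: "\<And>i a b. i \<in> I \<Longrightarrow> a \<in> H \<Longrightarrow> b \<in> H \<Longrightarrow> D i (a \<otimes> b) = D i a + D i b"
    and DN: "\<And>i a. i \<in> I \<Longrightarrow> a \<in> N \<Longrightarrow> D i a = 0"
    and Ds: "\<And>i j. i \<in> I \<Longrightarrow> j \<in> I \<Longrightarrow> D i (s j) = 0 \<longleftrightarrow> i \<noteq> j"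
    and w: "w \<in> generate G (s ` I \<union> N)" "\<And>i. i \<in> I \<Longrightarrow> D i w = 0"
  shows "w \<in> N"
proof -
  have Hc: "a \<in> carrier G" if "a \<in> H" for a using H that subgroup.mem_carrier by metis
  have KH: "generate G (s ` J \<union> N) \<subseteq> H" if "J \<subseteq> I" for J
    using H N s that by (intro generate_subset_subgroup) auto
  have Ksub: "subgroup (generate G (s ` J \<union> N)) G" if "J \<subseteq> I" for J
    using N s that Hc by (intro generate_is_subgroup) blast
  have NK: "N \<subseteq> generate G (s ` J \<union> N)" for J by (auto intro: generate.incl)
  have step: "\<exists>k::int. \<exists>v \<in> generate G (s ` J \<union> N). u = s j [^] k \<otimes> v"
    if u: "u \<in> generate G (s ` insert j J \<union> N)" and j: "j \<in> I" and J: "J \<subseteq> I" for j J u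
  proof -
    let ?K = "generate G (s ` J \<union> N)"
    have sj: "s j \<in> H" "s j \<in> carrier G" using s Hc j by auto
    have K1: "\<one> \<in> ?K" using Ksub[OF J] by (rule subgroup.one_closed)
    have Kc: "a \<in> carrier G" if "a \<in> ?K" for a using Ksub[OF J] that subgroup.mem_carrier by metis
    have triv: "\<exists>k::int. \<exists>v \<in> ?K. h = s j [^] k \<otimes> v" if "h \<in> ?K" for h
      using that Kc by (intro exI[of _ 0] bexI[of _ h]) auto
    show ?thesis
      using u
    proof induction
      case one
      then show ?case using triv K1 by blast
    next
      case (incl h)
      then consider "h = s j" | "h \<in> s ` J \<union> N" by auto
      then show ?case
      proof cases
        case 1
        then show ?thesis using K1 sj by (intro exI[of _ 1] bexI[of _ \<one>]) auto
      next
        case 2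
        then show ?thesis by (intro triv) (auto intro: generate.incl)
      qed
    next
      case (inv h)
      then consider "h = s j" | "h \<in> s ` J \<union> N" by auto
      then show ?case
      proof cases
        case 1
        then show ?thesis using K1 sj by (intro exI[of _ "-1"] bexI[of _ \<one>]) (auto simp: int_pow_neg)
      next
        case 2
        then show ?thesis by (intro triv) (auto intro: generate.inv)
      qed
    next
      case (eng h1 h2)
      then obtain k l :: int and v v' where e: "v \<in> ?K" "v' \<in> ?K"
        "h1 = s j [^] k \<otimes> v" "h2 = s j [^] l \<otimes> v'" by blast
      \<comment> \<open>Collecting the powers of \<open>s j\<close> on the left conjugates
        \<open>v\<close>; by \<open>comm\<close> the conjugate differs from \<open>v\<close> by an
        element of \<open>N\<close>.\<close>
      let ?c = "inv (s j [^] l) \<otimes> v \<otimes> s j [^] l"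
      have slH: "s j [^] l \<in> H" using sj(1) H by (simp add: subgroup_int_pow_closed)
      have isl: "inv (s j [^] l) \<in> H" using H slH subgroup.m_inv_closed by metis
      have "?c = commutator G (inv (s j [^] l)) v \<otimes> v"
        using conj_eq_commutator[of "inv (s j [^] l)" v] Hc isl slH Kc e by simp
      moreover have "commutator G (inv (s j [^] l)) v \<in> ?K"
        using comm isl KH[OF J] e(1) NK by blast
      ultimately have c: "?c \<in> ?K" using e(1) by (simp add: generate.eng)
      have "h1 \<otimes> h2 = s j [^] (k + l) \<otimes> (?c \<otimes> v')"
        using e Kc sj Hc[OF slH] by (simp add: int_pow_mult m_assoc)
      then show ?case using c e(2) generate.eng by metis
    qed
  qed
  have main: "u \<in> N" if "finite J" "J \<subseteq> I" "u \<in> generate G (s ` J \<union> N)" "\<And>i. i \<in> I \<Longrightarrow> D i u = 0" for J u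
    using that
  proof (induction J arbitrary: u rule: finite_induct)
    case empty
    then show ?case using generate_subset_subgroup[OF N(1), of N] by auto
  next
    case (insert j J)
    then obtain k :: int and v where e: "v \<in> generate G (s ` J \<union> N)" "u = s j [^] k \<otimes> v"
      using step[of u j J] by blast
    have j: "j \<in> I" "J \<subseteq> I" using insert by auto
    have vH: "v \<in> H" using e KH[OF j(2)] by auto
    have sk: "s j [^] k \<in> H" using s j H by (simp add: subgroup_int_pow_closed)
    have "D j v = 0"
    proof -
      have z: "subgroup {h \<in> H. D j h = 0} G"
      proof
        show "{h \<in> H. D j h = 0} \<subseteq> carrier G" using Hc by auto
        have "\<one> \<in> N" using N subgroup.one_closed by blast
        then show "\<one> \<in> {h \<in> H. D j h = 0}" using DN j N by auto
        fix x assume x: "x \<in> {h \<in> H. D j h = 0}"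
        then have ix: "inv x \<in> H" using H subgroup.m_inv_closed by fastforce
        have "D j (x \<otimes> inv x) = D j x + D j (inv x)" using D j x ix by auto
        then show "inv x \<in> {h \<in> H. D j h = 0}" using x ix Hc DN j \<open>\<one> \<in> N\<close> by auto
        fix y assume y: "y \<in> {h \<in> H. D j h = 0}"
        then show "x \<otimes> y \<in> {h \<in> H. D j h = 0}" using x D j H subgroup.m_closed by fastforce
      qed
      have "generate G (s ` J \<union> N) \<subseteq> {h \<in> H. D j h = 0}"
      proof (rule generate_subset_subgroup[OF z])
        have "s i \<in> H \<and> D j (s i) = 0" if "i \<in> J" for i
          using that j insert.hyps s[of i] Ds[of j i] by auto
        then show "s ` J \<union> N \<subseteq> {h \<in> H. D j h = 0}"
          using N DN[OF j(1)] by auto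
      qed
      then show ?thesis using e by auto
    qed
    then have "k * D j (s j) = 0"
      using insert.prems(3)[OF j(1)] e(2) D[OF j(1) sk vH] additive_int_pow[of H "D j" "s j" k] H D j s by simp
    then have "k = 0" using Ds[OF j(1) j(1)] by simp
    then have "u = v" using e(2) Hc[OF vH] by simp
    then show ?case using insert e j by auto
  qed
  show ?thesis using generate_finite_index[OF w(1)] main w(2) by blast
qed

end

section \<open>The quotients of the lower central series of a free group\<close>

text \<open>The order \<open>lt\<close> is not tied to the group structure: it selects the basic
  commutators and, for a Lie tensor, the words whose coefficients determine it.\<close>

locale magnus_coordinates = group G for G (structure) +
  fixes X :: "'a set" and lt :: "'a \<Rightarrow> 'a \<Rightarrow> bool"
    and d1 :: "'a \<Rightarrow> 'a vec" and d2 :: "'a \<Rightarrow> 'a ten2" and d3 :: "'a \<Rightarrow> 'a ten3"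
  assumes X_carrier: "X \<subseteq> carrier G" and generate_X: "generate G X = carrier G"
    and lt_irrefl: "\<not> lt x x" and lt_trans: "lt x y \<Longrightarrow> lt y z \<Longrightarrow> lt x z"
    and lt_total: "lt x y \<or> x = y \<or> lt y x"
    and d1_mult: "g \<in> carrier G \<Longrightarrow> h \<in> carrier G \<Longrightarrow> d1 (g \<otimes> h) = d1 g + d1 h"
    and d2_mult: "g \<in> carrier G \<Longrightarrow> h \<in> carrier G \<Longrightarrow>
      d2 (g \<otimes> h) = d2 g + t11 (d1 g) (d1 h) + d2 h"
    and d3_mult: "g \<in> carrier G \<Longrightarrow> h \<in> carrier G \<Longrightarrow>
      d3 (g \<otimes> h) = d3 g + t21 (d2 g) (d1 h) + t12 (d1 g) (d2 h) + d3 h"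
    and d1_X: "x \<in> X \<Longrightarrow> d1 x = delta x"
    and finite_support: "g \<in> carrier G \<Longrightarrow>
      \<exists>Y. finite Y \<and> Y \<subseteq> X \<and> supp1 Y (d1 g) \<and> supp2 Y (d2 g) \<and> supp3 Y (d3 g)"
begin

lemma X_in_carrier [simp]: "x \<in> X \<Longrightarrow> x \<in> carrier G"
  using X_carrier by blast

abbreviation "lc2 \<equiv> lc (Suc (Suc 0))"
abbreviation "lc3 \<equiv> lc (Suc (Suc (Suc 0)))"
abbreviation "lc4 \<equiv> lc (Suc (Suc (Suc (Suc 0))))"

section \<open>Terms of commutators and of elements of the lower central series\<close>

lemma tensor_zero [simp]:
  "t11 0 b = 0" "t11 a 0 = 0" "t21 0 b = 0" "t21 c 0 = 0" "t12 0 c = 0" "t12 a 0 = 0"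
  by (auto simp: tensor_defs fun_eq_iff)

lemma d_one [simp]: "d1 \<one> = 0" "d2 \<one> = 0" "d3 \<one> = 0"
proof -
  show 1: "d1 \<one> = 0" using d1_mult[of \<one> \<one>] by simp
  show 2: "d2 \<one> = 0" using d2_mult[of \<one> \<one>] 1 by simp
  show "d3 \<one> = 0" using d3_mult[of \<one> \<one>] 1 2 by simp
qed

lemma d1_inv: "g \<in> carrier G \<Longrightarrow> d1 (inv g) = - d1 g"
  using d1_mult[of g "inv g"] by (simp add: add_eq_0_iff)

lemma d2_inv: "g \<in> carrier G \<Longrightarrow> d1 g = 0 \<Longrightarrow> d2 (inv g) = - d2 g"
  using d2_mult[of g "inv g"] by (simp add: add_eq_0_iff)

lemma d3_inv: "g \<in> carrier G \<Longrightarrow> d1 g = 0 \<Longrightarrow> d3 (inv g) = - d3 g"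
  using d3_mult[of g "inv g"] d1_inv[of g] by (simp add: add_eq_0_iff)

text \<open>Here and in the next two lemmas the expansions of both sides of x y = [x, y] (y x) are
  compared, which avoids the expansion of inverses.\<close>

lemma d1_commutator:
  assumes "x \<in> carrier G" "y \<in> carrier G"
  shows "d1 (commutator G x y) = 0"
proof -
  have "d1 (x \<otimes> y) = d1 (commutator G x y \<otimes> (y \<otimes> x))"
    using assms by (subst mult_eq_commutator) auto
  then show ?thesis using assms by (simp add: d1_mult)
qed

lemma d2_commutator:
  assumes "x \<in> carrier G" "y \<in> carrier G"
  shows "d2 (commutator G x y) = t11 (d1 x) (d1 y) - t11 (d1 y) (d1 x)"
proof -
  have "d2 (x \<otimes> y) = d2 (commutator G x y \<otimes> (y \<otimes> x))"
    using assms by (subst mult_eq_commutator) auto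
  then show ?thesis using assms by (simp add: d2_mult d1_commutator algebra_simps)
qed

lemma d3_commutator_general:
  assumes "x \<in> carrier G" "y \<in> carrier G"
  shows "d3 (commutator G x y) =
    (t21 (d2 x) (d1 y) + t12 (d1 x) (d2 y)) - (t21 (d2 y) (d1 x) + t12 (d1 y) (d2 x))
      - t21 (t11 (d1 x) (d1 y) - t11 (d1 y) (d1 x)) (d1 x + d1 y)"
proof -
  have "d3 (x \<otimes> y) = d3 (commutator G x y \<otimes> (y \<otimes> x))"
    using assms by (subst mult_eq_commutator) auto
  then show ?thesis
    using assms by (simp add: d3_mult d1_mult d2_mult d1_commutator d2_commutator algebra_simps)
qed

lemma d3_commutator:
  assumes "u \<in> carrier G" "x \<in> carrier G" "d1 u = 0"
  shows "d3 (commutator G u x) = t21 (d2 u) (d1 x) - t12 (d1 x) (d2 u)"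
  using assms by (simp add: d3_commutator_general)

lemma subgroup_d1_zero: "subgroup {u \<in> carrier G. d1 u = 0} G"
  by unfold_locales (auto simp: d1_mult d1_inv)

lemma subgroup_d2_zero: "subgroup {u \<in> carrier G. d1 u = 0 \<and> d2 u = 0} G"
  by unfold_locales (auto simp: d1_mult d1_inv d2_mult d2_inv)

lemma subgroup_d3_zero: "subgroup {u \<in> carrier G. d1 u = 0 \<and> d2 u = 0 \<and> d3 u = 0} G"
  by unfold_locales (auto simp: d1_mult d1_inv d2_mult d2_inv d3_mult d3_inv)

lemma lc2_d1: "u \<in> lc2 \<Longrightarrow> d1 u = 0"
proof -
  have "lc2 \<subseteq> {u \<in> carrier G. d1 u = 0}"
    unfolding lc_Suc lc_1 by (intro generate_subset_subgroup subgroup_d1_zero) (auto simp: d1_commutator)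
  then show "u \<in> lc2 \<Longrightarrow> d1 u = 0" by blast
qed

lemma lc3_d2: "u \<in> lc3 \<Longrightarrow> d2 u = 0"
proof -
  have "lc3 \<subseteq> {u \<in> carrier G. d1 u = 0 \<and> d2 u = 0}"
    unfolding lc_Suc[of "Suc 0"] using lc_carrier
    by (intro generate_subset_subgroup subgroup_d2_zero) (auto simp: d1_commutator d2_commutator lc2_d1)
  then show "u \<in> lc3 \<Longrightarrow> d2 u = 0" by blast
qed

lemma lc3_d1: "u \<in> lc3 \<Longrightarrow> d1 u = 0"
  using lc2_d1 lc_mono by blast

lemma lc4_d3: "u \<in> lc4 \<Longrightarrow> d3 u = 0"
proof -
  have "lc4 \<subseteq> {u \<in> carrier G. d1 u = 0 \<and> d2 u = 0 \<and> d3 u = 0}"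
    unfolding lc_Suc[of "Suc (Suc 0)"] using lc_carrier
    by (intro generate_subset_subgroup subgroup_d3_zero)
       (auto simp: d1_commutator d2_commutator d3_commutator lc3_d1 lc3_d2)
  then show "u \<in> lc4 \<Longrightarrow> d3 u = 0" by blast
qed

lemma lc2_d2_antisymmetric:
  assumes "u \<in> lc2"
  shows "d2 u x y + d2 u y x = 0"
proof -
  have s: "subgroup {u \<in> carrier G. d1 u = 0 \<and> d2 u x y + d2 u y x = 0} G"
    by unfold_locales (auto simp: d1_mult d1_inv d2_mult d2_inv)
  have "lc2 \<subseteq> {u \<in> carrier G. d1 u = 0 \<and> d2 u x y + d2 u y x = 0}"
    unfolding lc_Suc lc_1
    by (intro generate_subset_subgroup s) (auto simp: d1_commutator d2_commutator t11_def)
  then show ?thesis using assms by blast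
qed

text \<open>Ree's conditions for a tensor of degree three to be a Lie element.\<close>

definition shuffle_free :: "'a ten3 \<Rightarrow> bool" where
  "shuffle_free t \<longleftrightarrow>
     (\<forall>x y z. t x y z - t z y x = 0 \<and> t x y z + t y x z + t y z x = 0)"

lemma shuffle_freeD:
  "shuffle_free t \<Longrightarrow> t x y z - t z y x = 0"
  "shuffle_free t \<Longrightarrow> t x y z + t y x z + t y z x = 0"
  unfolding shuffle_free_def by blast+

lemma shuffle_freeI:
  "(\<And>x y z. t x y z - t z y x = 0) \<Longrightarrow> (\<And>x y z. t x y z + t y x z + t y z x = 0)
    \<Longrightarrow> shuffle_free t"
  unfolding shuffle_free_def by blast

lemma shuffle_free_add:
  assumes "shuffle_free s" "shuffle_free t"
  shows "shuffle_free (s + t)"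
proof (rule shuffle_freeI)
  fix x y z
  show "(s + t) x y z - (s + t) z y x = 0"
    using shuffle_freeD(1)[OF assms(1), of x y z] shuffle_freeD(1)[OF assms(2), of x y z]
    unfolding plus_fun_apply by linarith
  show "(s + t) x y z + (s + t) y x z + (s + t) y z x = 0"
    using shuffle_freeD(2)[OF assms(1), of x y z] shuffle_freeD(2)[OF assms(2), of x y z]
    unfolding plus_fun_apply by linarith
qed

lemma shuffle_free_minus:
  assumes "shuffle_free t"
  shows "shuffle_free (- t)"
proof (rule shuffle_freeI)
  fix x y z
  show "(- t) x y z - (- t) z y x = 0"
    using shuffle_freeD(1)[OF assms, of x y z] unfolding uminus_apply by linarith
  show "(- t) x y z + (- t) y x z + (- t) y z x = 0"
    using shuffle_freeD(2)[OF assms, of x y z] unfolding uminus_apply by linarith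
qed

lemma lc3_d3_shuffle_free:
  assumes "u \<in> lc3"
  shows "shuffle_free (d3 u)"
proof -
  have s: "subgroup {u \<in> carrier G. d1 u = 0 \<and> d2 u = 0 \<and> shuffle_free (d3 u)} G"
    by unfold_locales
      (auto simp: d1_mult d1_inv d2_mult d2_inv d3_mult d3_inv
        intro: shuffle_free_add shuffle_free_minus, simp add: shuffle_free_def)
  have g: "shuffle_free (d3 (commutator G u v))" if u: "u \<in> lc2" and v: "v \<in> carrier G" for u v
  proof -
    have e: "d3 (commutator G u v) x y z = d2 u x y * d1 v z - d1 v x * d2 u y z" for x y z
      using u v by (simp add: d3_commutator lc2_d1 lc_carrier t21_def t12_def)
    have a: "d2 u y x = - d2 u x y" for x y
      using lc2_d2_antisymmetric[OF u, of x y] by simp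
    have "d3 (commutator G u v) x y z - d3 (commutator G u v) z y x = 0"
      "d3 (commutator G u v) x y z + d3 (commutator G u v) y x z + d3 (commutator G u v) y z x = 0" for x y z
      unfolding e a[of x y] a[of x z] a[of y z] by (simp_all add: algebra_simps)
    then show ?thesis by (rule shuffle_freeI)
  qed
  have "lc3 \<subseteq> {u \<in> carrier G. d1 u = 0 \<and> d2 u = 0 \<and> shuffle_free (d3 u)}"
    unfolding lc_Suc[of "Suc 0"] using g lc_carrier
    by (intro generate_subset_subgroup s) (auto simp: d1_commutator d2_commutator lc2_d1)
  then show ?thesis using assms by blast
qed

section \<open>The term of degree n is injective on gamma_n modulo gamma_{n+1}\<close>

lemma generate_Un_subset: "A \<subseteq> generate G (A \<union> B)" "B \<subseteq> generate G (A \<union> B)"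
  by (auto intro: generate.incl)

lemma d1_zero_lc2:
  assumes "w \<in> carrier G" "d1 w = 0"
  shows "w \<in> lc2"
proof (rule independent_generators[where H = "carrier G" and s = "\<lambda>x. x" and I = X and D = "\<lambda>x w. d1 w x"])
  show "commutator G a b \<in> lc2" if "a \<in> carrier G" "b \<in> carrier G" for a b
    using that commutator_in_lc[of a 0 b] by (simp add: lc_1)
  show "w \<in> generate G ((\<lambda>x. x) ` X \<union> lc2)"
    using assms(1) generate_X mono_generate[of X "(\<lambda>x. x) ` X \<union> lc2"] by auto
qed (use assms X_carrier subgroup_self subgroup_lc lc_carrier in \<open>auto simp: d1_mult lc2_d1 d1_X delta_def\<close>)

definition basic2 :: "('a \<times> 'a) set" where "basic2 = {(x, y). x \<in> X \<and> y \<in> X \<and> lt x y}"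

lemma lc2_generated: "lc2 \<subseteq> generate G ((\<lambda>(x, y). commutator G x y) ` basic2 \<union> lc3)"
  (is "_ \<subseteq> ?K")
proof (rule lc_Suc_subset[OF generate_X X_carrier, where T = X])
  show "lc (Suc 0) \<subseteq> generate G (X \<union> lc2)"
    using generate_X mono_generate[of X "X \<union> lc2"] by (auto simp: lc_1)
  show "X \<subseteq> lc (Suc 0)" using X_carrier by (simp add: lc_1)
  show K: "subgroup ?K G"
    using lc_carrier by (intro generate_is_subgroup) (auto simp: basic2_def)
  show "lc3 \<subseteq> ?K" by (rule generate_Un_subset)
  fix x y assume xy: "x \<in> X" "y \<in> X"
  then have c: "x \<in> carrier G" "y \<in> carrier G" using X_carrier by auto
  have *: "commutator G a b \<in> ?K" if "lt a b" "a \<in> X" "b \<in> X" for a b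
    using that by (intro generate.incl) (auto simp: basic2_def)
  consider "lt x y" | "x = y" | "lt y x" using lt_total by blast
  then show "commutator G x y \<in> ?K"
  proof cases
    case 2
    then show ?thesis using c subgroup.one_closed[OF K] by (simp add: commutator_def m_assoc)
  next
    case 3
    then show ?thesis
      using *[of y x] xy subgroup.m_inv_closed[OF K] inv_commutator[of y x] c by fastforce
  qed (use * xy in auto)
qed

lemma d2_zero_lc3:
  assumes "w \<in> lc2" "d2 w = 0"
  shows "w \<in> lc3"
proof (rule independent_generators[where H = lc2 and s = "\<lambda>(x, y). commutator G x y" and I = basic2
      and D = "\<lambda>(x, y) w. d2 w x y"])
  show "commutator G a b \<in> lc3" if "a \<in> lc2" "b \<in> lc2" for a b
    using that commutator_in_lc lc_carrier by blast
  show "(case i of (x, y) \<Rightarrow> commutator G x y) \<in> lc2" if "i \<in> basic2" for i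
    using that commutator_in_lc[of _ 0] by (auto simp: basic2_def lc_1)
  show "((case i of (x, y) \<Rightarrow> \<lambda>w. d2 w x y) (case j of (x, y) \<Rightarrow> commutator G x y) = 0) = (i \<noteq> j)"
    if "i \<in> basic2" "j \<in> basic2" for i j
  proof -
    obtain x y a b where ij: "i = (x, y)" "j = (a, b)" by (cases i, cases j) blast
    show ?thesis using that lt_irrefl lt_trans unfolding ij
      by (auto simp: basic2_def d2_commutator subset_iff d1_X t11_def delta_def split: if_splits)
  qed
qed (use assms subgroup_lc lc_mono lc2_generated in
      \<open>auto simp: d2_mult lc_carrier lc2_d1 lc3_d2\<close>)

text \<open>Indices of the basic commutators [[x, y], z]: the word xyz begins with its smallest
  letter, which may recur only at the end. At such a word no other basic commutator has a nonzero
  coefficient, so these words serve as coordinates.\<close>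

definition basic3 :: "('a \<times> 'a \<times> 'a) set" where
  "basic3 = {(x, y, z). x \<in> X \<and> y \<in> X \<and> z \<in> X \<and> lt x y \<and> (x = z \<or> lt x z)}"

text \<open>Modulo gamma_4 the Hall-Witt identity turns into the Jacobi identity, as conjugating an
  argument changes a triple commutator only by factors from gamma_4.\<close>

lemma jacobi_subgroup:
  assumes K: "subgroup K G" "lc4 \<subseteq> K"
    and c: "x \<in> carrier G" "y \<in> carrier G" "z \<in> carrier G"
    and m: "commutator G (commutator G y z) x \<in> K" "commutator G (commutator G z x) y \<in> K"
  shows "commutator G (commutator G x y) z \<in> K"
proof -
  note Kc = subgroup.m_closed[OF K(1)] subgroup.m_inv_closed[OF K(1)]
  have in2: "commutator G a b \<in> lc2" if "a \<in> carrier G" "b \<in> carrier G" for a b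
    using that commutator_in_lc[of a 0 b] by (simp add: lc_1)
  have conj: "g \<otimes> k \<otimes> inv g \<in> K \<longleftrightarrow> k \<in> K" if "g \<in> carrier G" "k \<in> lc3" for g k
  proof -
    have kc: "k \<in> carrier G" using that lc_carrier by auto
    have "commutator G g k \<in> K" using commutator_in_lc(2)[OF that(2,1)] K by auto
    then show ?thesis
      using conj_eq_commutator[OF that(1) kc] subgroup.m_closed[OF K(1)] subgroup.m_inv_closed[OF K(1)] kc that(1)
      by (metis cancel_left_inv(1) commutator_closed)
  qed
  \<comment> \<open>By \<open>commutator_conj\<close> the conjugation becomes multiplication of
    \<open>u\<close> by \<open>v\<close> in gamma_3, and [v, g] lies in gamma_4. The outer
    conjugation left over is removed by \<open>conj\<close>.\<close>
  have key: "commutator G u (h \<otimes> g \<otimes> inv h) \<in> K \<longleftrightarrow> commutator G u g \<in> K"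
    if u: "u \<in> lc2" and g: "g \<in> carrier G" "h \<in> carrier G" for u g h
  proof -
    have uc: "u \<in> carrier G" using u lc_carrier by auto
    define v where "v = commutator G (inv h) u"
    have v: "v \<in> lc3" "v \<in> carrier G"
      using commutator_in_lc(2)[OF u] g lc_carrier by (auto simp: v_def)
    have vg: "commutator G v g \<in> K" using commutator_in_lc(1)[OF v(1) g(1)] K by auto
    have sub: "subgroup {u \<in> lc2. commutator G u g \<in> K} G"
      using subgroup_commutator_left[OF K(1), of "Suc 0" g] K(2) g by auto
    have v2: "v \<in> {u \<in> lc2. commutator G u g \<in> K}" using v vg lc_mono by auto
    have "commutator G (v \<otimes> u) g \<in> K \<longleftrightarrow> commutator G u g \<in> K"
    proof
      assume "commutator G u g \<in> K"
      then show "commutator G (v \<otimes> u) g \<in> K"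
        using subgroup.m_closed[OF sub v2, of u] u by auto
    next
      assume "commutator G (v \<otimes> u) g \<in> K"
      then have "v \<otimes> u \<in> {u \<in> lc2. commutator G u g \<in> K}"
        using v2 u subgroup.m_closed[OF subgroup_lc] by auto
      then have "inv v \<otimes> (v \<otimes> u) \<in> {u \<in> lc2. commutator G u g \<in> K}"
        using subgroup.m_closed[OF sub subgroup.m_inv_closed[OF sub v2]] by blast
      then show "commutator G u g \<in> K" using v uc by simp
    qed
    moreover have "commutator G (v \<otimes> u) g \<in> lc3"
      using commutator_in_lc(1)[of "v \<otimes> u" "Suc 0" g] v2 u g subgroup.m_closed[OF subgroup_lc] by auto
    ultimately show ?thesis
      using conj[OF g(2)] commutator_conj[OF uc g(2,1)] by (simp add: v_def)
  qed
  define p q r where "p = commutator G (commutator G x y) (y \<otimes> z \<otimes> inv y)"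
    and "q = commutator G (commutator G y z) (z \<otimes> x \<otimes> inv z)"
    and "r = commutator G (commutator G z x) (x \<otimes> y \<otimes> inv x)"
  have pc: "p \<in> carrier G" "q \<in> carrier G" "r \<in> carrier G" using c by (auto simp: p_def q_def r_def)
  have qr: "q \<in> K" "r \<in> K" using m key in2 c by (auto simp: q_def r_def)
  have "p \<otimes> q \<otimes> r = \<one>" using hall_witt[OF c] by (simp add: p_def q_def r_def)
  then have "p = inv (q \<otimes> r)" using pc by (simp add: m_assoc inv_equality)
  then have "p \<in> K" using qr Kc by simp
  then show ?thesis using key in2 c by (auto simp: p_def)
qed

lemma lc3_generated:
  "lc3 \<subseteq> generate G ((\<lambda>(x, y, z). commutator G (commutator G x y) z) ` basic3 \<union> lc4)"
  (is "_ \<subseteq> ?K")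
proof (rule lc_Suc_subset[OF generate_X X_carrier lc2_generated])
  show "(\<lambda>(x, y). commutator G x y) ` basic2 \<subseteq> lc2"
    using commutator_in_lc[of _ 0] by (auto simp: basic2_def lc_1)
  show K: "subgroup ?K G"
    using lc_carrier by (intro generate_is_subgroup) (auto simp: basic3_def)
  show sub: "lc4 \<subseteq> ?K" by (rule generate_Un_subset)
  have *: "commutator G (commutator G x y) z \<in> ?K"
    if "x \<in> X" "y \<in> X" "z \<in> X" "lt x y" "x = z \<or> lt x z" for x y z
    using that by (intro generate.incl UnI1 rev_image_eqI[of "(x, y, z)"]) (auto simp: basic3_def)
  have inv_left: "commutator G (inv u) g \<in> ?K" if "u \<in> lc2" "g \<in> carrier G" "commutator G u g \<in> ?K" for u g
  proof -
    have "subgroup {u \<in> lc2. commutator G u g \<in> ?K} G"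
      by (rule subgroup_commutator_left) (use that K sub in auto)
    from subgroup.m_inv_closed[OF this, of u] show ?thesis using that by auto
  qed
  fix t z assume t: "t \<in> (\<lambda>(x, y). commutator G x y) ` basic2" and z: "z \<in> X"
  then obtain x y where xy: "t = commutator G x y" "x \<in> X" "y \<in> X" "lt x y" by (auto simp: basic2_def)
  have c: "x \<in> carrier G" "y \<in> carrier G" "z \<in> carrier G" using xy z by auto
  consider "x = z \<or> lt x z" | "lt z x" using lt_total by blast
  then show "commutator G t z \<in> ?K"
  proof cases
    case 1
    then show ?thesis using * xy z by auto
  next
    case 2
    \<comment> \<open>Now \<open>z\<close> is the smallest letter, and the Jacobi identity expresses
      [[x, y], z] through the basic commutators [[z, y], x] and [[z, x], y].\<close>
    then have zy: "lt z y" using xy lt_trans by blast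
    have "commutator G (inv (commutator G z y)) x \<in> ?K"
      using *[of z y x] xy z zy 2 c commutator_in_lc[of z 0 y] by (intro inv_left) (auto simp: lc_1)
    then have "commutator G (commutator G y z) x \<in> ?K" using c by (simp add: inv_commutator)
    then show ?thesis
      using jacobi_subgroup[OF K sub c] *[of z x y] xy z zy 2 by auto
  qed
qed

lemma d3_zero_lc4:
  assumes "w \<in> lc3" "d3 w = 0"
  shows "w \<in> lc4"
proof (rule independent_generators[where H = lc3 and s = "\<lambda>(x, y, z). commutator G (commutator G x y) z"
      and I = basic3 and D = "\<lambda>(x, y, z) w. d3 w x y z"])
  show "commutator G a b \<in> lc4" if "a \<in> lc3" "b \<in> lc3" for a b
    using that commutator_in_lc lc_carrier by blast
  show "(case i of (x, y, z) \<Rightarrow> commutator G (commutator G x y) z) \<in> lc3" if "i \<in> basic3" for i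
  proof -
    obtain x y z where i: "i = (x, y, z)" by (cases i) blast
    then have "x \<in> carrier G" "y \<in> carrier G" "z \<in> carrier G"
      using that by (auto simp: basic3_def)
    with i show ?thesis using commutator_in_lc[of x 0 y] commutator_in_lc(1)[of "commutator G x y" "Suc 0" z]
      by (simp add: lc_1)
  qed
  show "((case i of (x, y, z) \<Rightarrow> \<lambda>w. d3 w x y z)
      (case j of (x, y, z) \<Rightarrow> commutator G (commutator G x y) z) = 0) = (i \<noteq> j)"
    if "i \<in> basic3" "j \<in> basic3" for i j
  proof -
    obtain x y z a b c where ij: "i = (x, y, z)" "j = (a, b, c)" by (cases i, cases j) blast
    have cX: "a \<in> carrier G" "b \<in> carrier G" "c \<in> carrier G" "a \<in> X" "b \<in> X" "c \<in> X"
      using that ij by (auto simp: basic3_def)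
    have l: "lt x y" "x = z \<or> lt x z" "lt a b" "a = c \<or> lt a c"
      using that ij by (auto simp: basic3_def)
    have e: "d3 (commutator G (commutator G a b) c) x y z =
       (delta a x * delta b y - delta b x * delta a y) * delta c z
       - delta c x * (delta a y * delta b z - delta b y * delta a z)"
      using cX by (simp add: d3_commutator d1_commutator d2_commutator d1_X t21_def t12_def t11_def)
    show ?thesis unfolding ij prod.case e
      using l lt_irrefl lt_trans by (auto simp: delta_def split: if_splits)
  qed
qed (use assms subgroup_lc lc_mono lc3_generated in
      \<open>auto simp: d3_mult lc_carrier lc3_d1 lc3_d2 lc4_d3\<close>)

end

section \<open>Subgroups of free abelian groups and their tensors\<close>

definition zsub :: "'a::ab_group_add set \<Rightarrow> bool" where
  "zsub S \<longleftrightarrow> 0 \<in> S \<and> (\<forall>a\<in>S. \<forall>b\<in>S. a - b \<in> S)"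

lemma zsubI: "0 \<in> S \<Longrightarrow> (\<And>a b. a \<in> S \<Longrightarrow> b \<in> S \<Longrightarrow> a - b \<in> S) \<Longrightarrow> zsub S"
  by (auto simp: zsub_def)

lemma zsub_zero: "zsub S \<Longrightarrow> 0 \<in> S"
  by (simp add: zsub_def)

lemma zsub_diff: "zsub S \<Longrightarrow> a \<in> S \<Longrightarrow> b \<in> S \<Longrightarrow> a - b \<in> S"
  by (simp add: zsub_def)

lemma zsub_minus: "zsub S \<Longrightarrow> a \<in> S \<Longrightarrow> - a \<in> S"
  using zsub_diff[of S 0 a] zsub_zero[of S] by simp

lemma zsub_add: "zsub S \<Longrightarrow> a \<in> S \<Longrightarrow> b \<in> S \<Longrightarrow> a + b \<in> S"
  using zsub_diff[of S a "- b"] zsub_minus[of S b] by simp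

lemma zsub_sum: "zsub S \<Longrightarrow> (\<And>i. i \<in> I \<Longrightarrow> f i \<in> S) \<Longrightarrow> sum f I \<in> S"
  by (induction I rule: infinite_finite_induct) (auto intro: zsub_zero zsub_add)

text \<open>Integer multiples are written \<open>of_int k * a\<close>, with the pointwise product of
  functions, so that vectors and tensors of each degree share one notation.\<close>

lemma zsub_scale:
  fixes a :: "'a::ring_1"
  assumes "zsub S" "a \<in> S"
  shows "of_int k * a \<in> S"
proof (induction k rule: int_induct[of _ 0])
  case (step1 i)
  then show ?case using zsub_add[OF assms(1) _ assms(2), of "of_int i * a"] by (simp add: algebra_simps)
next
  case (step2 i)
  then show ?case using zsub_diff[OF assms(1) _ assms(2), of "of_int i * a"] by (simp add: algebra_simps)
qed (use assms zsub_zero in auto)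

lemma of_int_fun_apply [simp]: "of_int k x = of_int k"
  by (cases k) auto

lemma sum_fun_apply: "sum f I x = (\<Sum>i\<in>I. f i x)"
  by (induction I rule: infinite_finite_induct) auto

section \<open>Dual bases and Smith normal form\<close>

definition pairing :: "'a set \<Rightarrow> 'a vec \<Rightarrow> 'a vec \<Rightarrow> int" where
  "pairing Y u v = (\<Sum>y\<in>Y. u y * v y)"

lemma pairing_simps [simp]:
  "pairing Y 0 v = 0" "pairing Y u 0 = 0"
  "pairing Y (u + u') v = pairing Y u v + pairing Y u' v"
  "pairing Y (u - u') v = pairing Y u v - pairing Y u' v"
  "pairing Y u (v + v') = pairing Y u v + pairing Y u v'"
  "pairing Y u (v - v') = pairing Y u v - pairing Y u v'"
  "pairing Y (of_int k * u) v = k * pairing Y u v"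
  "pairing Y u (of_int k * v) = k * pairing Y u v"
  by (simp_all add: pairing_def algebra_simps sum.distrib sum_subtractf sum_distrib_left)

lemma pairing_sum: "pairing Y u (sum f I) = (\<Sum>i\<in>I. pairing Y u (f i))"
  unfolding pairing_def sum_fun_apply sum_distrib_left by (rule sum.swap)

lemma pairing_delta: "finite Y \<Longrightarrow> i \<in> Y \<Longrightarrow> pairing Y (delta i) v = v i"
  by (simp add: pairing_def delta_def if_distrib[of "\<lambda>a. a * _"] cong: if_cong)

text \<open>\<open>p\<close> is a basis of the integer vectors on \<open>Y\<close>, and
  \<open>q\<close> represents the coordinate functionals through \<open>pairing\<close>. The second
  clause gives independence, the third generation; carrying \<open>q\<close> along replaces the
  inversion of matrices.\<close>

definition dual_bases :: "'a set \<Rightarrow> ('a \<Rightarrow> 'a vec) \<Rightarrow> ('a \<Rightarrow> 'a vec) \<Rightarrow> bool" where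
  "dual_bases Y p q \<longleftrightarrow>
     (\<forall>i\<in>Y. supp1 Y (p i)) \<and>
     (\<forall>i\<in>Y. \<forall>j\<in>Y. pairing Y (q i) (p j) = (if i = j then 1 else 0)) \<and>
     (\<forall>v. supp1 Y v \<longrightarrow> v = (\<Sum>i\<in>Y. of_int (pairing Y (q i) v) * p i))"

lemma supp1_sum: "(\<And>i. i \<in> I \<Longrightarrow> supp1 Y (f i)) \<Longrightarrow> supp1 Y (sum f I)"
  by (induction I rule: infinite_finite_induct) (auto intro: supp_add)

lemma supp1_scale: "supp1 Y v \<Longrightarrow> supp1 Y (of_int k * v)"
  by (auto simp: supp1_def)

lemma dual_bases_delta: "finite Y \<Longrightarrow> dual_bases Y delta delta"
  unfolding dual_bases_def
proof (intro conjI ballI allI impI)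
  assume Y: "finite Y"
  show "supp1 Y (delta i)" if "i \<in> Y" for i using that by (auto simp: supp1_def delta_def)
  show "pairing Y (delta i) (delta j) = (if i = j then 1 else 0)" if "i \<in> Y" "j \<in> Y" for i j :: 'a
    using that Y by (simp add: pairing_delta) (simp add: delta_def)
  show "v = (\<Sum>i\<in>Y. of_int (pairing Y (delta i) v) * delta i)" if "supp1 Y v" for v
  proof
    fix x
    have "(\<Sum>i\<in>Y. of_int (pairing Y (delta i) v) * delta i) x = (\<Sum>i\<in>Y. if x = i then v i else 0)"
      unfolding sum_fun_apply using Y by (intro sum.cong) (auto simp: pairing_delta, auto simp: delta_def)
    then show "v x = (\<Sum>i\<in>Y. of_int (pairing Y (delta i) v) * delta i) x"
      using that Y by (auto simp: supp1_def)
  qed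
qed

text \<open>An elementary operation: what is added to \<open>p i\<close> must be compensated in the
  functionals of the other indices, which lose multiples of \<open>q i\<close>. The condition
  \<open>k i = 0\<close> leaves \<open>q i\<close> itself unchanged.\<close>

lemma dual_bases_transvection:
  assumes "finite Y" "dual_bases Y p q" "i \<in> Y" "k i = 0"
  shows "dual_bases Y (p(i := p i + (\<Sum>j\<in>Y. of_int (k j) * p j))) (\<lambda>j. q j - of_int (k j) * q i)"
proof -
  define s where "s = (\<Sum>j\<in>Y. of_int (k j) * p j)"
  have p: "\<And>i. i \<in> Y \<Longrightarrow> supp1 Y (p i)"
    and d: "\<And>i j. i \<in> Y \<Longrightarrow> j \<in> Y \<Longrightarrow> pairing Y (q i) (p j) = (if i = j then 1 else 0)"
    and c: "\<And>v. supp1 Y v \<Longrightarrow> v = (\<Sum>i\<in>Y. of_int (pairing Y (q i) v) * p i)"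
    using assms(2) unfolding dual_bases_def by blast+
  have qs: "pairing Y (q a) s = k a" if "a \<in> Y" for a
    using that assms(1) by (simp add: s_def pairing_sum d if_distrib[of "\<lambda>a. _ * a"] cong: if_cong)
  have sY: "supp1 Y s" unfolding s_def using p by (intro supp1_sum supp1_scale)
  show ?thesis
    unfolding dual_bases_def s_def[symmetric]
  proof (intro conjI ballI allI impI)
    fix j assume "j \<in> Y"
    then show "supp1 Y ((p(i := p i + s)) j)" using p sY assms(3) by (auto intro: supp_add)
  next
    fix a b assume "a \<in> Y" "b \<in> Y"
    then show "pairing Y (q a - of_int (k a) * q i) ((p(i := p i + s)) b) = (if a = b then 1 else 0)"
      using d qs assms by auto
  next
    fix v assume v: "supp1 Y v"
    let ?c = "\<lambda>j. pairing Y (q j) v"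
    have "(\<Sum>j\<in>Y. of_int (pairing Y (q j - of_int (k j) * q i) v) * (p(i := p i + s)) j)
      = (\<Sum>j\<in>Y. of_int (?c j) * p j - of_int (?c i) * (of_int (k j) * p j)
           + (if j = i then of_int (?c i) * s else 0))"
      using assms(4) by (intro sum.cong refl) (simp add: left_diff_distrib distrib_left mult.assoc mult.left_commute)
    also have "\<dots> = (\<Sum>j\<in>Y. of_int (?c j) * p j) - of_int (?c i) * s + of_int (?c i) * s"
      using assms(1,3) by (simp add: sum.distrib sum_subtractf s_def sum_distrib_left)
    also have "\<dots> = v" using c[OF v] by simp
    finally show "v = (\<Sum>j\<in>Y. of_int (pairing Y (q j - of_int (k j) * q i) v) * (p(i := p i + s)) j)"
      by simp
  qed
qed

text \<open>Smith normal form of the inclusion \<open>B \<subseteq> \<int>\<^sup>Y\<close>, except that the basis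
  vectors with index in \<open>I\<close> are still to be treated.\<close>

definition stacked_outside ::
    "'a set \<Rightarrow> 'a vec set \<Rightarrow> 'a set \<Rightarrow> ('a \<Rightarrow> 'a vec) \<Rightarrow> ('a \<Rightarrow> 'a vec) \<Rightarrow> ('a \<Rightarrow> int) \<Rightarrow> bool" where
  "stacked_outside Y B I p q e \<longleftrightarrow> dual_bases Y p q \<and>
     (\<forall>i\<in>Y - I. of_int (e i) * p i \<in> B \<and> (\<forall>b\<in>B. e i dvd pairing Y (q i) b))"

lemma stacked_outside_step:
  assumes Y: "finite Y" "I \<subseteq> Y" "I \<noteq> {}" and B: "zsub B" "\<And>b. b \<in> B \<Longrightarrow> supp1 Y b"
    and st: "stacked_outside Y B I p q e"
  shows "\<exists>i\<in>I. \<exists>p q e. stacked_outside Y B (I - {i}) p q e"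
proof (cases "\<exists>i\<in>I. \<exists>b\<in>B. pairing Y (q i) b \<noteq> 0")
  case False
  obtain i where i: "i \<in> I" using Y by blast
  \<comment> \<open>All coordinates of \<open>B\<close> with index in \<open>I\<close> vanish, so 0
    can be the elementary divisor: it divides them, and \<open>0 * p i\<close> is in
    \<open>B\<close>.\<close>
  have "stacked_outside Y B (I - {i}) p q (e(i := 0))"
    unfolding stacked_outside_def
  proof (intro conjI ballI)
    show "dual_bases Y p q" using st unfolding stacked_outside_def by blast
    fix j assume j: "j \<in> Y - (I - {i})"
    show "of_int ((e(i := 0)) j) * p j \<in> B"
      using st j zsub_zero[OF B(1)] unfolding stacked_outside_def by (cases "j = i") simp_all
    fix b assume "b \<in> B"
    then show "(e(i := 0)) j dvd pairing Y (q j) b"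
      using st j False i unfolding stacked_outside_def by (cases "j = i") simp_all
  qed
  then show ?thesis using i by blast
next
  case True
  txt \<open>Among all admissible bases and all \<open>b\<close> choose a nonzero coefficient, with index \<open>i \<in> I\<close>,
    of least absolute value; by division with remainder it divides the other coefficients of
    \<open>b\<close> with index in \<open>I\<close> and the coefficient with index \<open>i\<close> of every element of \<open>B\<close>.\<close>
  define P where "P = (\<lambda>(p :: 'a \<Rightarrow> 'a vec, q, i, b). stacked_outside Y B I p q e \<and> i \<in> I \<and> b \<in> B \<and> pairing Y (q i) b \<noteq> 0)"
  define f where "f = (\<lambda>(p :: 'a \<Rightarrow> 'a vec, q :: 'a \<Rightarrow> 'a vec, i :: 'a, b). nat \<bar>pairing Y (q i) b\<bar>)"
  obtain i0 b0 where "P (p, q, i0, b0)" using True st by (auto simp: P_def)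
  then obtain t where t: "P t" "\<And>t'. P t' \<Longrightarrow> f t \<le> f t'"
    using ex_has_least_nat[of P _ f] by blast
  obtain p q i b where "t = (p, q, i, b)" by (cases t) blast
  then have st: "stacked_outside Y B I p q e" and i: "i \<in> I" and b: "b \<in> B" and nz: "pairing Y (q i) b \<noteq> 0"
    and least: "\<And>p' q' i' b'. stacked_outside Y B I p' q' e \<Longrightarrow> i' \<in> I \<Longrightarrow> b' \<in> B \<Longrightarrow>
       pairing Y (q' i') b' \<noteq> 0 \<Longrightarrow> \<bar>pairing Y (q i) b\<bar> \<le> \<bar>pairing Y (q' i') b'\<bar>"
    using t unfolding P_def f_def by (auto simp: nat_le_eq_zle)
  define m where "m = pairing Y (q i) b"
  have small: "pairing Y (q' i') b' = 0"
    if "stacked_outside Y B I p' q' e" "i' \<in> I" "b' \<in> B" "\<bar>pairing Y (q' i') b'\<bar> < \<bar>m\<bar>" for p' q' i' b'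
    using least[OF that(1-3)] that(4) by (auto simp: m_def)
  have db: "dual_bases Y p q" using st by (simp add: stacked_outside_def)
  then have d: "\<And>i j. i \<in> Y \<Longrightarrow> j \<in> Y \<Longrightarrow> pairing Y (q i) (p j) = (if i = j then 1 else 0)"
    by (simp add: dual_bases_def)
  have iY: "i \<in> Y" using i Y by auto
  \<comment> \<open>The coordinates outside \<open>I\<close> are removed without leaving
    \<open>B\<close>: each is a multiple of \<open>e j\<close>, and \<open>e j\<close> times
    \<open>p j\<close> belongs to \<open>B\<close>.\<close>
  define b0 where "b0 = b - (\<Sum>j\<in>Y - I. of_int (pairing Y (q j) b) * p j)"
  have b0: "b0 \<in> B"
    unfolding b0_def
  proof (intro zsub_diff[OF B(1) b] zsub_sum[OF B(1)])
    fix j assume j: "j \<in> Y - I"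
    then have "e j dvd pairing Y (q j) b" using st b unfolding stacked_outside_def by blast
    then obtain c where "pairing Y (q j) b = c * e j" by (metis dvdE mult.commute)
    then show "of_int (pairing Y (q j) b) * p j \<in> B"
      using zsub_scale[OF B(1), of "of_int (e j) * p j" c] st j
      by (simp add: stacked_outside_def mult.assoc)
  qed
  have qb0: "pairing Y (q l) b0 = (if l \<in> I then pairing Y (q l) b else 0)" if "l \<in> Y" for l
  proof -
    have "pairing Y (q l) b0 = pairing Y (q l) b - (\<Sum>j\<in>Y - I. pairing Y (q j) b * pairing Y (q l) (p j))"
      by (simp add: b0_def pairing_sum)
    also have "(\<Sum>j\<in>Y - I. pairing Y (q j) b * pairing Y (q l) (p j))
      = (\<Sum>j\<in>Y - I. if j = l then pairing Y (q j) b else 0)"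
      using d that by (intro sum.cong) auto
    also have "\<dots> = (if l \<in> I then 0 else pairing Y (q l) b)"
      using Y that by simp
    finally show ?thesis by simp
  qed
  \<comment> \<open>Quotients of the other coordinates by \<open>m\<close>: the transvection leaves
    their remainders, which the minimality of \<open>m\<close> forces to be 0. Then
    \<open>b0\<close> is \<open>m\<close> times the new vector \<open>p' i\<close>, and
    \<open>m\<close> becomes the elementary divisor.\<close>
  define k where "k = (\<lambda>j. if j \<in> I - {i} then pairing Y (q j) b div m else 0)"
  define p' where "p' = p(i := p i + (\<Sum>j\<in>Y. of_int (k j) * p j))"
  define q' where "q' = (\<lambda>j. q j - of_int (k j) * q i)"
  have db': "dual_bases Y p' q'"
    unfolding p'_def q'_def using dual_bases_transvection[OF Y(1) db iY] by (simp add: k_def)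
  have st': "stacked_outside Y B I p' q' e"
    unfolding stacked_outside_def
  proof (intro conjI ballI db')
    fix j assume j: "j \<in> Y - I"
    then have "p' j = p j" "q' j = q j" using i by (auto simp: p'_def q'_def k_def)
    then show "of_int (e j) * p' j \<in> B" "\<And>b. b \<in> B \<Longrightarrow> e j dvd pairing Y (q' j) b"
      using st j unfolding stacked_outside_def by simp_all
  qed
  have q'b0: "pairing Y (q' l) b0 = (if l = i then m else 0)" if "l \<in> Y" for l
  proof (cases "l \<in> I - {i}")
    case True
    have "pairing Y (q' l) b0 = pairing Y (q l) b mod m"
      using True that qb0 iY i by (simp add: q'_def k_def m_def minus_div_mult_eq_mod)
    then have "\<bar>pairing Y (q' l) b0\<bar> < \<bar>m\<bar>" using nz abs_mod_less[of m] by (simp add: m_def)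
    then have "pairing Y (q' l) b0 = 0" using small[OF st' _ b0] True by blast
    then show ?thesis using True by simp
  next
    case False
    then have "k l = 0" unfolding k_def by (rule if_not_P)
    then have "q' l = q l" by (simp add: q'_def)
    moreover have "pairing Y (q l) b0 = (if l = i then m else 0)"
      unfolding qb0[OF that] m_def using False i by (cases "l = i") simp_all
    ultimately show ?thesis by metis
  qed
  have "b0 = (\<Sum>l\<in>Y. of_int (pairing Y (q' l) b0) * p' l)"
    using db' B(2)[OF b0] by (simp add: dual_bases_def)
  also have "\<dots> = (\<Sum>l\<in>Y. if l = i then of_int m * p' i else 0)"
    using q'b0 by (intro sum.cong) auto
  finally have b0p: "b0 = of_int m * p' i" using Y iY by simp
  have "m dvd pairing Y (q' i) b'" if "b' \<in> B" for b'
  proof -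
    define c where "c = pairing Y (q' i) b'"
    have "b' - of_int (c div m) * b0 \<in> B" using B(1) that b0 by (intro zsub_diff zsub_scale)
    moreover have e: "pairing Y (q' i) (b' - of_int (c div m) * b0) = c mod m"
      using q'b0[OF iY] by (simp add: c_def minus_div_mult_eq_mod)
    moreover have "\<bar>c mod m\<bar> < \<bar>m\<bar>" using nz abs_mod_less[of m] by (simp add: m_def)
    ultimately have "c mod m = 0" using small[OF st' i] by metis
    then show ?thesis by (auto simp: c_def)
  qed
  then have "stacked_outside Y B (I - {i}) p' q' (e(i := m))"
    using st' b0 unfolding b0p stacked_outside_def by auto
  then show ?thesis using i by blast
qed

lemma stacked_bases:
  assumes Y: "finite Y" and B: "zsub B" "\<And>b. b \<in> B \<Longrightarrow> supp1 Y b"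
  shows "\<exists>p q e. dual_bases Y p q \<and>
     (\<forall>i\<in>Y. of_int (e i) * p i \<in> B \<and> (\<forall>b\<in>B. e i dvd pairing Y (q i) b))"
proof -
  have "\<exists>p q e. stacked_outside Y B {} p q e"
    if "I \<subseteq> Y" "stacked_outside Y B I p q e" for I p q e
    using that
  proof (induction "card I" arbitrary: I p q e)
    case 0
    then have "I = {}" using Y finite_subset by fastforce
    then show ?case using 0 by blast
  next
    case (Suc n)
    then have "I \<noteq> {}" by auto
    from stacked_outside_step[OF Y Suc.prems(1) this B Suc.prems(2)]
    obtain i p q e where i: "i \<in> I" "stacked_outside Y B (I - {i}) p q e" by blast
    moreover have "card (I - {i}) = n" using Suc.hyps(2) i(1) by simp
    ultimately show ?case using Suc.hyps(1)[of "I - {i}"] Suc.prems(1) by blast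
  qed
  from this[of Y delta delta] show ?thesis
    using dual_bases_delta[OF Y] by (simp add: stacked_outside_def)
qed

section \<open>Coordinates of tensors with respect to a basis\<close>

definition coef2 :: "'a set \<Rightarrow> ('a \<Rightarrow> 'a vec) \<Rightarrow> 'a ten2 \<Rightarrow> 'a \<Rightarrow> 'a \<Rightarrow> int" where
  "coef2 Y q t i j = (\<Sum>x\<in>Y. \<Sum>y\<in>Y. q i x * q j y * t x y)"

definition coef3 :: "'a set \<Rightarrow> ('a \<Rightarrow> 'a vec) \<Rightarrow> 'a ten3 \<Rightarrow> 'a \<Rightarrow> 'a \<Rightarrow> 'a \<Rightarrow> int" where
  "coef3 Y q t i j k = (\<Sum>x\<in>Y. \<Sum>y\<in>Y. \<Sum>z\<in>Y. q i x * q j y * q k z * t x y z)"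

lemma coef2_diff: "coef2 Y q (s - t) i j = coef2 Y q s i j - coef2 Y q t i j"
  by (simp add: coef2_def algebra_simps sum_subtractf)

lemma coef2_zero [simp]: "coef2 Y q 0 i j = 0"
  by (simp add: coef2_def)

lemma coef2_t11: "coef2 Y q (t11 a b) i j = pairing Y (q i) a * pairing Y (q j) b"
  by (simp add: coef2_def pairing_def t11_def sum_product algebra_simps)

lemma coef2_swap: "coef2 Y q t j i = coef2 Y q (\<lambda>x y. t y x) i j"
  unfolding coef2_def by (subst sum.swap) (simp add: mult_ac)

lemma coef3_swap12: "coef3 Y q t j i k = coef3 Y q (\<lambda>x y z. t y x z) i j k"
  unfolding coef3_def by (subst sum.swap) (simp add: mult_ac)

lemma coef3_swap23: "coef3 Y q t i k j = coef3 Y q (\<lambda>x y z. t x z y) i j k"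
  unfolding coef3_def by (subst (2) sum.swap) (simp add: mult_ac)

text \<open>Isolates the first index: if all columns of \<open>t\<close> lie in a lattice on which
  \<open>q i\<close> takes multiples of \<open>e i\<close>, then \<open>e i\<close> divides the
  coordinate.\<close>

lemma coef3_pairing: "coef3 Y q t i j k = (\<Sum>y\<in>Y. \<Sum>z\<in>Y. q j y * q k z * pairing Y (q i) (\<lambda>x. t x y z))"
proof -
  have "coef3 Y q t i j k = (\<Sum>y\<in>Y. \<Sum>z\<in>Y. \<Sum>x\<in>Y. q i x * q j y * q k z * t x y z)"
    unfolding coef3_def by (subst sum.swap) (intro sum.cong refl sum.swap)
  then show ?thesis by (simp add: pairing_def sum_distrib_left mult_ac)
qed

lemma dual_bases_expand1:
  assumes "dual_bases Y p q" "\<And>x. x \<notin> Y \<Longrightarrow> v x = 0"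
  shows "v x = (\<Sum>i\<in>Y. \<Sum>a\<in>Y. q i a * p i x * v a)"
proof -
  have "v = (\<Sum>i\<in>Y. of_int (pairing Y (q i) v) * p i)"
    using assms by (simp add: dual_bases_def supp1_def)
  then have "v x = (\<Sum>i\<in>Y. of_int (pairing Y (q i) v) * p i) x" by simp
  then show ?thesis by (simp add: sum_fun_apply pairing_def sum_distrib_left mult_ac)
qed

lemma dual_bases_expand2:
  assumes "dual_bases Y p q" "supp2 Y t"
  shows "t = (\<Sum>i\<in>Y. \<Sum>j\<in>Y. of_int (coef2 Y q t i j) * t11 (p i) (p j))"
proof (intro ext)
  fix x y
  have "t x y = (\<Sum>i\<in>Y. \<Sum>a\<in>Y. q i a * p i x * (\<Sum>j\<in>Y. \<Sum>b\<in>Y. q j b * p j y * t a b))"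
    using assms dual_bases_expand1[OF assms(1), of "\<lambda>x. t x y" x]
      dual_bases_expand1[OF assms(1), of "t _" y] by (simp add: supp2_def)
  also have "\<dots> = (\<Sum>i\<in>Y. \<Sum>j\<in>Y. \<Sum>a\<in>Y. \<Sum>b\<in>Y. q i a * q j b * t a b * (p i x * p j y))"
    by (subst (2) sum.swap) (simp add: sum_distrib_left mult_ac)
  finally show "t x y = (\<Sum>i\<in>Y. \<Sum>j\<in>Y. of_int (coef2 Y q t i j) * t11 (p i) (p j)) x y"
    by (simp add: sum_fun_apply coef2_def t11_def sum_distrib_right)
qed

lemma dual_bases_expand3:
  assumes "dual_bases Y p q" "supp3 Y t"
  shows "t = (\<Sum>i\<in>Y. \<Sum>j\<in>Y. \<Sum>k\<in>Y. of_int (coef3 Y q t i j k) * t21 (t11 (p i) (p j)) (p k))"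
proof (intro ext)
  fix x y z
  have 2: "t a y z = (\<Sum>j\<in>Y. \<Sum>k\<in>Y. \<Sum>b\<in>Y. \<Sum>c\<in>Y. q j b * q k c * t a b c * (p j y * p k z))" for a
  proof -
    have "supp2 Y (t a)" using assms(2) by (simp add: supp2_def supp3_def)
    from dual_bases_expand2[OF assms(1) this]
    have "t a y z = (\<Sum>i\<in>Y. \<Sum>j\<in>Y. of_int (coef2 Y q (t a) i j) * t11 (p i) (p j)) y z"
      by simp
    then show ?thesis by (simp add: sum_fun_apply coef2_def t11_def sum_distrib_right)
  qed
  have "t x y z = (\<Sum>i\<in>Y. \<Sum>a\<in>Y. q i a * p i x * t a y z)"
    using dual_bases_expand1[OF assms(1), of "\<lambda>x. t x y z" x] assms(2) by (simp add: supp3_def)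
  also have "\<dots> = (\<Sum>i\<in>Y. \<Sum>a\<in>Y. \<Sum>j\<in>Y. \<Sum>k\<in>Y. \<Sum>b\<in>Y. \<Sum>c\<in>Y.
      q i a * q j b * q k c * t a b c * (p i x * p j y * p k z))"
    by (subst 2) (simp add: sum_distrib_left mult_ac)
  also have "\<dots> = (\<Sum>i\<in>Y. \<Sum>j\<in>Y. \<Sum>a\<in>Y. \<Sum>k\<in>Y. \<Sum>b\<in>Y. \<Sum>c\<in>Y.
      q i a * q j b * q k c * t a b c * (p i x * p j y * p k z))"
    by (intro sum.cong refl sum.swap)
  also have "\<dots> = (\<Sum>i\<in>Y. \<Sum>j\<in>Y. \<Sum>k\<in>Y. \<Sum>a\<in>Y. \<Sum>b\<in>Y. \<Sum>c\<in>Y.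
      q i a * q j b * q k c * t a b c * (p i x * p j y * p k z))"
    by (intro sum.cong refl sum.swap)
  finally show "t x y z = (\<Sum>i\<in>Y. \<Sum>j\<in>Y. \<Sum>k\<in>Y. of_int (coef3 Y q t i j k) * t21 (t11 (p i) (p j)) (p k)) x y z"
    by (simp add: sum_fun_apply coef3_def t11_def t21_def sum_distrib_right)
qed

context magnus_coordinates
begin

text \<open>An antisymmetric array is determined by its entries above the diagonal, so the sum is a
  combination of the \<open>P i j - P j i\<close> with just those entries as coefficients. Using one
  half only, instead of symmetrizing, avoids a division by 2. In the application
  \<open>P i j\<close> is \<open>p i \<otimes> p j\<close>.\<close>

lemma antisymmetric_sum_in_zsub:
  fixes P :: "'a \<Rightarrow> 'a \<Rightarrow> 'c::ring_1"
  assumes S: "zsub S" and c: "\<And>i j. c i j + c j i = (0::int)"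
    and d: "\<And>i j. i \<in> Y \<Longrightarrow> j \<in> Y \<Longrightarrow> e i j dvd c i j"
    and P: "\<And>i j. i \<in> Y \<Longrightarrow> j \<in> Y \<Longrightarrow> of_int (e i j) * (P i j - P j i) \<in> S"
  shows "(\<Sum>i\<in>Y. \<Sum>j\<in>Y. of_int (c i j) * P i j) \<in> S"
proof -
  define g where "g = (\<lambda>i j. if lt i j then c i j else 0)"
  have cg: "c i j = g i j - g j i" for i j
    using c[of i j] c[of i i] lt_total[of i j] lt_irrefl[of i] lt_trans[of i j i] by (auto simp: g_def)
  have "(\<Sum>i\<in>Y. \<Sum>j\<in>Y. of_int (c i j) * P i j)
    = (\<Sum>i\<in>Y. \<Sum>j\<in>Y. of_int (g i j) * P i j) - (\<Sum>i\<in>Y. \<Sum>j\<in>Y. of_int (g j i) * P i j)"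
    by (simp add: cg algebra_simps sum_subtractf)
  also have "(\<Sum>i\<in>Y. \<Sum>j\<in>Y. of_int (g j i) * P i j) = (\<Sum>i\<in>Y. \<Sum>j\<in>Y. of_int (g i j) * P j i)"
    by (rule sum.swap)
  finally have "(\<Sum>i\<in>Y. \<Sum>j\<in>Y. of_int (c i j) * P i j) = (\<Sum>i\<in>Y. \<Sum>j\<in>Y. of_int (g i j) * (P i j - P j i))"
    by (simp add: algebra_simps sum_subtractf)
  moreover have "of_int (g i j) * (P i j - P j i) \<in> S" if "i \<in> Y" "j \<in> Y" for i j
  proof -
    have "e i j dvd g i j" using d that by (auto simp: g_def)
    then obtain a where "g i j = a * e i j" by (metis dvdE mult.commute)
    then show ?thesis using zsub_scale[OF S P[OF that], of a] by (simp add: mult.assoc)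
  qed
  ultimately show ?thesis using S by (auto intro!: zsub_sum)
qed

text \<open>With \<open>P i j k\<close> the tensor product of three vectors, the expression in the
  last hypothesis is \<open>e i\<close> times the Lie commutator [[i, j], k]. The shuffle relations
  rewrite the sum as a combination of such commutators whose first letter is smallest, and only
  divisibility by the number of that letter is then required.\<close>

lemma shuffle_free_sum_in_zsub:
  fixes P :: "'a \<Rightarrow> 'a \<Rightarrow> 'a \<Rightarrow> 'c::ring_1"
  assumes S: "zsub S" and c: "shuffle_free c"
    and d: "\<And>i j k. i \<in> Y \<Longrightarrow> j \<in> Y \<Longrightarrow> k \<in> Y \<Longrightarrow> e i dvd c i j k"
    and P: "\<And>i j k. i \<in> Y \<Longrightarrow> j \<in> Y \<Longrightarrow> k \<in> Y \<Longrightarrow>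
      of_int (e i) * (P i j k - P j i k - P k i j + P k j i) \<in> S"
  shows "(\<Sum>i\<in>Y. \<Sum>j\<in>Y. \<Sum>k\<in>Y. of_int (c i j k) * P i j k) \<in> S"
proof -
  \<comment> \<open>\<open>g i j k\<close> is the coefficient of [[i, j], k]. For
    \<open>i = k\<close> it is read off at the word iij, where [[i, j], i] has coefficient -1; at
    iji it has coefficient 2, and a division would be needed.\<close>
  define g where "g = (\<lambda>i j k. if lt i j \<and> lt i k then c i j k else if lt i j \<and> i = k then - c i i j else 0)"
  have cg: "c i j k = g i j k - g j i k - g j k i + g k j i" for i j k
  proof -
    have s: "c i j k - c k j i = 0" "c i j k + c j i k + c j k i = 0" "c i i j + c i i j + c i j i = 0"
      "c j j i + c j j i + c j i j = 0" "c i i k + c i i k + c i k i = 0" "c k k i + c k k i + c k i k = 0"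
      "c j j k + c j j k + c j k j = 0" "c k k j + c k k j + c k j k = 0" "c i i i + c i i i + c i i i = 0"
      "c j i i - c i i j = 0" "c k i i - c i i k = 0" "c i j j - c j j i = 0" "c k j j - c j j k = 0"
      "c i k k - c k k i = 0" "c j k k - c k k j = 0"
      using shuffle_freeD[OF c] by blast+
    have l: "\<not> (lt x y \<and> lt y x)" for x y using lt_trans lt_irrefl by blast
    consider "i = j" "j = k" | "i = j" "lt j k" | "i = j" "lt k j" | "lt i j" "j = k" | "lt j i" "j = k"
      | "i = k" "lt i j" | "i = k" "lt j i" | "lt i j" "lt i k" "j \<noteq> k" | "lt j i" "lt j k" "i \<noteq> k" | "lt k i" "lt k j" "i \<noteq> j"
      using lt_total lt_trans by metis
    then show ?thesis
      using s l[of i j] l[of j k] l[of i k] lt_irrefl[of i] lt_irrefl[of j] lt_irrefl[of k]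
      by cases (auto simp: g_def)
  qed
  define L where "L = (\<lambda>i j k. P i j k - P j i k - P k i j + P k j i)"
  have sw12: "(\<Sum>i\<in>Y. \<Sum>j\<in>Y. \<Sum>k\<in>Y. h j i k) = (\<Sum>i\<in>Y. \<Sum>j\<in>Y. \<Sum>k\<in>Y. h i j k)" for h :: "'a \<Rightarrow> 'a \<Rightarrow> 'a \<Rightarrow> 'c"
    by (rule sum.swap)
  have sw23: "(\<Sum>i\<in>Y. \<Sum>j\<in>Y. \<Sum>k\<in>Y. h i k j) = (\<Sum>i\<in>Y. \<Sum>j\<in>Y. \<Sum>k\<in>Y. h i j k)" for h :: "'a \<Rightarrow> 'a \<Rightarrow> 'a \<Rightarrow> 'c"
    by (intro sum.cong refl sum.swap)
  have r1: "(\<Sum>i\<in>Y. \<Sum>j\<in>Y. \<Sum>k\<in>Y. of_int (g j i k) * P i j k) = (\<Sum>i\<in>Y. \<Sum>j\<in>Y. \<Sum>k\<in>Y. of_int (g i j k) * P j i k)"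
    by (rule sw12)
  have r2: "(\<Sum>i\<in>Y. \<Sum>j\<in>Y. \<Sum>k\<in>Y. of_int (g j k i) * P i j k) = (\<Sum>i\<in>Y. \<Sum>j\<in>Y. \<Sum>k\<in>Y. of_int (g i j k) * P k i j)"
    using sw12[of "\<lambda>i j k. of_int (g i k j) * P j i k"] sw23[of "\<lambda>i j k. of_int (g i j k) * P k i j"] by simp
  have r3: "(\<Sum>i\<in>Y. \<Sum>j\<in>Y. \<Sum>k\<in>Y. of_int (g k j i) * P i j k) = (\<Sum>i\<in>Y. \<Sum>j\<in>Y. \<Sum>k\<in>Y. of_int (g i j k) * P k j i)"
    using sw12[of "\<lambda>i j k. of_int (g k i j) * P j i k"] sw23[of "\<lambda>i j k. of_int (g j i k) * P k i j"]
      sw12[of "\<lambda>i j k. of_int (g i j k) * P k j i"] by simp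
  have "(\<Sum>i\<in>Y. \<Sum>j\<in>Y. \<Sum>k\<in>Y. of_int (c i j k) * P i j k)
     = (\<Sum>i\<in>Y. \<Sum>j\<in>Y. \<Sum>k\<in>Y. of_int (g i j k) * P i j k) - (\<Sum>i\<in>Y. \<Sum>j\<in>Y. \<Sum>k\<in>Y. of_int (g j i k) * P i j k)
     - (\<Sum>i\<in>Y. \<Sum>j\<in>Y. \<Sum>k\<in>Y. of_int (g j k i) * P i j k) + (\<Sum>i\<in>Y. \<Sum>j\<in>Y. \<Sum>k\<in>Y. of_int (g k j i) * P i j k)"
    by (subst cg) (simp add: algebra_simps sum_subtractf sum.distrib)
  also have "\<dots> = (\<Sum>i\<in>Y. \<Sum>j\<in>Y. \<Sum>k\<in>Y. of_int (g i j k) * L i j k)"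
    unfolding r1 r2 r3 by (simp add: L_def algebra_simps sum_subtractf sum.distrib)
  finally have "(\<Sum>i\<in>Y. \<Sum>j\<in>Y. \<Sum>k\<in>Y. of_int (c i j k) * P i j k) = (\<Sum>i\<in>Y. \<Sum>j\<in>Y. \<Sum>k\<in>Y. of_int (g i j k) * L i j k)" .
  moreover have "of_int (g i j k) * L i j k \<in> S" if "i \<in> Y" "j \<in> Y" "k \<in> Y" for i j k
  proof -
    have "e i dvd g i j k" using d that by (auto simp: g_def)
    then obtain a where "g i j k = a * e i" by (metis dvdE mult.commute)
    then show ?thesis using zsub_scale[OF S P[OF that], of a] by (simp add: L_def mult.assoc)
  qed
  ultimately show ?thesis using S by (auto intro!: zsub_sum)
qed

text \<open>The relations only permute the tensor positions, so they survive every linear change of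
  coordinates. The smallest letter can thus be taken among the indices of an adapted basis instead
  of the original generators.\<close>

lemma shuffle_free_coef3:
  assumes "shuffle_free t"
  shows "shuffle_free (coef3 Y q t)"
proof (rule shuffle_freeI)
  fix i j k
  have 1: "coef3 Y q t k j i = coef3 Y q (\<lambda>x y z. t z y x) i j k"
    by (simp add: coef3_swap12[of Y q _ k] coef3_swap23[of Y q _ j k] coef3_swap12[of Y q _ j i])
  have 2: "coef3 Y q t j i k = coef3 Y q (\<lambda>x y z. t y x z) i j k" by (rule coef3_swap12)
  have 3: "coef3 Y q t j k i = coef3 Y q (\<lambda>x y z. t y z x) i j k"
    by (simp add: coef3_swap23[of Y q _ j k] coef3_swap12[of Y q _ j i])
  have "coef3 Y q t i j k - coef3 Y q (\<lambda>x y z. t z y x) i j k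
    = (\<Sum>x\<in>Y. \<Sum>y\<in>Y. \<Sum>z\<in>Y. q i x * q j y * q k z * (t x y z - t z y x))"
    by (simp add: coef3_def sum_subtractf algebra_simps)
  then show "coef3 Y q t i j k - coef3 Y q t k j i = 0"
    using shuffle_freeD(1)[OF assms] by (simp add: 1)
  have "coef3 Y q t i j k + coef3 Y q (\<lambda>x y z. t y x z) i j k + coef3 Y q (\<lambda>x y z. t y z x) i j k
    = (\<Sum>x\<in>Y. \<Sum>y\<in>Y. \<Sum>z\<in>Y. q i x * q j y * q k z * (t x y z + t y x z + t y z x))"
    by (simp add: coef3_def sum.distrib algebra_simps)
  then show "coef3 Y q t i j k + coef3 Y q t j i k + coef3 Y q t j k i = 0"
    using shuffle_freeD(2)[OF assms] by (simp add: 2 3)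
qed

end

section \<open>The terms of low degree of elements of a normal subgroup\<close>

inductive_set zspan :: "'a::ab_group_add set \<Rightarrow> 'a set" for S where
  zspan_base: "a \<in> S \<Longrightarrow> a \<in> zspan S"
| zspan_zero: "0 \<in> zspan S"
| zspan_diff: "a \<in> zspan S \<Longrightarrow> b \<in> zspan S \<Longrightarrow> a - b \<in> zspan S"

lemma zsub_zspan: "zsub (zspan S)"
  by (intro zsubI zspan_zero zspan_diff)

lemma zspan_subset: "zsub T \<Longrightarrow> S \<subseteq> T \<Longrightarrow> zspan S \<subseteq> T"
proof
  fix a assume "zsub T" "S \<subseteq> T" "a \<in> zspan S"
  from this(3,1,2) show "a \<in> T" by induction (auto intro: zsub_zero zsub_diff)
qed

lemma zspan_mono: "S \<subseteq> T \<Longrightarrow> zspan S \<subseteq> zspan T"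
  by (intro zspan_subset zsub_zspan) (auto intro: zspan_base)

locale magnus_normal = magnus_coordinates +
  fixes R assumes R_normal: "R \<lhd> G"
begin

lemma R_subgroup: "subgroup R G"
  using R_normal by (rule normal_imp_subgroup)

lemma R_carrier [simp]: "r \<in> R \<Longrightarrow> r \<in> carrier G"
  using subgroup.mem_carrier[OF R_subgroup] .

lemmas R_closed = subgroup.m_closed[OF R_subgroup] subgroup.m_inv_closed[OF R_subgroup]
  subgroup.one_closed[OF R_subgroup]

lemma commutator_in_R: 
  assumes "r \<in> R" "g \<in> carrier G" shows "commutator G r g \<in> R" "commutator G g r \<in> R"
proof -
  have "g \<otimes> r \<otimes> inv g \<in> R" using normal.inv_op_closed2[OF R_normal assms(2,1)] .
  then have "g \<otimes> r \<otimes> inv g \<otimes> inv r \<in> R" using assms R_closed by blast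
  then show *: "commutator G g r \<in> R" by (simp add: commutator_def)
  show "commutator G r g \<in> R"
    using R_closed(2)[OF *] assms by (simp add: inv_commutator)
qed

text \<open>Only the degree one term is confined to \<open>Y\<close>; \<open>d2 r\<close> and
  \<open>d3 r\<close> may involve other generators. The resulting lattice is the whole intersection
  of \<open>B\<close> with the integer vectors on \<open>Y\<close>, and it has finite rank when
  \<open>Y\<close> is finite, as Smith normal form demands.\<close>

definition R_at :: "'a set \<Rightarrow> 'a set" where "R_at Y = {r \<in> R. supp1 Y (d1 r)}"

abbreviation R_lattice :: "'a set \<Rightarrow> 'a vec set" where "R_lattice Y \<equiv> d1 ` R_at Y"

lemma supp1_minus: "supp1 Y a \<Longrightarrow> supp1 Y (- a)"
  by (simp add: supp1_def)

lemma subgroup_R_at: "subgroup (R_at Y) G"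
  by unfold_locales (auto simp: R_at_def R_closed d1_mult d1_inv intro: supp_add supp1_minus)

lemma R_atD: "r \<in> R_at Y \<Longrightarrow> r \<in> R" "r \<in> R_at Y \<Longrightarrow> r \<in> carrier G" "r \<in> R_at Y \<Longrightarrow> supp1 Y (d1 r)"
  by (auto simp: R_at_def)

lemmas R_at_closed = subgroup.m_closed[OF subgroup_R_at] subgroup.m_inv_closed[OF subgroup_R_at]
  subgroup.one_closed[OF subgroup_R_at]

lemma zsub_lattice: "zsub (R_lattice Y)"
proof (rule zsubI)
  show "0 \<in> R_lattice Y" using R_at_closed(3) by (intro image_eqI[of _ _ \<one>]) auto
  fix a b assume "a \<in> R_lattice Y" "b \<in> R_lattice Y"
  then obtain r s where "r \<in> R_at Y" "s \<in> R_at Y" "a = d1 r" "b = d1 s" by auto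
  then show "a - b \<in> R_lattice Y"
    using R_at_closed by (intro image_eqI[of _ _ "r \<otimes> inv s"]) (auto simp: d1_mult d1_inv R_atD)
qed

lemma R_at_mono: "Y \<subseteq> Z \<Longrightarrow> R_at Y \<subseteq> R_at Z"
  using supp_mono(1) by (auto simp: R_at_def)

definition derived_R :: "'a set" where "derived_R = generate G {commutator G r s | r s. r \<in> R \<and> s \<in> R}"

lemma subgroup_derived_R: "subgroup derived_R G"
  unfolding derived_R_def by (intro generate_is_subgroup) auto

lemma derived_R_subset: "derived_R \<subseteq> R"
  unfolding derived_R_def using commutator_in_R
  by (intro generate_subset_subgroup R_subgroup) auto

lemma derived_R_lc2: "derived_R \<subseteq> lc2"
  unfolding derived_R_def using commutator_in_lc(1)[of _ 0]
  by (intro generate_subset_subgroup subgroup_lc) (auto simp: lc_1)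

lemma stacked_lattice:
  assumes "finite Y"
  obtains p q e s where "dual_bases Y p q" "\<And>i. i \<in> Y \<Longrightarrow> s i \<in> R_at Y"
    "\<And>i. i \<in> Y \<Longrightarrow> d1 (s i) = of_int (e i) * p i"
    "\<And>i b. i \<in> Y \<Longrightarrow> b \<in> R_lattice Y \<Longrightarrow> e i dvd pairing Y (q i) b"
proof -
  have "\<exists>p q e. dual_bases Y p q \<and>
     (\<forall>i\<in>Y. of_int (e i) * p i \<in> R_lattice Y \<and> (\<forall>b\<in>R_lattice Y. e i dvd pairing Y (q i) b))"
    by (rule stacked_bases[OF assms zsub_lattice]) (auto simp: R_at_def)
  then obtain p q e where *: "dual_bases Y p q" "\<And>i. i \<in> Y \<Longrightarrow> of_int (e i) * p i \<in> R_lattice Y"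
    "\<And>i b. i \<in> Y \<Longrightarrow> b \<in> R_lattice Y \<Longrightarrow> e i dvd pairing Y (q i) b"
    by blast
  have "\<forall>i\<in>Y. \<exists>r. r \<in> R_at Y \<and> d1 r = of_int (e i) * p i"
    using *(2) by (metis imageE)
  then obtain s where "\<And>i. i \<in> Y \<Longrightarrow> s i \<in> R_at Y \<and> d1 (s i) = of_int (e i) * p i"
    by metis
  then show ?thesis using that * by blast
qed

definition tensor_square :: "'a set \<Rightarrow> 'a ten2 set" where
  "tensor_square Y = zspan {t11 (d1 r) (d1 s) | r s. r \<in> R_at Y \<and> s \<in> R_at Y}"

lemma tensor_square_mono: "Y \<subseteq> Z \<Longrightarrow> tensor_square Y \<subseteq> tensor_square Z"
  unfolding tensor_square_def using R_at_mono[of Y Z] by (intro zspan_mono) blast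

lemma coef2_antisymmetric:
  assumes "w \<in> lc2"
  shows "coef2 Y q (d2 w) i j + coef2 Y q (d2 w) j i = 0"
proof -
  have "coef2 Y q (d2 w) i j + coef2 Y q (\<lambda>x y. d2 w y x) i j
      = (\<Sum>x\<in>Y. \<Sum>y\<in>Y. q i x * q j y * (d2 w x y + d2 w y x))"
    by (simp add: coef2_def sum.distrib algebra_simps)
  then show ?thesis
    unfolding coef2_swap[of Y q _ j i] using lc2_d2_antisymmetric[OF assms] by simp
qed

lemma derived_R_times_lc3:
  assumes w: "w \<in> carrier G" "d1 w = 0" and Y: "finite Y" "d2 w \<in> tensor_square Y"
  shows "\<exists>u\<in>derived_R. \<exists>v\<in>lc3. w = u \<otimes> v"
proof -
  obtain Y' where Y': "finite Y'" "supp2 Y' (d2 w)" using finite_support[OF w(1)] by blast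
  define Z where "Z = Y \<union> Y'"
  have Z: "finite Z" "supp2 Z (d2 w)" "d2 w \<in> tensor_square Z"
    using Y Y' supp_mono(2)[of Y' _ Z] tensor_square_mono[of Y Z] by (auto simp: Z_def)
  obtain p q e s where pq: "dual_bases Z p q" and s: "\<And>i. i \<in> Z \<Longrightarrow> s i \<in> R_at Z"
    "\<And>i. i \<in> Z \<Longrightarrow> d1 (s i) = of_int (e i) * p i"
    and e: "\<And>i b. i \<in> Z \<Longrightarrow> b \<in> R_lattice Z \<Longrightarrow> e i dvd pairing Z (q i) b"
    using stacked_lattice[OF Z(1)] by metis
  have w2: "w \<in> lc2" using d1_zero_lc2 w by blast
  \<comment> \<open>Divisibility passes to differences, so it is enough to see it on pure tensors,
    where the coordinate is the product of two coordinates of lattice vectors.\<close>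
  have dvd: "e i * e j dvd coef2 Z q t i j" if t: "t \<in> tensor_square Z" and ij: "i \<in> Z" "j \<in> Z" for t i j
  proof -
    have "tensor_square Z \<subseteq> {t. e i * e j dvd coef2 Z q t i j}"
      unfolding tensor_square_def
      by (intro zspan_subset zsubI) (use e ij in \<open>auto simp: coef2_t11 coef2_diff intro!: mult_dvd_mono\<close>)
    then show ?thesis using t by blast
  qed
  have dR: "u \<in> carrier G" "d1 u = 0" if "u \<in> derived_R" for u
    using that derived_R_subset derived_R_lc2 lc2_d1 by auto
  have "zsub (d2 ` derived_R)"
  proof (rule zsubI)
    show "0 \<in> d2 ` derived_R"
      using subgroup.one_closed[OF subgroup_derived_R] by (intro image_eqI[of _ _ \<one>]) auto
    fix a b assume "a \<in> d2 ` derived_R" "b \<in> d2 ` derived_R"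
    then obtain u v where uv: "u \<in> derived_R" "v \<in> derived_R" "a = d2 u" "b = d2 v" by auto
    then show "a - b \<in> d2 ` derived_R"
      using subgroup.m_closed[OF subgroup_derived_R] subgroup.m_inv_closed[OF subgroup_derived_R] dR
      by (intro image_eqI[of _ _ "u \<otimes> inv v"]) (auto simp: d2_mult d2_inv)
  qed
  then have "(\<Sum>i\<in>Z. \<Sum>j\<in>Z. of_int (coef2 Z q (d2 w) i j) * t11 (p i) (p j)) \<in> d2 ` derived_R"
  proof (rule antisymmetric_sum_in_zsub[where e = "\<lambda>i j. e i * e j"])
    show "of_int (e i * e j) * (t11 (p i) (p j) - t11 (p j) (p i)) \<in> d2 ` derived_R"
      if "i \<in> Z" "j \<in> Z" for i j
    proof (rule image_eqI)
      show "commutator G (s i) (s j) \<in> derived_R"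
        unfolding derived_R_def using that s R_atD by (intro generate.incl) blast
      show "of_int (e i * e j) * (t11 (p i) (p j) - t11 (p j) (p i)) = d2 (commutator G (s i) (s j))"
        unfolding d2_commutator[OF R_atD(2)[OF s(1)[OF that(1)]] R_atD(2)[OF s(1)[OF that(2)]]]
          s(2)[OF that(1)] s(2)[OF that(2)]
        by (simp add: t11_def fun_eq_iff algebra_simps)
    qed
  qed (use coef2_antisymmetric[OF w2] dvd Z in auto)
  then have "d2 w \<in> d2 ` derived_R" using dual_bases_expand2[OF pq Z(2)] by simp
  then obtain u where u: "u \<in> derived_R" "d2 w = d2 u" by auto
  have u2: "u \<in> lc2" "u \<in> carrier G" "inv u \<in> lc2"
    using u derived_R_lc2 derived_R_subset subgroup.m_inv_closed[OF subgroup_lc] by auto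
  have "inv u \<otimes> w \<in> lc2" using u2 w2 subgroup.m_closed[OF subgroup_lc] by blast
  moreover have "d2 (inv u \<otimes> w) = 0"
    using u2 w lc2_d1 u(2) by (simp add: d2_mult d2_inv)
  ultimately have "inv u \<otimes> w \<in> lc3" by (rule d2_zero_lc3)
  moreover have "w = u \<otimes> (inv u \<otimes> w)" using u2 w by simp
  ultimately show ?thesis using u by blast
qed

text \<open>Plays the role of \<open>B \<otimes> A \<otimes> A\<close>. Membership is tested column
  by column, with the last two indices fixed, rather than through a representation as a sum of
  tensors; this is the form in which \<open>e i\<close> is seen to divide the coordinates.\<close>

definition columns :: "'a set \<Rightarrow> 'a ten3 set" where
  "columns Y = {t. \<forall>y z. (\<lambda>x. t x y z) \<in> R_lattice Y}"

text \<open>The degree three term of the product (r - 1)(s - 1).\<close>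

definition mixed :: "'a \<Rightarrow> 'a \<Rightarrow> 'a ten3" where
  "mixed r s = t21 (d2 r) (d1 s) + t12 (d1 r) (d2 s)"

text \<open>The possible terms of degree two and three of elements of \<open>\<rr>\<^sup>2 \<int>[F]\<close>.\<close>

definition leading_pairs :: "'a set \<Rightarrow> ('a ten2 \<times> 'a ten3) set" where
  "leading_pairs Y = zspan
     ({(t11 (d1 r) (d1 s), mixed r s) | r s. r \<in> R_at Y \<and> s \<in> R_at Y} \<union> Pair 0 ` columns Y)"

lemma lattice_mono: "Y \<subseteq> Z \<Longrightarrow> R_lattice Y \<subseteq> R_lattice Z"
  using R_at_mono by blast

lemma columnsI: "(\<And>y z. (\<lambda>x. t x y z) \<in> R_lattice Y) \<Longrightarrow> t \<in> columns Y"
  by (simp add: columns_def)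

lemma columnsD: "t \<in> columns Y \<Longrightarrow> (\<lambda>x. t x y z) \<in> R_lattice Y"
  by (simp add: columns_def)

lemma columns_mono:
  assumes "Y \<subseteq> Z"
  shows "columns Y \<subseteq> columns Z"
proof
  fix t assume t: "t \<in> columns Y"
  show "t \<in> columns Z"
  proof (rule columnsI)
    show "(\<lambda>x. t x y z) \<in> R_lattice Z" for y z
      using lattice_mono[OF assms] columnsD[OF t, of y z] by (rule subsetD)
  qed
qed

lemma zsub_columns: "zsub (columns Y)"
proof (rule zsubI)
  show "0 \<in> columns Y"
  proof (rule columnsI)
    fix y z
    have "(\<lambda>x. (0 :: 'a ten3) x y z) = 0" by (simp add: fun_eq_iff)
    then show "(\<lambda>x. (0 :: 'a ten3) x y z) \<in> R_lattice Y"
      using zsub_zero[OF zsub_lattice[of Y]] by metis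
  qed
  fix a b assume ab: "a \<in> columns Y" "b \<in> columns Y"
  show "a - b \<in> columns Y"
  proof (rule columnsI)
    fix y z
    have "(\<lambda>x. (a - b) x y z) = (\<lambda>x. a x y z) - (\<lambda>x. b x y z)" by (simp add: fun_eq_iff)
    then show "(\<lambda>x. (a - b) x y z) \<in> R_lattice Y"
      using zsub_diff[OF zsub_lattice columnsD[OF ab(1)] columnsD[OF ab(2)]] by metis
  qed
qed

lemma lattice_scale: "b \<in> R_lattice Y \<Longrightarrow> (\<lambda>x. b x * k) \<in> R_lattice Y"
proof -
  assume "b \<in> R_lattice Y"
  then have "of_int k * b \<in> R_lattice Y" by (rule zsub_scale[OF zsub_lattice])
  moreover have "of_int k * b = (\<lambda>x. b x * k)" by (simp add: fun_eq_iff)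
  ultimately show ?thesis by simp
qed

lemma t12_columns: "b \<in> R_lattice Y \<Longrightarrow> t12 b c \<in> columns Y"
  unfolding t12_def by (rule columnsI) (rule lattice_scale)

lemma t21_columns: "b \<in> R_lattice Y \<Longrightarrow> t21 (t11 b a) c \<in> columns Y"
  unfolding t21_def t11_def mult.assoc by (rule columnsI) (rule lattice_scale)

lemma leading_pairs_mono:
  assumes "Y \<subseteq> Z"
  shows "leading_pairs Y \<subseteq> leading_pairs Z"
proof -
  have "{(t11 (d1 r) (d1 s), mixed r s) | r s. r \<in> R_at Y \<and> s \<in> R_at Y}
    \<subseteq> {(t11 (d1 r) (d1 s), mixed r s) | r s. r \<in> R_at Z \<and> s \<in> R_at Z}"
    using R_at_mono[OF assms] by blast
  then show ?thesis
    unfolding leading_pairs_def by (intro zspan_mono Un_mono image_mono columns_mono[OF assms])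
qed

lemma leading_pairs_fst:
  assumes "t \<in> leading_pairs Y"
  shows "fst t \<in> tensor_square Y"
proof -
  have zs: "zsub (tensor_square Y)" unfolding tensor_square_def by (rule zsub_zspan)
  have "zsub {t. fst t \<in> tensor_square Y}"
    using zsub_zero[OF zs] zsub_diff[OF zs] by (intro zsubI) simp_all
  then have "leading_pairs Y \<subseteq> {t. fst t \<in> tensor_square Y}"
    unfolding leading_pairs_def
  proof (rule zspan_subset, intro Un_least subsetI CollectI)
    fix x assume "x \<in> {(t11 (d1 r) (d1 s), mixed r s) | r s. r \<in> R_at Y \<and> s \<in> R_at Y}"
    then obtain r s where rs: "r \<in> R_at Y" "s \<in> R_at Y" and x: "fst x = t11 (d1 r) (d1 s)" by auto
    show "fst x \<in> tensor_square Y"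
      unfolding tensor_square_def x using rs by (intro zspan_base) blast
  next
    fix x :: "'a ten2 \<times> 'a ten3" assume "x \<in> Pair 0 ` columns Y"
    then have "fst x = 0" by (metis fst_conv imageE)
    then show "fst x \<in> tensor_square Y" using zsub_zero[OF zs] by simp
  qed
  then show ?thesis using assms by blast
qed

text \<open>Modulo this set \<^term>\<open>mixed r s\<close> depends only, and bilinearly, on \<^term>\<open>d1 r\<close> and \<^term>\<open>d1 s\<close>.\<close>

definition columns_mod :: "'a set \<Rightarrow> 'a ten3 set" where
  "columns_mod Y = {t. \<exists>u \<in> R \<inter> lc3. t - d3 u \<in> columns Y}"

lemma subgroup_R_lc3: "subgroup (R \<inter> lc3) G"
  using subgroups_Inter_pair[OF R_subgroup subgroup_lc] .

lemma d3_lc3_diff: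
  assumes "u \<in> R \<inter> lc3" "v \<in> R \<inter> lc3"
  shows "u \<otimes> inv v \<in> R \<inter> lc3" "d3 (u \<otimes> inv v) = d3 u - d3 v"
proof -
  show "u \<otimes> inv v \<in> R \<inter> lc3"
    using subgroup.m_closed[OF subgroup_R_lc3] subgroup.m_inv_closed[OF subgroup_R_lc3] assms by blast
  show "d3 (u \<otimes> inv v) = d3 u - d3 v"
    using assms lc_carrier by (simp add: d3_mult d3_inv d1_inv lc3_d1 lc3_d2)
qed

lemma columns_subset_mod: "columns Y \<subseteq> columns_mod Y"
  unfolding columns_mod_def using subgroup.one_closed[OF subgroup_R_lc3]
  by (auto intro!: bexI[of _ \<one>])

lemma zsub_columns_mod: "zsub (columns_mod Y)"
proof (rule zsubI)
  show "0 \<in> columns_mod Y" using columns_subset_mod zsub_zero[OF zsub_columns] by blast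
  fix a b assume "a \<in> columns_mod Y" "b \<in> columns_mod Y"
  then obtain u v where uv: "u \<in> R \<inter> lc3" "v \<in> R \<inter> lc3" "a - d3 u \<in> columns Y" "b - d3 v \<in> columns Y"
    by (auto simp: columns_mod_def)
  have "a - b - d3 (u \<otimes> inv v) = (a - d3 u) - (b - d3 v)"
    using d3_lc3_diff(2)[OF uv(1,2)] by simp
  then have "a - b - d3 (u \<otimes> inv v) \<in> columns Y"
    using zsub_diff[OF zsub_columns uv(3,4)] by metis
  then show "a - b \<in> columns_mod Y"
    unfolding columns_mod_def using d3_lc3_diff(1)[OF uv(1,2)] by blast
qed

text \<open>Additivity fails only by \<open>d1 r \<otimes> d1 r' \<otimes> d1 s\<close> in the first
  argument and by \<open>d1 s \<otimes> d1 r \<otimes> d1 r'\<close> in the second; both begin in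
  the lattice.\<close>

lemma mixed_mult:
  assumes "r \<in> R_at Y" "r' \<in> R_at Y" "s \<in> R_at Y"
  shows "mixed (r \<otimes> r') s - mixed r s - mixed r' s \<in> columns_mod Y"
    and "mixed s (r \<otimes> r') - mixed s r - mixed s r' \<in> columns_mod Y"
proof -
  have "mixed (r \<otimes> r') s - mixed r s - mixed r' s = t21 (t11 (d1 r) (d1 r')) (d1 s)"
    using assms R_atD by (simp add: mixed_def d1_mult d2_mult fun_eq_iff tensor_defs algebra_simps)
  then show "mixed (r \<otimes> r') s - mixed r s - mixed r' s \<in> columns_mod Y"
    using subsetD[OF columns_subset_mod t21_columns[OF imageI[OF assms(1)]]] by metis
  have "mixed s (r \<otimes> r') - mixed s r - mixed s r' = t12 (d1 s) (t11 (d1 r) (d1 r'))"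
    using assms R_atD by (simp add: mixed_def d1_mult d2_mult fun_eq_iff tensor_defs algebra_simps)
  then show "mixed s (r \<otimes> r') - mixed s r - mixed s r' \<in> columns_mod Y"
    using subsetD[OF columns_subset_mod t12_columns[OF imageI[OF assms(3)]]] by metis
qed

text \<open>An element \<open>y\<close> of R with \<open>d1 y = 0\<close> is in gamma_2, and
  \<open>mixed y s\<close> is \<open>d2 y \<otimes> d1 s\<close>, one half of the degree three term
  of [y, s]; the other half begins with \<open>d1 s\<close>. This is why \<open>columns_mod\<close>
  admits the terms of elements of \<open>R \<inter> lc3\<close>. In the other order the tensor
  itself begins with \<open>d1 s\<close>.\<close>

lemma mixed_kernel:
  assumes "y \<in> R_at Y" "d1 y = 0" "s \<in> R_at Y"
  shows "mixed y s \<in> columns_mod Y" and "mixed s y \<in> columns_mod Y"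
proof -
  have c: "y \<in> carrier G" "s \<in> carrier G" "y \<in> R" "s \<in> R" using assms R_atD by auto
  have y: "y \<in> lc2" using d1_zero_lc2 c assms by auto
  have "commutator G y s \<in> R \<inter> lc3"
    using commutator_in_R c commutator_in_lc(1)[OF y] by auto
  moreover have "mixed y s - d3 (commutator G y s) = t12 (d1 s) (d2 y)"
    using c assms by (simp add: mixed_def d3_commutator)
  moreover have t: "t12 (d1 s) (d2 y) \<in> columns Y" using t12_columns[OF imageI[OF assms(3)]] .
  ultimately show "mixed y s \<in> columns_mod Y"
    unfolding columns_mod_def by (intro CollectI bexI[of _ "commutator G y s"]) simp_all
  have "mixed s y = t12 (d1 s) (d2 y)" using assms by (simp add: mixed_def)
  then show "mixed s y \<in> columns_mod Y"
    using subsetD[OF columns_subset_mod t] by simp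
qed

lemma d1_int_pow: "g \<in> carrier G \<Longrightarrow> d1 (g [^] (n::int)) = of_int n * d1 g"
  using additive_int_pow[OF subgroup_self, of "\<lambda>g. d1 g z" g n for z] by (simp add: d1_mult fun_eq_iff)

text \<open>Modulo \<open>Q\<close> the function \<open>f\<close> is additive and vanishes on the
  kernel of \<open>d1\<close>, so its class is a linear function of \<open>d1 r\<close>. The
  statement concerns one variable, to be applied to the two arguments of \<open>mixed\<close> in
  turn.\<close>

lemma quasi_additive_combination:
  fixes f :: "'a \<Rightarrow> 'c::ring_1"
  assumes Q: "zsub Q"
    and f: "\<And>r r'. r \<in> R_at Y \<Longrightarrow> r' \<in> R_at Y \<Longrightarrow> f (r \<otimes> r') - f r - f r' \<in> Q"
    and k: "\<And>y. y \<in> R_at Y \<Longrightarrow> d1 y = 0 \<Longrightarrow> f y \<in> Q"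
    and J: "finite J" "\<And>i. i \<in> J \<Longrightarrow> s i \<in> R_at Y"
    and r: "r \<in> R_at Y" "d1 r = (\<Sum>i\<in>J. of_int (c i) * d1 (s i))"
  shows "f r - (\<Sum>i\<in>J. of_int (c i) * f (s i)) \<in> Q"
proof -
  note add = zsub_add[OF Q] and diff = zsub_diff[OF Q]
  have neg: "f (inv a) + f a \<in> Q" if "a \<in> R_at Y" for a
    using diff[OF k[of \<one>] f[of "inv a" a]] that R_at_closed R_atD by (simp add: add.commute)
  have pow: "f (a [^] n) - of_int n * f a \<in> Q" if a: "a \<in> R_at Y" for a and n :: int
  proof (induction n rule: int_induct[of _ 0])
    case base
    then show ?case using k[of \<one>] R_at_closed by simp
  next
    case (step1 i)
    have e: "a [^] (i + 1) = a [^] i \<otimes> a" using a R_atD by (simp add: int_pow_mult)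
    have "f (a [^] i \<otimes> a) - of_int (i + 1) * f a
      = (f (a [^] i \<otimes> a) - f (a [^] i) - f a) + (f (a [^] i) - of_int i * f a)"
      by (simp add: algebra_simps)
    moreover have "\<dots> \<in> Q"
      using step1 a subgroup_int_pow_closed[OF subgroup_R_at] by (intro add f) auto
    ultimately show ?case unfolding e by metis
  next
    case (step2 i)
    have e: "a [^] (i - 1) = a [^] i \<otimes> inv a" using a R_atD by (simp add: int_pow_diff)
    have ia: "inv a \<in> R_at Y" using a R_at_closed by blast
    have "f (a [^] i \<otimes> inv a) - of_int (i - 1) * f a
      = (f (a [^] i \<otimes> inv a) - f (a [^] i) - f (inv a)) + (f (a [^] i) - of_int i * f a) + (f (inv a) + f a)"
      by (simp add: algebra_simps)
    moreover have "\<dots> \<in> Q"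
      using step2 a ia subgroup_int_pow_closed[OF subgroup_R_at] by (intro add f neg) auto
    ultimately show ?case unfolding e by metis
  qed
  show ?thesis
    using J r
  proof (induction J arbitrary: r rule: finite_induct)
    case empty
    have "d1 r = 0" by (rule trans[OF empty.prems(3) sum.empty])
    then show ?case using k[OF empty.prems(2)] by simp
  next
    case (insert j J)
    define a where "a = s j [^] c j"
    have sj: "s j \<in> R_at Y" "s j \<in> carrier G" using insert.prems(1)[of j] R_atD by auto
    have a: "a \<in> R_at Y" "a \<in> carrier G" "d1 a = of_int (c j) * d1 (s j)" "f a - of_int (c j) * f (s j) \<in> Q"
      using pow[OF sj(1), of "c j"] sj d1_int_pow subgroup_int_pow_closed[OF subgroup_R_at]
      by (auto simp: a_def)
    define r' where "r' = r \<otimes> inv a"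
    have r': "r' \<in> R_at Y" using a(1) insert.prems(2) R_at_closed by (simp add: r'_def)
    have rc: "r \<in> carrier G" using insert.prems R_atD by auto
    have "d1 r' = d1 r - d1 a" using rc a(2) by (simp add: r'_def d1_mult d1_inv)
    also have "\<dots> = (\<Sum>i\<in>J. of_int (c i) * d1 (s i))"
      unfolding insert.prems(3) a(3) sum.insert[OF insert.hyps(1,2)] by (rule add_diff_cancel_left')
    finally have "d1 r' = (\<Sum>i\<in>J. of_int (c i) * d1 (s i))" .
    then have "f r' - (\<Sum>i\<in>J. of_int (c i) * f (s i)) \<in> Q"
      by (rule insert.IH[OF _ r', rotated]) (use insert.prems(1) in blast)
    moreover have "r = r' \<otimes> a" using a rc by (simp add: r'_def m_assoc)
    then have "f r - f r' - f a \<in> Q" using f[OF r' a(1)] by simp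
    moreover have "f r - (\<Sum>i\<in>insert j J. of_int (c i) * f (s i))
       = (f r - f r' - f a) + (f r' - (\<Sum>i\<in>J. of_int (c i) * f (s i))) + (f a - of_int (c j) * f (s j))"
      using insert.hyps by simp
    ultimately show ?case using a(4) add by metis
  qed
qed

text \<open>Here the injectivity of \<open>B \<otimes> B \<rightarrow> A \<otimes> A\<close> takes
  effect. The coordinates of the degree two term, divided by \<open>e i * e j\<close>, are its
  coefficients with respect to the lattice vectors; since \<open>mixed\<close> is bilinear modulo
  \<open>columns_mod\<close>, they determine the degree three term there as \<open>T\<close>, and
  \<open>T 0 = 0\<close>.\<close>

lemma leading_pairs_zero:
  assumes Y: "finite Y" and t: "(0, t) \<in> leading_pairs Y"
  shows "t \<in> columns_mod Y"
proof -
  obtain p q e s where pq: "dual_bases Y p q" and s: "\<And>i. i \<in> Y \<Longrightarrow> s i \<in> R_at Y"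
    "\<And>i. i \<in> Y \<Longrightarrow> d1 (s i) = of_int (e i) * p i"
    and e: "\<And>i b. i \<in> Y \<Longrightarrow> b \<in> R_lattice Y \<Longrightarrow> e i dvd pairing Y (q i) b"
    using stacked_lattice[OF Y] by metis
  \<comment> \<open>If \<open>e i = 0\<close>, then the coordinate itself is 0 on the lattice, and
    the convention that division by 0 gives 0 yields the right coefficient.\<close>
  define k where "k = (\<lambda>i r. pairing Y (q i) (d1 r) div e i)"
  have d1k: "d1 r = (\<Sum>i\<in>Y. of_int (k i r) * d1 (s i))" if "r \<in> R_at Y" for r
  proof -
    have "d1 r = (\<Sum>i\<in>Y. of_int (pairing Y (q i) (d1 r)) * p i)"
      using pq R_atD(3)[OF that] by (simp add: dual_bases_def)
    also have "\<dots> = (\<Sum>i\<in>Y. of_int (k i r) * d1 (s i))"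
    proof (rule sum.cong)
      fix i assume i: "i \<in> Y"
      have "pairing Y (q i) (d1 r) = k i r * e i" using e[OF i] that by (simp add: k_def)
      then show "of_int (pairing Y (q i) (d1 r)) * p i = of_int (k i r) * d1 (s i)"
        using s i by (simp add: mult.assoc)
    qed simp
    finally show ?thesis .
  qed
  define T where "T = (\<lambda>t. \<Sum>i\<in>Y. \<Sum>j\<in>Y. of_int (coef2 Y q t i j div (e i * e j)) * mixed (s i) (s j))"
  \<comment> \<open>The divisibility is part of the invariant because \<open>div\<close> respects
    differences only between multiples of the divisor, and the additivity of \<open>T\<close> rests
    on this.\<close>
  define W where "W = {t. (\<forall>i\<in>Y. \<forall>j\<in>Y. e i * e j dvd coef2 Y q (fst t) i j) \<and>
    snd t - T (fst t) \<in> columns_mod Y}"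
  have T0: "T 0 = 0" by (simp add: T_def)
  have "leading_pairs Y \<subseteq> W"
    unfolding leading_pairs_def
  proof (intro zspan_subset zsubI Un_least subsetI)
    show "0 \<in> W" using zsub_zero[OF zsub_columns_mod] by (simp add: W_def T0)
  next
    fix a b assume ab: "a \<in> W" "b \<in> W"
    have "T (fst a - fst b) = T (fst a) - T (fst b)"
      unfolding T_def sum_subtractf[symmetric] using ab
      by (intro sum.cong refl) (simp add: W_def coef2_diff left_diff_distrib)
    then have "snd (a - b) - T (fst (a - b)) = (snd a - T (fst a)) - (snd b - T (fst b))" by simp
    moreover have "\<dots> \<in> columns_mod Y"
      by (rule zsub_diff[OF zsub_columns_mod]) (use ab W_def in blast)+
    ultimately have "snd (a - b) - T (fst (a - b)) \<in> columns_mod Y" by metis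
    moreover have "\<forall>i\<in>Y. \<forall>j\<in>Y. e i * e j dvd coef2 Y q (fst (a - b)) i j"
      using ab by (simp add: W_def coef2_diff)
    ultimately show "a - b \<in> W" unfolding W_def by blast
  next
    fix a assume "a \<in> {(t11 (d1 r) (d1 s), mixed r s) |r s. r \<in> R_at Y \<and> s \<in> R_at Y}"
    then obtain r r' where a: "fst a = t11 (d1 r) (d1 r')" "snd a = mixed r r'" "r \<in> R_at Y" "r' \<in> R_at Y"
      by auto
    have dvd: "e i * e j dvd coef2 Y q (fst a) i j"
      and div: "coef2 Y q (fst a) i j div (e i * e j) = k i r * k j r'" if "i \<in> Y" "j \<in> Y" for i j
      using e that a by (auto simp: coef2_t11 k_def intro!: mult_dvd_mono div_mult_div_if_dvd[symmetric])
    have 1: "mixed r r' - (\<Sum>i\<in>Y. of_int (k i r) * mixed (s i) r') \<in> columns_mod Y"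
      by (rule quasi_additive_combination[OF zsub_columns_mod _ _ Y s(1) a(3) d1k[OF a(3)]])
        (intro mixed_mult mixed_kernel a | assumption)+
    have 2: "mixed (s i) r' - (\<Sum>j\<in>Y. of_int (k j r') * mixed (s i) (s j)) \<in> columns_mod Y" if "i \<in> Y" for i
      by (rule quasi_additive_combination[OF zsub_columns_mod _ _ Y s(1) a(4) d1k[OF a(4)]])
        (intro mixed_mult mixed_kernel s that | assumption)+
    have "T (fst a) = (\<Sum>i\<in>Y. of_int (k i r) * (\<Sum>j\<in>Y. of_int (k j r') * mixed (s i) (s j)))"
      unfolding T_def sum_distrib_left by (intro sum.cong refl) (simp add: div mult.assoc)
    then have "snd a - T (fst a) = (mixed r r' - (\<Sum>i\<in>Y. of_int (k i r) * mixed (s i) r'))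
      + (\<Sum>i\<in>Y. of_int (k i r) * (mixed (s i) r' - (\<Sum>j\<in>Y. of_int (k j r') * mixed (s i) (s j))))"
      using a by (simp add: right_diff_distrib sum_subtractf)
    also have "\<dots> \<in> columns_mod Y"
      by (intro zsub_add[OF zsub_columns_mod] zsub_sum[OF zsub_columns_mod] zsub_scale[OF zsub_columns_mod] 1 2)
    finally show "a \<in> W" using dvd unfolding W_def by blast
  next
    fix a :: "'a ten2 \<times> 'a ten3" assume "a \<in> Pair 0 ` columns Y"
    then obtain c where c: "c \<in> columns Y" "a = (0, c)" by blast
    then show "a \<in> W"
      using subsetD[OF columns_subset_mod c(1)] by (simp add: W_def T0)
  qed
  from subsetD[OF this t] show ?thesis by (simp add: W_def T0)
qed

section \<open>Realizing Lie elements of degree three inside R\<close>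

lemma d1_surj:
  assumes "finite Y" "Y \<subseteq> X" "supp1 Y v"
  shows "\<exists>g \<in> carrier G. d1 g = v"
  using assms
proof (induction Y arbitrary: v rule: finite_induct)
  case empty
  then have "v = 0" by (auto simp: supp1_def fun_eq_iff)
  then show ?case by (intro bexI[of _ \<one>]) auto
next
  case (insert x Y)
  define v' where "v' = v(x := 0)"
  have "supp1 Y v'" using insert by (auto simp: supp1_def v'_def)
  then obtain g where g: "g \<in> carrier G" "d1 g = v'" using insert by auto
  have x: "x \<in> X" "x \<in> carrier G" using insert by auto
  have "d1 (g \<otimes> x [^] v x) = v"
    using g x by (auto simp: d1_mult d1_int_pow d1_X fun_eq_iff v'_def delta_def)
  then show ?case using g x by (intro bexI[of _ "g \<otimes> x [^] v x"]) auto
qed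

lemma columns_lc3:
  assumes v: "v \<in> lc3" and Y: "finite Y" "Y \<subseteq> X" "d3 v \<in> columns Y"
  shows "\<exists>u \<in> R \<inter> lc3. d3 u = d3 v"
proof -
  obtain Y' where Y': "finite Y'" "Y' \<subseteq> X" "supp3 Y' (d3 v)"
    using finite_support[OF lc_carrier[OF v]] by blast
  \<comment> \<open>Membership in \<open>columns Y\<close> confines only the first index to
    \<open>Y\<close>; the expansion in a basis needs all three confined.\<close>
  define Z where "Z = Y \<union> Y'"
  have Z: "finite Z" "Z \<subseteq> X" "supp3 Z (d3 v)" "d3 v \<in> columns Z"
    using Y Y' supp_mono(3)[of Y' _ Z] columns_mono[of Y Z] by (auto simp: Z_def)
  obtain p q e s where pq: "dual_bases Z p q" and s: "\<And>i. i \<in> Z \<Longrightarrow> s i \<in> R_at Z"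
    "\<And>i. i \<in> Z \<Longrightarrow> d1 (s i) = of_int (e i) * p i"
    and e: "\<And>i b. i \<in> Z \<Longrightarrow> b \<in> R_lattice Z \<Longrightarrow> e i dvd pairing Z (q i) b"
    using stacked_lattice[OF Z(1)] by metis
  have "\<forall>i\<in>Z. \<exists>g\<in>carrier G. d1 g = p i"
    using d1_surj[OF Z(1,2)] pq by (auto simp: dual_bases_def)
  then obtain f where f: "\<And>i. i \<in> Z \<Longrightarrow> f i \<in> carrier G" "\<And>i. i \<in> Z \<Longrightarrow> d1 (f i) = p i" by metis
  have zs: "zsub (d3 ` (R \<inter> lc3))"
  proof (rule zsubI)
    show "0 \<in> d3 ` (R \<inter> lc3)"
      using subgroup.one_closed[OF subgroup_R_lc3] by (intro image_eqI[of _ _ \<one>]) auto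
    fix a b assume "a \<in> d3 ` (R \<inter> lc3)" "b \<in> d3 ` (R \<inter> lc3)"
    then obtain u v where "u \<in> R \<inter> lc3" "v \<in> R \<inter> lc3" "a = d3 u" "b = d3 v" by blast
    then show "a - b \<in> d3 ` (R \<inter> lc3)"
      using d3_lc3_diff by (intro image_eqI[of _ _ "u \<otimes> inv v"]) auto
  qed
  have "(\<Sum>i\<in>Z. \<Sum>j\<in>Z. \<Sum>k\<in>Z. of_int (coef3 Z q (d3 v) i j k) * t21 (t11 (p i) (p j)) (p k))
    \<in> d3 ` (R \<inter> lc3)"
  proof (rule shuffle_free_sum_in_zsub[OF zs shuffle_free_coef3[OF lc3_d3_shuffle_free[OF v]]])
    fix i j k assume ijk: "i \<in> Z" "j \<in> Z" "k \<in> Z"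
    show "e i dvd coef3 Z q (d3 v) i j k"
      unfolding coef3_pairing using Z(4) e[OF ijk(1)]
      by (intro dvd_sum dvd_mult) (auto dest: columnsD)
    \<comment> \<open>The factor \<open>e i\<close> is absorbed in replacing \<open>p i\<close> by
      \<open>d1 (s i)\<close>, whereas \<open>p j\<close> and \<open>p k\<close> are lifted to
      elements of the whole group. Normality keeps the commutators in \<open>R\<close>.\<close>
    define u where "u = commutator G (s i) (f j)"
    have c: "s i \<in> R" "s i \<in> carrier G" "f j \<in> carrier G" "f k \<in> carrier G"
      using ijk s f R_atD by blast+
    have u: "u \<in> R" "u \<in> lc2" "u \<in> carrier G"
      using c commutator_in_R commutator_in_lc(1)[of "s i" 0] by (auto simp: u_def lc_1)
    have "commutator G u (f k) \<in> R \<inter> lc3"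
      using u c commutator_in_R commutator_in_lc(1)[OF u(2)] by auto
    moreover have "of_int (e i) * (t21 (t11 (p i) (p j)) (p k) - t21 (t11 (p j) (p i)) (p k)
        - t21 (t11 (p k) (p i)) (p j) + t21 (t11 (p k) (p j)) (p i)) = d3 (commutator G u (f k))"
      using u c ijk s f
      by (simp add: d3_commutator lc2_d1 u_def d1_commutator d2_commutator fun_eq_iff tensor_defs algebra_simps)
    ultimately show "of_int (e i) * (t21 (t11 (p i) (p j)) (p k) - t21 (t11 (p j) (p i)) (p k)
        - t21 (t11 (p k) (p i)) (p j) + t21 (t11 (p k) (p j)) (p i)) \<in> d3 ` (R \<inter> lc3)"
      by (rule image_eqI[rotated])
  qed
  then have "d3 v \<in> d3 ` (R \<inter> lc3)" using dual_bases_expand3[OF pq Z(3)] by simp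
  then show ?thesis by (metis imageE)
qed

text \<open>Two corrections from \<open>R \<inter> lc3\<close>: the first brings the degree three
  term into \<open>columns Y\<close>, the second then cancels it, and the remaining factor lies in
  gamma_4.\<close>

lemma R_times_lc4:
  assumes v: "v \<in> lc3" and Y: "finite Y" "Y \<subseteq> X" "(0, d3 v) \<in> leading_pairs Y"
  shows "\<exists>u\<in>R. \<exists>w\<in>lc4. v = u \<otimes> w"
proof -
  obtain u where u: "u \<in> R \<inter> lc3" "d3 v - d3 u \<in> columns Y"
    using leading_pairs_zero[OF Y(1,3)] by (auto simp: columns_mod_def)
  have sub: "d3 (inv x \<otimes> y) = d3 y - d3 x" "inv x \<otimes> y \<in> lc3" if "x \<in> lc3" "y \<in> lc3" for x y
    using that lc_carrier subgroup.m_closed[OF subgroup_lc] subgroup.m_inv_closed[OF subgroup_lc]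
    by (auto simp: d3_mult d3_inv d1_inv lc3_d1 lc3_d2)
  have v': "inv u \<otimes> v \<in> lc3" "d3 (inv u \<otimes> v) = d3 v - d3 u" using sub u v by auto
  then obtain u' where u': "u' \<in> R \<inter> lc3" "d3 u' = d3 (inv u \<otimes> v)"
    using columns_lc3[OF _ Y(1,2)] u by metis
  have "inv u' \<otimes> (inv u \<otimes> v) \<in> lc4"
    using d3_zero_lc4[of "inv u' \<otimes> (inv u \<otimes> v)"] sub[of u' "inv u \<otimes> v"] u' v' by simp
  moreover have "v = (u \<otimes> u') \<otimes> (inv u' \<otimes> (inv u \<otimes> v))"
    using u u' v lc_carrier by (simp add: m_assoc)
  moreover have "u \<otimes> u' \<in> R" using u u' R_closed by auto
  ultimately show ?thesis by blast
qed

end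

section \<open>Integral group rings\<close>

definition lin :: "('a \<Rightarrow> int) \<Rightarrow> ('a \<Rightarrow>\<^sub>0 int) \<Rightarrow> int" where
  "lin f a = (\<Sum>g\<in>Poly_Mapping.keys a. Poly_Mapping.lookup a g * f g)"

lemma lin_superset:
  "finite S \<Longrightarrow> Poly_Mapping.keys a \<subseteq> S \<Longrightarrow> lin f a = (\<Sum>g\<in>S. Poly_Mapping.lookup a g * f g)"
  unfolding lin_def by (rule sum.mono_neutral_left) (auto simp: in_keys_iff)

lemma lin_diff [simp]: "lin f (a - b) = lin f a - lin f b"
proof -
  let ?S = "Poly_Mapping.keys a \<union> Poly_Mapping.keys b"
  have "lin f (a - b) = (\<Sum>g\<in>?S. Poly_Mapping.lookup (a - b) g * f g)"
    by (intro lin_superset) (auto simp: in_keys_iff lookup_minus)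
  then show ?thesis
    using lin_superset[of ?S a f] lin_superset[of ?S b f]
    by (simp add: lookup_minus left_diff_distrib sum_subtractf)
qed

lemma lin_zero [simp]: "lin f 0 = 0"
  by (simp add: lin_def)

lemma lin_minus [simp]: "lin f (- a) = - lin f a"
  using lin_diff[of f 0 a] by simp

lemma lin_add [simp]: "lin f (a + b) = lin f a + lin f b"
  using lin_diff[of f a "- b"] by simp

lemma lin_frag_of [simp]: "lin f (frag_of g) = f g"
  by (simp add: lin_def)

lemma lin_cong: "(\<And>g. g \<in> Poly_Mapping.keys a \<Longrightarrow> f g = f' g) \<Longrightarrow> lin f a = lin f' a"
  by (simp add: lin_def)

lemma augmentation_eq_lin: "augmentation = lin (\<lambda>_. 1)"
  by (simp add: fun_eq_iff augmentation_def lin_def)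

lemma lin_fun_simps:
  "lin (\<lambda>g. f g + f' g) a = lin f a + lin f' a"
  "lin (\<lambda>g. c * f g) a = c * lin f a"
  "lin (\<lambda>g. f g * c) a = lin f a * c"
  "lin (\<lambda>g. c) a = c * lin (\<lambda>_. 1) a"
  by (simp_all add: lin_def algebra_simps sum.distrib sum_distrib_left)

lemma lin_frag_extend: "lin f (frag_extend h a) = lin (\<lambda>g. lin f (h g)) a"
  by (induction a rule: frag_induction[OF subset_UNIV]) (auto simp: frag_extend_diff)

context group
begin

abbreviation gr_mult :: "('a \<Rightarrow>\<^sub>0 int) \<Rightarrow> ('a \<Rightarrow>\<^sub>0 int) \<Rightarrow> ('a \<Rightarrow>\<^sub>0 int)" (infixl "\<star>" 70) where
  "a \<star> b \<equiv> a \<otimes>\<^bsub>group_ring G\<^esub> b"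

lemma gr_mult_def: "a \<star> b = frag_extend (\<lambda>g. frag_extend (\<lambda>h. frag_of (g \<otimes> h)) b) a"
  by (simp add: group_ring_def)

lemma gr_simps: "\<one>\<^bsub>group_ring G\<^esub> = frag_of \<one>" "a \<oplus>\<^bsub>group_ring G\<^esub> b = a + b"
  "a \<in> carrier (group_ring G) \<longleftrightarrow> Poly_Mapping.keys a \<subseteq> carrier G"
  by (simp_all add: group_ring_def)

lemma gr_mult_diff:
  "(a - a') \<star> b = a \<star> b - a' \<star> b"
  "a \<star> (b - b') = a \<star> b - a \<star> b'"
proof -
  show "(a - a') \<star> b = a \<star> b - a' \<star> b" by (simp add: gr_mult_def frag_extend_diff)
  show "a \<star> (b - b') = a \<star> b - a \<star> b'"
    unfolding gr_mult_def frag_extend_diff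
    by (induction a rule: frag_induction[OF subset_UNIV]) (auto simp: frag_extend_diff)
qed

lemma gr_mult_zero [simp]: "0 \<star> b = 0" "a \<star> 0 = 0"
  using gr_mult_diff(1)[of 0 0 b] gr_mult_diff(2)[of a 0 0] by simp_all

lemma gr_mult_minus: "(- a) \<star> b = - (a \<star> b)" "a \<star> (- b) = - (a \<star> b)"
  using gr_mult_diff(1)[of 0 a b] gr_mult_diff(2)[of a 0 b] by simp_all

lemma gr_mult_add:
  "(a + a') \<star> b = a \<star> b + a' \<star> b"
  "a \<star> (b + b') = a \<star> b + a \<star> b'"
  using gr_mult_diff(1)[of a "- a'" b] gr_mult_diff(2)[of a b "- b'"] by (simp_all add: gr_mult_minus)

lemma gr_mult_frag_of [simp]: "frag_of g \<star> frag_of h = frag_of (g \<otimes> h)"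
  by (simp add: gr_mult_def)

lemma gr_mult_assoc:
  assumes "Poly_Mapping.keys a \<subseteq> carrier G" "Poly_Mapping.keys b \<subseteq> carrier G"
    "Poly_Mapping.keys c \<subseteq> carrier G"
  shows "(a \<star> b) \<star> c = a \<star> (b \<star> c)"
  using assms(1)
proof (induction a rule: frag_induction)
  case (one g)
  show ?case using assms(2)
  proof (induction b rule: frag_induction)
    case (one h)
    show ?case using assms(3)
      by (induction c rule: frag_induction) (use one \<open>g \<in> carrier G\<close> in \<open>auto simp: m_assoc gr_mult_diff\<close>)
  qed (auto simp: gr_mult_diff)
qed (auto simp: gr_mult_diff)

lemma gr_mult_one:
  "Poly_Mapping.keys a \<subseteq> carrier G \<Longrightarrow> frag_of \<one> \<star> a = a"
  "Poly_Mapping.keys a \<subseteq> carrier G \<Longrightarrow> a \<star> frag_of \<one> = a"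
  by (induction a rule: frag_induction) (auto simp: gr_mult_diff)

lemma keys_gr_mult:
  assumes "subgroup H G" "Poly_Mapping.keys a \<subseteq> H" "Poly_Mapping.keys b \<subseteq> H"
  shows "Poly_Mapping.keys (a \<star> b) \<subseteq> H"
proof -
  have "Poly_Mapping.keys (frag_extend (\<lambda>h. frag_of (g \<otimes> h)) b) \<subseteq> H" if "g \<in> H" for g
    using keys_frag_extend[of "\<lambda>h. frag_of (g \<otimes> h)" b] that assms(3) subgroup.m_closed[OF assms(1)]
    by auto
  then show ?thesis
    unfolding gr_mult_def
    using keys_frag_extend[of "\<lambda>g. frag_extend (\<lambda>h. frag_of (g \<otimes> h)) b" a] assms(2) by blast
qed

lemma lin_gr_mult: "lin f (a \<star> b) = lin (\<lambda>g. lin (\<lambda>h. f (g \<otimes> h)) b) a"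
  by (simp add: gr_mult_def lin_frag_extend)

lemma augmentation_gr_mult: "augmentation (a \<star> b) = augmentation a * augmentation b"
  by (simp add: augmentation_eq_lin lin_gr_mult lin_fun_simps(4)[of "lin (\<lambda>_. 1) b"])

lemma augmentation_simps [simp]:
  "augmentation 0 = 0" "augmentation (a + b) = augmentation a + augmentation b"
  "augmentation (a - b) = augmentation a - augmentation b"
  "augmentation (- a) = - augmentation a" "augmentation (frag_of g) = 1"
  by (simp_all add: augmentation_eq_lin)

lemma augmentation_ideal_iff:
  "a \<in> augmentation_ideal G \<longleftrightarrow> Poly_Mapping.keys a \<subseteq> carrier G \<and> augmentation a = 0"
  "a \<in> augmentation_ideal (G\<lparr>carrier := H\<rparr>) \<longleftrightarrow> Poly_Mapping.keys a \<subseteq> H \<and> augmentation a = 0"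
  by (simp_all add: augmentation_ideal_def group_ring_def)

lemma keys_add_subset: "Poly_Mapping.keys a \<subseteq> S \<Longrightarrow> Poly_Mapping.keys b \<subseteq> S \<Longrightarrow> Poly_Mapping.keys (a + b) \<subseteq> S"
  using keys_add[of a b] by blast

lemma keys_diff_subset: "Poly_Mapping.keys a \<subseteq> S \<Longrightarrow> Poly_Mapping.keys b \<subseteq> S \<Longrightarrow> Poly_Mapping.keys (a - b) \<subseteq> S"
  using keys_diff[of a b] by blast

lemma group_inter_one_plus_iff:
  "g \<in> group_inter_one_plus G J \<longleftrightarrow> g \<in> carrier G \<and> frag_of g - frag_of \<one> \<in> J"
  unfolding group_inter_one_plus_def a_l_coset_def'
  by (auto simp: gr_simps) (metis add_diff_cancel_left' diff_add_cancel add.commute)+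

lemma ideal_prod_keys:
  assumes "\<And>a. a \<in> I \<Longrightarrow> Poly_Mapping.keys a \<subseteq> H" "\<And>a. a \<in> J \<Longrightarrow> Poly_Mapping.keys a \<subseteq> H"
    "subgroup H G" "z \<in> I \<cdot>\<^bsub>group_ring G\<^esub> J"
  shows "Poly_Mapping.keys z \<subseteq> H"
  using assms(4)
proof induction
  case (prod i j)
  show ?case by (rule keys_gr_mult[OF assms(3) assms(1)[OF prod(1)] assms(2)[OF prod(2)]])
next
  case (sum s1 s2)
  show ?case unfolding gr_simps(2) by (rule keys_add_subset[OF sum.IH])
qed

lemma ideal_prod_add:
  "a \<in> I \<cdot>\<^bsub>group_ring G\<^esub> J \<Longrightarrow> b \<in> I \<cdot>\<^bsub>group_ring G\<^esub> J \<Longrightarrow> a + b \<in> I \<cdot>\<^bsub>group_ring G\<^esub> J"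
  using ideal_prod.sum[of a "group_ring G" I J b] by (simp add: gr_simps)

lemma ideal_prod_minus:
  assumes "\<And>a. a \<in> I \<Longrightarrow> - a \<in> I" "z \<in> I \<cdot>\<^bsub>group_ring G\<^esub> J"
  shows "- z \<in> I \<cdot>\<^bsub>group_ring G\<^esub> J"
  using assms(2)
proof induction
  case (prod i j)
  then show ?case using ideal_prod.prod[of "- i" I j J "group_ring G"] assms(1) by (simp add: gr_mult_minus)
next
  case (sum s1 s2)
  then show ?case using ideal_prod_add[of "- s1" I J "- s2"] by (simp add: gr_simps add.commute)
qed

text \<open>A target \<open>I'\<close> different from \<open>I\<close> is allowed so that the lemma
  covers both stability under left multiplication and the raising of the exponent of an ideal
  power.\<close>

lemma ideal_prod_left:
  assumes "\<And>a. a \<in> I \<Longrightarrow> c \<star> a \<in> I'" "\<And>a. a \<in> I \<Longrightarrow> Poly_Mapping.keys a \<subseteq> carrier G"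
    "\<And>a. a \<in> J \<Longrightarrow> Poly_Mapping.keys a \<subseteq> carrier G" "Poly_Mapping.keys c \<subseteq> carrier G"
    "z \<in> I \<cdot>\<^bsub>group_ring G\<^esub> J"
  shows "c \<star> z \<in> I' \<cdot>\<^bsub>group_ring G\<^esub> J"
  using assms(5)
proof induction
  case (prod i j)
  then show ?case using ideal_prod.prod[of "c \<star> i" I' j J "group_ring G"] assms(1-4)
    by (simp add: gr_mult_assoc)
next
  case (sum s1 s2)
  then show ?case using ideal_prod_add[of "c \<star> s1" I' J "c \<star> s2"] by (simp add: gr_simps(2) gr_mult_add)
qed

lemma ideal_prod_right:
  assumes "\<And>a. a \<in> J \<Longrightarrow> a \<star> c \<in> J" "\<And>a. a \<in> I \<Longrightarrow> Poly_Mapping.keys a \<subseteq> carrier G"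
    "\<And>a. a \<in> J \<Longrightarrow> Poly_Mapping.keys a \<subseteq> carrier G" "Poly_Mapping.keys c \<subseteq> carrier G"
    "z \<in> I \<cdot>\<^bsub>group_ring G\<^esub> J"
  shows "z \<star> c \<in> I \<cdot>\<^bsub>group_ring G\<^esub> J"
  using assms(5)
proof induction
  case (prod i j)
  then show ?case using ideal_prod.prod[of i I "j \<star> c" J "group_ring G"] assms(1-4)
    by (simp add: gr_mult_assoc)
next
  case (sum s1 s2)
  then show ?case using ideal_prod_add[of "s1 \<star> c" I J "s2 \<star> c"] by (simp add: gr_simps(2) gr_mult_add)
qed

text \<open>Rests on u v - 1 = u (v - 1) + (u - 1) and u^-1 - 1 = - u^-1 (u - 1). Only elements of
  \<open>H\<close> act on \<open>I\<close>, so that \<open>I\<close> may be the square of the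
  augmentation ideal of \<open>H\<close>, which need not be an ideal of the large group
  ring.\<close>

lemma subgroup_one_plus:
  assumes H: "subgroup H G"
    and I: "0 \<in> I" "\<And>a b. a \<in> I \<Longrightarrow> b \<in> I \<Longrightarrow> a + b \<in> I" "\<And>a. a \<in> I \<Longrightarrow> - a \<in> I"
      "\<And>h a. h \<in> H \<Longrightarrow> a \<in> I \<Longrightarrow> frag_of h \<star> a \<in> I"
  shows "subgroup {u \<in> H. frag_of u - frag_of \<one> \<in> I} G"
proof
  note Hc = subgroup.mem_carrier[OF H]
  show "{u \<in> H. frag_of u - frag_of \<one> \<in> I} \<subseteq> carrier G" using Hc by auto
  show "\<one> \<in> {u \<in> H. frag_of u - frag_of \<one> \<in> I}" using I subgroup.one_closed[OF H] by simp
  fix u assume u: "u \<in> {u \<in> H. frag_of u - frag_of \<one> \<in> I}"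
  then have "frag_of (inv u) \<star> (frag_of u - frag_of \<one>) \<in> I"
    using I(4) subgroup.m_inv_closed[OF H] by blast
  from I(3)[OF this] have "frag_of (inv u) - frag_of \<one> \<in> I" using u Hc by (simp add: gr_mult_diff)
  then show "inv u \<in> {u \<in> H. frag_of u - frag_of \<one> \<in> I}" using u subgroup.m_inv_closed[OF H] by blast
  fix v assume v: "v \<in> {u \<in> H. frag_of u - frag_of \<one> \<in> I}"
  have "frag_of u \<star> (frag_of v - frag_of \<one>) \<in> I" using I(4) u v by blast
  from I(2)[OF this, of "frag_of u - frag_of \<one>"]
  have "frag_of (u \<otimes> v) - frag_of \<one> \<in> I" using u v Hc by (simp add: gr_mult_diff)
  then show "u \<otimes> v \<in> {u \<in> H. frag_of u - frag_of \<one> \<in> I}" using u v subgroup.m_closed[OF H] by blast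
qed

text \<open>[u, g] - 1 = (u g - g u)(g u)^-1, and u g - g u is the ring commutator of u - 1 and g -
  1. The unit (g u)^-1 is attached to the right factor, so that each summand is a product of two
  elements of augmentation ideals.\<close>

lemma commutator_minus_one:
  assumes "u \<in> carrier G" "g \<in> carrier G"
  shows "frag_of (commutator G u g) - frag_of \<one> =
    (frag_of u - frag_of \<one>) \<star> ((frag_of g - frag_of \<one>) \<star> frag_of (inv (g \<otimes> u)))
    + - ((frag_of g - frag_of \<one>) \<star> ((frag_of u - frag_of \<one>) \<star> frag_of (inv (g \<otimes> u))))"
  using assms by (simp add: gr_mult_diff group_normalize)

section \<open>Powers of the augmentation ideal and the inclusions of group elements in them\<close>

abbreviation aug_power :: "nat \<Rightarrow> ('a \<Rightarrow>\<^sub>0 int) set" where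
  "aug_power n \<equiv> ideal_power (group_ring G) (augmentation_ideal G) n"

lemma aug_power_keys: "z \<in> aug_power n \<Longrightarrow> Poly_Mapping.keys z \<subseteq> carrier G"
proof (induction n arbitrary: z)
  case (Suc n)
  show ?case by (rule ideal_prod_keys[OF Suc.IH _ subgroup_self]) (use Suc.prems in \<open>auto simp: augmentation_ideal_iff\<close>)
qed (simp add: gr_simps)

lemma aug_ideal_mult:
  "a \<in> augmentation_ideal G \<Longrightarrow> Poly_Mapping.keys c \<subseteq> carrier G \<Longrightarrow> a \<star> c \<in> augmentation_ideal G"
  "a \<in> augmentation_ideal G \<Longrightarrow> Poly_Mapping.keys c \<subseteq> carrier G \<Longrightarrow> c \<star> a \<in> augmentation_ideal G"
  using keys_gr_mult[OF subgroup_self] by (simp_all add: augmentation_ideal_iff augmentation_gr_mult)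

lemma aug_power_zero: "0 \<in> aug_power n"
proof (induction n)
  case (Suc n)
  \<comment> \<open>The sums in \<open>ideal_prod\<close> are nonempty, so 0 has to be exhibited as
    a product of zeros.\<close>
  then show ?case using ideal_prod.prod[of 0 "aug_power n" 0 "augmentation_ideal G" "group_ring G"]
    by (simp add: augmentation_ideal_iff)
qed (simp add: gr_simps)

lemma aug_power_add: "a \<in> aug_power n \<Longrightarrow> b \<in> aug_power n \<Longrightarrow> a + b \<in> aug_power n"
  by (cases n) (auto simp: gr_simps(3) intro: ideal_prod_add keys_add_subset[THEN subsetD])

lemma aug_power_minus: "a \<in> aug_power n \<Longrightarrow> - a \<in> aug_power n"
proof (induction n arbitrary: a)
  case (Suc n)
  then show ?case by (auto intro: ideal_prod_minus)
qed (simp add: gr_simps)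

lemma aug_power_left:
  assumes "Poly_Mapping.keys c \<subseteq> carrier G"
  shows "z \<in> aug_power n \<Longrightarrow> c \<star> z \<in> aug_power n"
proof (induction n arbitrary: z)
  case 0
  then show ?case using keys_gr_mult[OF subgroup_self assms] by (simp add: gr_simps)
next
  case (Suc n)
  show ?case unfolding ideal_power.simps
    by (rule ideal_prod_left[OF Suc.IH])
       (use Suc.prems assms aug_power_keys in \<open>auto simp: augmentation_ideal_iff\<close>)
qed

lemma aug_power_right:
  assumes "Poly_Mapping.keys c \<subseteq> carrier G"
  shows "z \<in> aug_power n \<Longrightarrow> z \<star> c \<in> aug_power n"
proof (cases n)
  case 0
  then show "z \<in> aug_power n \<Longrightarrow> z \<star> c \<in> aug_power n"
    using keys_gr_mult[OF subgroup_self _ assms] by (simp add: gr_simps)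
next
  case (Suc m)
  assume "z \<in> aug_power n"
  then show ?thesis unfolding Suc ideal_power.simps
    by (intro ideal_prod_right)
       (use assms aug_power_keys aug_ideal_mult in \<open>auto simp: augmentation_ideal_iff(1)\<close>)
qed

text \<open>\<open>ideal_power\<close> adds factors on the right; the left-hand version is what the
  second summand of \<open>commutator_minus_one\<close> calls for.\<close>

lemma aug_power_Suc_left:
  assumes "a \<in> augmentation_ideal G"
  shows "z \<in> aug_power n \<Longrightarrow> a \<star> z \<in> aug_power (Suc n)"
proof (induction n arbitrary: z)
  case 0
  have "a \<star> z \<in> augmentation_ideal G" using aug_ideal_mult(1)[OF assms] 0 by (simp add: gr_simps)
  \<comment> \<open>The first power is by definition the whole ring times the augmentation ideal,
    hence the extra factor \<open>frag_of \<one>\<close>.\<close>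
  then show ?case
    using ideal_prod.prod[of "frag_of \<one>" "carrier (group_ring G)" "a \<star> z" "augmentation_ideal G" "group_ring G"]
    by (simp add: gr_simps gr_mult_one augmentation_ideal_iff)
next
  case (Suc n)
  show ?case unfolding ideal_power.simps(2)[of _ _ "Suc n"]
    by (rule ideal_prod_left[OF Suc.IH])
       (use Suc.prems assms aug_power_keys in \<open>auto simp: augmentation_ideal_iff\<close>)
qed

lemma frag_of_minus_one_in_aug:
  "subgroup H G \<Longrightarrow> g \<in> H \<Longrightarrow> frag_of g - frag_of \<one> \<in> augmentation_ideal (G\<lparr>carrier := H\<rparr>)"
  using keys_diff_subset[of "frag_of g" H "frag_of \<one>"] subgroup.one_closed
  by (auto simp: augmentation_ideal_iff)

lemma frag_of_minus_one_in_aug_self: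
  "g \<in> carrier G \<Longrightarrow> frag_of g - frag_of \<one> \<in> augmentation_ideal G"
  using keys_diff_subset[of "frag_of g" "carrier G" "frag_of \<one>"] by (auto simp: augmentation_ideal_iff)

lemma lc_aug_power: "u \<in> lc (Suc n) \<Longrightarrow> frag_of u - frag_of \<one> \<in> aug_power (Suc n)"
proof (induction n arbitrary: u)
  case 0
  then have "frag_of u - frag_of \<one> \<in> augmentation_ideal G"
    by (simp add: lc_1 frag_of_minus_one_in_aug_self)
  then show ?case
    using ideal_prod.prod[of "frag_of \<one>" "carrier (group_ring G)" "frag_of u - frag_of \<one>" "augmentation_ideal G" "group_ring G"]
    by (simp add: gr_simps gr_mult_one augmentation_ideal_iff)
next
  case (Suc n)
  have sub: "subgroup {u \<in> carrier G. frag_of u - frag_of \<one> \<in> aug_power (Suc (Suc n))} G"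
    by (intro subgroup_one_plus subgroup_self aug_power_zero aug_power_add aug_power_minus aug_power_left) auto
  have "lc (Suc (Suc n)) \<subseteq> {u \<in> carrier G. frag_of u - frag_of \<one> \<in> aug_power (Suc (Suc n))}"
    unfolding lc_Suc
  proof (rule generate_subset_subgroup[OF sub], safe)
    fix h k assume h: "h \<in> lc (Suc n)" and k: "k \<in> carrier G"
    have hc: "h \<in> carrier G" using h lc_carrier by auto
    then show "commutator G h k \<in> carrier G" using k by simp
    have t: "Poly_Mapping.keys (frag_of (inv (k \<otimes> h))) \<subseteq> carrier G" using hc k by simp
    have ka: "frag_of k - frag_of \<one> \<in> augmentation_ideal G" using k by (rule frag_of_minus_one_in_aug_self)
    have "(frag_of h - frag_of \<one>) \<star> ((frag_of k - frag_of \<one>) \<star> frag_of (inv (k \<otimes> h))) \<in> aug_power (Suc (Suc n))"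
      unfolding ideal_power.simps(2)[of _ _ "Suc n"]
      by (intro ideal_prod.prod Suc.IH h aug_ideal_mult(1) ka t)
    moreover have "(frag_of k - frag_of \<one>) \<star> ((frag_of h - frag_of \<one>) \<star> frag_of (inv (k \<otimes> h))) \<in> aug_power (Suc (Suc n))"
      by (intro aug_power_Suc_left aug_power_right Suc.IH h ka t)
    ultimately show "frag_of (commutator G h k) - frag_of \<one> \<in> aug_power (Suc (Suc n))"
      unfolding commutator_minus_one[OF hc k] by (intro aug_power_add aug_power_minus)
  qed
  then show ?case using Suc.prems by blast
qed

lemma derived_aug_square:
  assumes H: "subgroup H G" and u: "u \<in> generate G {commutator G r s | r s. r \<in> H \<and> s \<in> H}"
  shows "frag_of u - frag_of \<one> \<in>
    augmentation_ideal (G\<lparr>carrier := H\<rparr>) \<cdot>\<^bsub>group_ring G\<^esub> augmentation_ideal (G\<lparr>carrier := H\<rparr>)"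
    (is "_ \<in> ?I \<cdot>\<^bsub>_\<^esub> ?I")
proof -
  note Hc = subgroup.mem_carrier[OF H]
  have mult: "a \<star> c \<in> ?I" "c \<star> a \<in> ?I" if "a \<in> ?I" "Poly_Mapping.keys c \<subseteq> H" for a c
    using that keys_gr_mult[OF H] by (simp_all add: augmentation_ideal_iff augmentation_gr_mult)
  have keys: "Poly_Mapping.keys a \<subseteq> carrier G" if "a \<in> ?I" for a
    using that Hc by (auto simp: augmentation_ideal_iff)
  have I0: "0 \<in> ?I" "\<And>a. a \<in> ?I \<Longrightarrow> - a \<in> ?I" by (auto simp: augmentation_ideal_iff)
  have "subgroup {u \<in> H. frag_of u - frag_of \<one> \<in> ?I \<cdot>\<^bsub>group_ring G\<^esub> ?I} G"
  proof (rule subgroup_one_plus[OF H])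
    show "0 \<in> ?I \<cdot>\<^bsub>group_ring G\<^esub> ?I"
      using ideal_prod.prod[OF I0(1) I0(1), of "group_ring G"] by simp
    show "frag_of h \<star> a \<in> ?I \<cdot>\<^bsub>group_ring G\<^esub> ?I" if "h \<in> H" "a \<in> ?I \<cdot>\<^bsub>group_ring G\<^esub> ?I" for h a
      by (rule ideal_prod_left[OF _ keys keys _ that(2)]) (use that(1) mult Hc in auto)
  qed (auto intro: ideal_prod_add ideal_prod_minus I0)
  then have "generate G {commutator G r s | r s. r \<in> H \<and> s \<in> H}
    \<subseteq> {u \<in> H. frag_of u - frag_of \<one> \<in> ?I \<cdot>\<^bsub>group_ring G\<^esub> ?I}"
  proof (rule generate_subset_subgroup, safe)
    fix r s assume rs: "r \<in> H" "s \<in> H"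
    note cl = subgroup.m_closed[OF H] subgroup.m_inv_closed[OF H]
    show "commutator G r s \<in> H" using rs cl by (simp add: commutator_def)
    have t: "Poly_Mapping.keys (frag_of (inv (s \<otimes> r))) \<subseteq> H" using rs cl by simp
    note a = frag_of_minus_one_in_aug[OF H rs(1)] frag_of_minus_one_in_aug[OF H rs(2)]
    show "frag_of (commutator G r s) - frag_of \<one> \<in> ?I \<cdot>\<^bsub>group_ring G\<^esub> ?I"
      unfolding commutator_minus_one[OF Hc[OF rs(1)] Hc[OF rs(2)]]
      by (intro ideal_prod_add ideal_prod_minus ideal_prod.prod I0 mult(1) a t)
  qed
  then show ?thesis using u by blast
qed

end

section \<open>The linear extension of the expansion to the group ring\<close>

context magnus_coordinates
begin

definition e1 :: "('a \<Rightarrow>\<^sub>0 int) \<Rightarrow> 'a vec" where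
  "e1 a = (\<lambda>x. lin (\<lambda>g. d1 g x) a)"
definition e2 :: "('a \<Rightarrow>\<^sub>0 int) \<Rightarrow> 'a ten2" where
  "e2 a = (\<lambda>x y. lin (\<lambda>g. d2 g x y) a)"
definition e3 :: "('a \<Rightarrow>\<^sub>0 int) \<Rightarrow> 'a ten3" where
  "e3 a = (\<lambda>x y z. lin (\<lambda>g. d3 g x y z) a)"

lemma lin_e:
  "lin (\<lambda>g. c) a = c * augmentation a" "lin (\<lambda>g. d1 g x) a = e1 a x"
  "lin (\<lambda>g. d2 g x y) a = e2 a x y" "lin (\<lambda>g. d3 g x y z) a = e3 a x y z"
  using lin_fun_simps(4)[of c a] by (simp_all add: augmentation_eq_lin e1_def e2_def e3_def)

lemma e_zero [simp]: "e1 0 = 0" "e2 0 = 0" "e3 0 = 0"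
  by (simp_all add: e1_def e2_def e3_def fun_eq_iff)

lemma e_diff: "e1 (a - b) = e1 a - e1 b" "e2 (a - b) = e2 a - e2 b" "e3 (a - b) = e3 a - e3 b"
  by (simp_all add: e1_def e2_def e3_def fun_eq_iff)

lemma e_add: "e1 (a + b) = e1 a + e1 b" "e2 (a + b) = e2 a + e2 b" "e3 (a + b) = e3 a + e3 b"
  by (simp_all add: e1_def e2_def e3_def fun_eq_iff)

lemma e_frag_of [simp]: "e1 (frag_of g) = d1 g" "e2 (frag_of g) = d2 g" "e3 (frag_of g) = d3 g"
  by (simp_all add: e1_def e2_def e3_def)

lemma lin_gr_mult_cong:
  assumes "Poly_Mapping.keys a \<subseteq> carrier G" "Poly_Mapping.keys b \<subseteq> carrier G"
    "\<And>g h. g \<in> carrier G \<Longrightarrow> h \<in> carrier G \<Longrightarrow> f (g \<otimes> h) = f' g h"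
  shows "lin f (a \<star> b) = lin (\<lambda>g. lin (f' g) b) a"
  unfolding lin_gr_mult using assms by (intro lin_cong) blast

lemma e1_mult:
  assumes "Poly_Mapping.keys a \<subseteq> carrier G" "Poly_Mapping.keys b \<subseteq> carrier G"
  shows "e1 (a \<star> b) x = e1 a x * augmentation b + augmentation a * e1 b x"
proof -
  have "e1 (a \<star> b) x = lin (\<lambda>g. lin (\<lambda>h. d1 g x + d1 h x) b) a"
    unfolding lin_e(2)[symmetric] by (rule lin_gr_mult_cong[OF assms]) (simp add: d1_mult)
  also have "\<dots> = lin (\<lambda>g. d1 g x * augmentation b + e1 b x) a"
    by (simp add: lin_fun_simps(1-3) lin_e)
  also have "\<dots> = e1 a x * augmentation b + augmentation a * e1 b x"
    by (simp add: lin_fun_simps(1-3) lin_e)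
  finally show ?thesis .
qed

lemma e2_mult:
  assumes "Poly_Mapping.keys a \<subseteq> carrier G" "Poly_Mapping.keys b \<subseteq> carrier G"
  shows "e2 (a \<star> b) x y = e2 a x y * augmentation b + e1 a x * e1 b y + augmentation a * e2 b x y"
proof -
  have "e2 (a \<star> b) x y = lin (\<lambda>g. lin (\<lambda>h. d2 g x y + d1 g x * d1 h y + d2 h x y) b) a"
    unfolding lin_e(3)[symmetric] by (rule lin_gr_mult_cong[OF assms]) (simp add: d2_mult t11_def)
  also have "\<dots> = lin (\<lambda>g. d2 g x y * augmentation b + d1 g x * e1 b y + e2 b x y) a"
    by (simp add: lin_fun_simps(1-3) lin_e)
  also have "\<dots> = e2 a x y * augmentation b + e1 a x * e1 b y + augmentation a * e2 b x y"
    by (simp add: lin_fun_simps(1-3) lin_e)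
  finally show ?thesis .
qed

lemma e3_mult:
  assumes "Poly_Mapping.keys a \<subseteq> carrier G" "Poly_Mapping.keys b \<subseteq> carrier G"
  shows "e3 (a \<star> b) x y z = e3 a x y z * augmentation b + e2 a x y * e1 b z + e1 a x * e2 b y z
    + augmentation a * e3 b x y z"
proof -
  have "e3 (a \<star> b) x y z =
    lin (\<lambda>g. lin (\<lambda>h. d3 g x y z + d2 g x y * d1 h z + d1 g x * d2 h y z + d3 h x y z) b) a"
    unfolding lin_e(4)[symmetric] by (rule lin_gr_mult_cong[OF assms]) (simp add: d3_mult t12_def t21_def)
  also have "\<dots> = lin (\<lambda>g. d3 g x y z * augmentation b + d2 g x y * e1 b z + d1 g x * e2 b y z + e3 b x y z) a"
    by (simp add: lin_fun_simps(1-3) lin_e)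
  also have "\<dots> = e3 a x y z * augmentation b + e2 a x y * e1 b z + e1 a x * e2 b y z + augmentation a * e3 b x y z"
    by (simp add: lin_fun_simps(1-3) lin_e)
  finally show ?thesis .
qed

text \<open>The constant term of the extended expansion is the augmentation, which accounts for the
  outer summands; on group elements it is 1.\<close>

lemma e_mult:
  assumes "Poly_Mapping.keys a \<subseteq> carrier G" "Poly_Mapping.keys b \<subseteq> carrier G"
  shows "e1 (a \<star> b) = of_int (augmentation b) * e1 a + of_int (augmentation a) * e1 b"
    and "e2 (a \<star> b) = of_int (augmentation b) * e2 a + t11 (e1 a) (e1 b) + of_int (augmentation a) * e2 b"
    and "e3 (a \<star> b) = of_int (augmentation b) * e3 a + t21 (e2 a) (e1 b) + t12 (e1 a) (e2 b)
      + of_int (augmentation a) * e3 b"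
  using e1_mult[OF assms] e2_mult[OF assms] e3_mult[OF assms]
  by (simp_all add: fun_eq_iff tensor_defs mult.commute)

lemma aug_power_1: "z \<in> aug_power 1 \<Longrightarrow> augmentation z = 0"
  unfolding One_nat_def ideal_power.simps(2)
  by (induction z rule: ideal_prod.induct)
     (auto simp: augmentation_gr_mult augmentation_ideal_iff gr_simps(2))

lemma aug_power_2: "z \<in> aug_power 2 \<Longrightarrow> augmentation z = 0 \<and> e1 z = 0"
proof -
  assume "z \<in> aug_power 2"
  then have "z \<in> aug_power 1 \<cdot>\<^bsub>group_ring G\<^esub> augmentation_ideal G" by (simp add: numeral_2_eq_2)
  then show ?thesis
  proof induction
    case (prod i j)
    have "Poly_Mapping.keys i \<subseteq> carrier G" using aug_power_keys prod by blast
    then show ?case using prod aug_power_1[OF prod(1)]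
      by (simp add: augmentation_gr_mult augmentation_ideal_iff e_mult)
  next
    case (sum s1 s2)
    then show ?case by (simp add: gr_simps(2) e_add)
  qed
qed

lemma aug_power_3: "z \<in> aug_power 3 \<Longrightarrow> augmentation z = 0 \<and> e1 z = 0 \<and> e2 z = 0"
proof -
  assume "z \<in> aug_power 3"
  then have "z \<in> aug_power 2 \<cdot>\<^bsub>group_ring G\<^esub> augmentation_ideal G"
    by (simp add: numeral_2_eq_2 numeral_3_eq_3)
  then show ?thesis
  proof induction
    case (prod i j)
    have "Poly_Mapping.keys i \<subseteq> carrier G" using aug_power_keys prod by blast
    then show ?case using prod aug_power_2[OF prod(1)]
      by (simp add: augmentation_gr_mult augmentation_ideal_iff e_mult)
  next
    case (sum s1 s2)
    then show ?case by (simp add: gr_simps(2) e_add)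
  qed
qed

lemma aug_power_4: "z \<in> aug_power 4 \<Longrightarrow> augmentation z = 0 \<and> e1 z = 0 \<and> e2 z = 0 \<and> e3 z = 0"
proof -
  assume "z \<in> aug_power 4"
  then have "z \<in> aug_power 3 \<cdot>\<^bsub>group_ring G\<^esub> augmentation_ideal G"
    by (simp add: eval_nat_numeral)
  then show ?thesis
  proof induction
    case (prod i j)
    have "Poly_Mapping.keys i \<subseteq> carrier G" using aug_power_keys prod by blast
    then show ?case using prod aug_power_3[OF prod(1)]
      by (simp add: augmentation_gr_mult augmentation_ideal_iff e_mult)
  next
    case (sum s1 s2)
    then show ?case by (simp add: gr_simps(2) e_add)
  qed
qed

end

section \<open>Leading terms of the square of the augmentation ideal of R\<close>

context magnus_normal
begin

definition all_leading_pairs :: "('a ten2 \<times> 'a ten3) set" where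
  "all_leading_pairs = (\<Union>Y \<in> {Y. finite Y \<and> Y \<subseteq> X}. leading_pairs Y)"

lemma all_leading_pairsI: "finite Y \<Longrightarrow> Y \<subseteq> X \<Longrightarrow> t \<in> leading_pairs Y \<Longrightarrow> t \<in> all_leading_pairs"
  unfolding all_leading_pairs_def by blast

lemma all_leading_pairsE:
  assumes "t \<in> all_leading_pairs"
  obtains Y where "finite Y" "Y \<subseteq> X" "t \<in> leading_pairs Y"
  using assms unfolding all_leading_pairs_def by blast

lemma zsub_all_leading_pairs: "zsub all_leading_pairs"
proof (rule zsubI)
  show "0 \<in> all_leading_pairs"
    by (rule all_leading_pairsI[of "{}"]) (auto simp: leading_pairs_def intro: zspan_zero)
  fix a b assume "a \<in> all_leading_pairs" "b \<in> all_leading_pairs"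
  then obtain Y Z where YZ: "finite Y" "Y \<subseteq> X" "a \<in> leading_pairs Y" "finite Z" "Z \<subseteq> X" "b \<in> leading_pairs Z"
    by (elim all_leading_pairsE)
  have "a \<in> leading_pairs (Y \<union> Z)" "b \<in> leading_pairs (Y \<union> Z)"
    using YZ leading_pairs_mono[of Y "Y \<union> Z"] leading_pairs_mono[of Z "Y \<union> Z"] by blast+
  then have "a - b \<in> leading_pairs (Y \<union> Z)" unfolding leading_pairs_def by (rule zspan_diff)
  then show "a - b \<in> all_leading_pairs" using YZ by (intro all_leading_pairsI[of "Y \<union> Z"]) auto
qed

lemma R_at_support:
  assumes "r \<in> R"
  obtains Y where "finite Y" "Y \<subseteq> X" "r \<in> R_at Y"
  using finite_support[OF R_carrier[OF assms]] assms unfolding R_at_def by blast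

lemma all_leading_pairs_mixed:
  assumes "r \<in> R" "s \<in> R"
  shows "(t11 (d1 r) (d1 s), mixed r s) \<in> all_leading_pairs"
proof -
  obtain Y Z where YZ: "finite Y" "Y \<subseteq> X" "r \<in> R_at Y" "finite Z" "Z \<subseteq> X" "s \<in> R_at Z"
    using R_at_support[OF assms(1)] R_at_support[OF assms(2)] by metis
  then have "r \<in> R_at (Y \<union> Z)" "s \<in> R_at (Y \<union> Z)"
    using R_at_mono[of Y "Y \<union> Z"] R_at_mono[of Z "Y \<union> Z"] by blast+
  then have "(t11 (d1 r) (d1 s), mixed r s) \<in> leading_pairs (Y \<union> Z)"
    unfolding leading_pairs_def by (intro zspan_base) blast
  then show ?thesis using YZ by (intro all_leading_pairsI[of "Y \<union> Z"]) auto
qed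

lemma all_leading_pairs_column:
  assumes "r \<in> R"
  shows "(0, t21 (t11 (d1 r) a) c) \<in> all_leading_pairs"
proof -
  obtain Y where Y: "finite Y" "Y \<subseteq> X" "r \<in> R_at Y" using R_at_support[OF assms] .
  have "(0, t21 (t11 (d1 r) a) c) \<in> leading_pairs Y"
    unfolding leading_pairs_def by (intro zspan_base UnI2 imageI t21_columns Y(3))
  then show ?thesis using Y by (intro all_leading_pairsI)
qed

text \<open>For \<open>a\<close> and \<open>b\<close> of augmentation 0 these are the terms of
  degree two and three of the product a b c. The formula is trilinear without any condition on
  augmentations, so it can be evaluated on single group elements, which themselves have augmentation
  1.\<close>

definition product_pair :: "('a \<Rightarrow>\<^sub>0 int) \<Rightarrow> ('a \<Rightarrow>\<^sub>0 int) \<Rightarrow> ('a \<Rightarrow>\<^sub>0 int) \<Rightarrow> 'a ten2 \<times> 'a ten3" where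
  "product_pair a b c = (of_int (augmentation c) * t11 (e1 a) (e1 b),
     of_int (augmentation c) * (t21 (e2 a) (e1 b) + t12 (e1 a) (e2 b)) + t21 (t11 (e1 a) (e1 b)) (e1 c))"

lemma product_pair_diff:
  "product_pair (a - a') b c = product_pair a b c - product_pair a' b c"
  "product_pair a (b - b') c = product_pair a b c - product_pair a b' c"
  "product_pair a b (c - c') = product_pair a b c - product_pair a b c'"
  by (simp_all add: product_pair_def e_diff prod_eq_iff fun_eq_iff tensor_defs algebra_simps)

lemma product_pair_zero: "product_pair 0 b c = 0" "product_pair a 0 c = 0" "product_pair a b 0 = 0"
  by (simp_all add: product_pair_def prod_eq_iff)

lemma product_pair_in:
  assumes "Poly_Mapping.keys a \<subseteq> R" "Poly_Mapping.keys b \<subseteq> R" "Poly_Mapping.keys c \<subseteq> carrier G"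
  shows "product_pair a b c \<in> all_leading_pairs"
  using assms(1)
proof (induction a rule: frag_induction)
  case (one r)
  show ?case using assms(2)
  proof (induction b rule: frag_induction)
    case (one s)
    show ?case using assms(3)
    proof (induction c rule: frag_induction)
      case (one g)
      have "product_pair (frag_of r) (frag_of s) (frag_of g) =
        (t11 (d1 r) (d1 s), mixed r s) + (0, t21 (t11 (d1 r) (d1 s)) (d1 g))"
        by (simp add: product_pair_def mixed_def)
      also have "\<dots> \<in> all_leading_pairs"
        by (intro zsub_add[OF zsub_all_leading_pairs] all_leading_pairs_mixed
            all_leading_pairs_column \<open>r \<in> R\<close> \<open>s \<in> R\<close>)
      finally show ?case .
    qed (simp_all only: product_pair_zero product_pair_diff zsub_zero[OF zsub_all_leading_pairs] zsub_diff[OF zsub_all_leading_pairs])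
  qed (simp_all only: product_pair_zero product_pair_diff zsub_zero[OF zsub_all_leading_pairs] zsub_diff[OF zsub_all_leading_pairs])
qed (simp_all only: product_pair_zero product_pair_diff zsub_zero[OF zsub_all_leading_pairs] zsub_diff[OF zsub_all_leading_pairs])

abbreviation aug_R :: "('a \<Rightarrow>\<^sub>0 int) set" where
  "aug_R \<equiv> augmentation_ideal (G\<lparr>carrier := R\<rparr>)"

lemma aug_R_keys: "a \<in> aug_R \<Longrightarrow> Poly_Mapping.keys a \<subseteq> R" "a \<in> aug_R \<Longrightarrow> Poly_Mapping.keys a \<subseteq> carrier G"
  by (auto simp: augmentation_ideal_iff)

definition leading_kernel :: "('a \<Rightarrow>\<^sub>0 int) set" where
  "leading_kernel = {z. e1 z = 0 \<and> (e2 z, e3 z) \<in> all_leading_pairs}"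

lemma leading_kernel_add:
  assumes "y \<in> leading_kernel" "z \<in> leading_kernel"
  shows "y + z \<in> leading_kernel"
proof -
  have "(e2 (y + z), e3 (y + z)) = (e2 y, e3 y) + (e2 z, e3 z)" by (simp add: e_add)
  also have "\<dots> \<in> all_leading_pairs"
    using assms unfolding leading_kernel_def by (intro zsub_add[OF zsub_all_leading_pairs]) auto
  finally show ?thesis using assms by (simp add: leading_kernel_def e_add)
qed

lemma aug_R_square_leading:
  assumes "z \<in> aug_R \<cdot>\<^bsub>group_ring G\<^esub> aug_R" "Poly_Mapping.keys c \<subseteq> carrier G"
  shows "z \<star> c \<in> leading_kernel"
  using assms(1)
proof induction
  case (prod a b)
  note k = aug_R_keys(2)[OF prod(1)] aug_R_keys(2)[OF prod(2)]
  have kab: "Poly_Mapping.keys (a \<star> b) \<subseteq> carrier G" by (rule keys_gr_mult[OF subgroup_self k])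
  have "augmentation a = 0" "augmentation b = 0" using prod by (auto simp: augmentation_ideal_iff)
  then have "e1 (a \<star> b \<star> c) = 0" "(e2 (a \<star> b \<star> c), e3 (a \<star> b \<star> c)) = product_pair a b c"
    by (simp_all add: e_mult[OF kab assms(2)] e_mult[OF k] augmentation_gr_mult product_pair_def)
  then show ?case
    using product_pair_in[OF aug_R_keys(1)[OF prod(1)] aug_R_keys(1)[OF prod(2)] assms(2)]
    by (simp add: leading_kernel_def)
next
  case (sum s1 s2)
  then show ?case by (simp add: gr_simps(2) gr_mult_add leading_kernel_add)
qed

lemma aug_R_square_ideal_leading:
  assumes "z \<in> aug_R \<cdot>\<^bsub>group_ring G\<^esub> aug_R \<cdot>\<^bsub>group_ring G\<^esub> carrier (group_ring G)"
  shows "z \<in> leading_kernel"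
  using assms
proof induction
  case (prod a c)
  then show ?case by (intro aug_R_square_leading) (simp_all add: gr_simps)
next
  case (sum s1 s2)
  then show ?case by (simp add: gr_simps(2) leading_kernel_add)
qed

lemma leading_kernel_tensor_square:
  assumes "z \<in> leading_kernel"
  obtains Y where "finite Y" "e2 z \<in> tensor_square Y"
proof -
  have "(e2 z, e3 z) \<in> all_leading_pairs" using assms by (simp add: leading_kernel_def)
  then obtain Y where "finite Y" "(e2 z, e3 z) \<in> leading_pairs Y" by (elim all_leading_pairsE)
  then show ?thesis using that leading_pairs_fst by fastforce
qed

text \<open>Allows the factor from \<open>derived_R\<close> supplied by part (i) to be split off in
  part (ii) without leaving the leading pairs. On elements with \<open>d1 u = 0\<close> the terms of
  degree two and three are additive, so commutators of elements of R suffice; for these the formula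
  differs from an antisymmetrized pair by tensors beginning in the lattice.\<close>

lemma derived_R_leading:
  assumes "u \<in> derived_R"
  shows "(d2 u, d3 u) \<in> all_leading_pairs"
proof -
  note zs = zsub_all_leading_pairs
  have "subgroup {u \<in> carrier G. d1 u = 0 \<and> (d2 u, d3 u) \<in> all_leading_pairs} G"
  proof
    show "\<one> \<in> {u \<in> carrier G. d1 u = 0 \<and> (d2 u, d3 u) \<in> all_leading_pairs}"
      using zsub_zero[OF zs] by (simp add: zero_prod_def)
    fix u assume u: "u \<in> {u \<in> carrier G. d1 u = 0 \<and> (d2 u, d3 u) \<in> all_leading_pairs}"
    have "(d2 (inv u), d3 (inv u)) = - (d2 u, d3 u)" using u by (simp add: d2_inv d3_inv)
    then have "(d2 (inv u), d3 (inv u)) \<in> all_leading_pairs"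
      using zsub_minus[OF zs, of "(d2 u, d3 u)"] u by (metis (mono_tags, lifting) mem_Collect_eq)
    then show "inv u \<in> {u \<in> carrier G. d1 u = 0 \<and> (d2 u, d3 u) \<in> all_leading_pairs}"
      using u by (simp add: d1_inv)
    fix v assume v: "v \<in> {u \<in> carrier G. d1 u = 0 \<and> (d2 u, d3 u) \<in> all_leading_pairs}"
    have "(d2 (u \<otimes> v), d3 (u \<otimes> v)) = (d2 u, d3 u) + (d2 v, d3 v)"
      using u v by (simp add: d2_mult d3_mult)
    then have "(d2 (u \<otimes> v), d3 (u \<otimes> v)) \<in> all_leading_pairs"
      using zsub_add[OF zs, of "(d2 u, d3 u)" "(d2 v, d3 v)"] u v by (metis (mono_tags, lifting) mem_Collect_eq)
    then show "u \<otimes> v \<in> {u \<in> carrier G. d1 u = 0 \<and> (d2 u, d3 u) \<in> all_leading_pairs}"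
      using u v by (simp add: d1_mult)
  qed auto
  then have "derived_R \<subseteq> {u \<in> carrier G. d1 u = 0 \<and> (d2 u, d3 u) \<in> all_leading_pairs}"
    unfolding derived_R_def
  proof (rule generate_subset_subgroup, safe)
    fix r s assume rs: "r \<in> R" "s \<in> R"
    show "commutator G r s \<in> carrier G" "d1 (commutator G r s) = 0"
      using rs by (simp_all add: d1_commutator)
    have "(d2 (commutator G r s), d3 (commutator G r s)) =
      (t11 (d1 r) (d1 s), mixed r s) - (t11 (d1 s) (d1 r), mixed s r)
      - ((0, t21 (t11 (d1 r) (d1 s)) (d1 r + d1 s)) - (0, t21 (t11 (d1 s) (d1 r)) (d1 r + d1 s)))"
      using rs by (simp add: d2_commutator d3_commutator_general mixed_def fun_eq_iff tensor_defs algebra_simps)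
    also have "\<dots> \<in> all_leading_pairs"
      by (rule zsub_diff[OF zs zsub_diff[OF zs] zsub_diff[OF zs]])
        (rule all_leading_pairs_mixed all_leading_pairs_column rs)+
    finally show "(d2 (commutator G r s), d3 (commutator G r s)) \<in> all_leading_pairs" .
  qed
  then show ?thesis using assms by blast
qed

lemma lower_central_R: "lower_central (G\<lparr>carrier := R\<rparr>) 2 = derived_R"
proof -
  have c: "commutator (G\<lparr>carrier := R\<rparr>) r s = commutator G r s" if "r \<in> R" "s \<in> R" for r s
    using that by (simp add: commutator_def m_inv_consistent[OF R_subgroup])
  have "lower_central (G\<lparr>carrier := R\<rparr>) 2 =
     generate (G\<lparr>carrier := R\<rparr>) {commutator (G\<lparr>carrier := R\<rparr>) r s | r s. r \<in> R \<and> s \<in> R}"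
    by (simp add: lower_central_def commutator_subgroup_eq)
  also have "{commutator (G\<lparr>carrier := R\<rparr>) r s | r s. r \<in> R \<and> s \<in> R} = {commutator G r s | r s. r \<in> R \<and> s \<in> R}"
    by (rule Collect_cong) (metis c)
  also have "generate (G\<lparr>carrier := R\<rparr>) \<dots> = derived_R"
    unfolding derived_R_def using commutator_in_R by (intro generate_consistent R_subgroup) auto
  finally show ?thesis .
qed

section \<open>The two parts of the theorem in coordinates\<close>

lemma group_inter_one_plus_aug_R_square:
  "group_inter_one_plus G ((aug_R \<cdot>\<^bsub>group_ring G\<^esub> aug_R) <+>\<^bsub>group_ring G\<^esub> aug_power 3)
    = derived_R <#> lc3"
proof (intro equalityI subsetI)
  fix g assume "g \<in> group_inter_one_plus G ((aug_R \<cdot>\<^bsub>group_ring G\<^esub> aug_R) <+>\<^bsub>group_ring G\<^esub> aug_power 3)"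
  then obtain y z where g: "g \<in> carrier G" and y: "y \<in> aug_R \<cdot>\<^bsub>group_ring G\<^esub> aug_R"
    and z: "z \<in> aug_power 3" and eq: "frag_of g - frag_of \<one> = y + z"
    by (auto simp: group_inter_one_plus_iff set_add_def' gr_simps(2))
  have "Poly_Mapping.keys y \<subseteq> carrier G"
    by (rule ideal_prod_keys[OF aug_R_keys(2) aug_R_keys(2) subgroup_self y])
  \<comment> \<open>An element of the square itself is treated as a product with third factor
    1.\<close>
  then have ylk: "y \<in> leading_kernel"
    using aug_R_square_leading[OF y, of "frag_of \<one>"] by (simp add: gr_mult_one)
  have "e1 (frag_of g - frag_of \<one>) = e1 y + e1 z" "e2 (frag_of g - frag_of \<one>) = e2 y + e2 z"
    unfolding eq by (simp_all add: e_add)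
  then have dg: "d1 g = 0" "d2 g = e2 y"
    using aug_power_3[OF z] ylk by (simp_all add: e_diff leading_kernel_def)
  obtain Y where Y: "finite Y" "e2 y \<in> tensor_square Y"
    using leading_kernel_tensor_square[OF ylk] .
  then obtain u v where "u \<in> derived_R" "v \<in> lc3" "g = u \<otimes> v"
    using derived_R_times_lc3[OF g dg(1) Y(1)] dg(2) by metis
  then show "g \<in> derived_R <#> lc3" unfolding set_mult_def by blast
next
  fix g assume "g \<in> derived_R <#> lc3"
  then obtain u v where g: "g = u \<otimes> v" and u: "u \<in> derived_R" and v: "v \<in> lc3"
    by (auto simp: set_mult_def)
  have c: "u \<in> carrier G" "v \<in> carrier G" using u v derived_R_subset lc_carrier by auto
  have "frag_of u - frag_of \<one> \<in> aug_R \<cdot>\<^bsub>group_ring G\<^esub> aug_R"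
    using derived_aug_square[OF R_subgroup] u unfolding derived_R_def by blast
  moreover have "frag_of u \<star> (frag_of v - frag_of \<one>) \<in> aug_power 3"
    using aug_power_left[OF _ lc_aug_power[OF v], of "frag_of u"] c by (simp add: numeral_3_eq_3)
  moreover have "frag_of g - frag_of \<one> = (frag_of u - frag_of \<one>) + frag_of u \<star> (frag_of v - frag_of \<one>)"
    using c g by (simp add: gr_mult_diff)
  ultimately have "frag_of g - frag_of \<one> \<in> (aug_R \<cdot>\<^bsub>group_ring G\<^esub> aug_R) <+>\<^bsub>group_ring G\<^esub> aug_power 3"
    unfolding set_add_def' gr_simps(2) by blast
  then show "g \<in> group_inter_one_plus G ((aug_R \<cdot>\<^bsub>group_ring G\<^esub> aug_R) <+>\<^bsub>group_ring G\<^esub> aug_power 3)"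
    using c g by (simp add: group_inter_one_plus_iff)
qed

lemma group_inter_one_plus_aug_R_square_ideal:
  "group_inter_one_plus G
     ((aug_R \<cdot>\<^bsub>group_ring G\<^esub> aug_R \<cdot>\<^bsub>group_ring G\<^esub> carrier (group_ring G)) <+>\<^bsub>group_ring G\<^esub> aug_power 4)
    \<subseteq> R <#> lc4"
proof
  fix g assume "g \<in> group_inter_one_plus G
     ((aug_R \<cdot>\<^bsub>group_ring G\<^esub> aug_R \<cdot>\<^bsub>group_ring G\<^esub> carrier (group_ring G)) <+>\<^bsub>group_ring G\<^esub> aug_power 4)"
  then obtain y z where g: "g \<in> carrier G"
    and y: "y \<in> aug_R \<cdot>\<^bsub>group_ring G\<^esub> aug_R \<cdot>\<^bsub>group_ring G\<^esub> carrier (group_ring G)"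
    and z: "z \<in> aug_power 4" and eq: "frag_of g - frag_of \<one> = y + z"
    by (auto simp: group_inter_one_plus_iff set_add_def' gr_simps(2))
  have ylk: "y \<in> leading_kernel" using aug_R_square_ideal_leading[OF y] .
  have "e1 (frag_of g - frag_of \<one>) = e1 y + e1 z" "e2 (frag_of g - frag_of \<one>) = e2 y + e2 z"
    "e3 (frag_of g - frag_of \<one>) = e3 y + e3 z"
    unfolding eq by (simp_all add: e_add)
  then have dg: "d1 g = 0" "d2 g = e2 y" "d3 g = e3 y"
    using aug_power_4[OF z] ylk by (simp_all add: e_diff leading_kernel_def)
  obtain Y where Y: "finite Y" "e2 y \<in> tensor_square Y"
    using leading_kernel_tensor_square[OF ylk] .
  then obtain u v where uv: "u \<in> derived_R" "v \<in> lc3" "g = u \<otimes> v"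
    using derived_R_times_lc3[OF g dg(1) Y(1)] dg(2) by metis
  have c: "u \<in> R" "u \<in> carrier G" "v \<in> carrier G" using uv derived_R_subset lc_carrier by auto
  have d1u: "d1 u = 0" using uv derived_R_lc2 lc2_d1 by blast
  \<comment> \<open>Both factors of \<open>g\<close> have vanishing \<open>d1\<close>, so no cross
    terms occur, and \<open>d2 v = 0\<close> because \<open>v\<close> is in gamma_3.\<close>
  have "(0, d3 v) = (d2 g, d3 g) - (d2 u, d3 u)"
    using c d1u lc3_d1[OF uv(2)] lc3_d2[OF uv(2)] by (simp add: uv(3) d2_mult d3_mult)
  also have "\<dots> \<in> all_leading_pairs"
    using ylk derived_R_leading[OF uv(1)] unfolding dg leading_kernel_def
    by (intro zsub_diff[OF zsub_all_leading_pairs]) auto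
  finally obtain Z where "finite Z" "Z \<subseteq> X" "(0, d3 v) \<in> leading_pairs Z"
    by (elim all_leading_pairsE)
  then obtain r w where rw: "r \<in> R" "w \<in> lc4" "v = r \<otimes> w" using R_times_lc4[OF uv(2)] by blast
  have "g = (u \<otimes> r) \<otimes> w" "u \<otimes> r \<in> R"
    using uv rw c lc_carrier R_closed by (auto simp: m_assoc)
  then show "g \<in> R <#> lc4" using rw by (auto simp: set_mult_def)
qed

end

theorem corollary10:
  fixes F :: "('a, 'b) monoid_scheme" and R :: "'a set"
  assumes "free_group F" and "R \<lhd> F"
  shows
    "(let ZF = group_ring F;
          \<ff> = augmentation_ideal F;
          \<rr> = augmentation_ideal (F\<lparr>carrier := R\<rparr>)
      in group_inter_one_plus F ((\<rr> \<cdot>\<^bsub>ZF\<^esub> \<rr>) <+>\<^bsub>ZF\<^esub> ideal_power ZF \<ff> 3)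
           = lower_central (F\<lparr>carrier := R\<rparr>) 2 <#>\<^bsub>F\<^esub> lower_central F 3
       \<and> group_inter_one_plus F
             ((\<rr> \<cdot>\<^bsub>ZF\<^esub> \<rr> \<cdot>\<^bsub>ZF\<^esub> carrier ZF) <+>\<^bsub>ZF\<^esub> ideal_power ZF \<ff> 4)
           \<subseteq> R <#>\<^bsub>F\<^esub> lower_central F 4)"
proof -
  obtain X where F: "group F" and X: "free_on F X"
    using assms(1) by (auto simp: free_group_def)
  obtain d1 d2 d3 where d:
    "\<forall>g\<in>carrier F. \<forall>h\<in>carrier F.
        d1 (g \<otimes>\<^bsub>F\<^esub> h) = d1 g + d1 h \<and>
        d2 (g \<otimes>\<^bsub>F\<^esub> h) = d2 g + t11 (d1 g) (d1 h) + d2 h \<and>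
        d3 (g \<otimes>\<^bsub>F\<^esub> h) = d3 g + t21 (d2 g) (d1 h) + t12 (d1 g) (d2 h) + d3 h"
    "\<forall>x\<in>X. d1 x = delta x"
    "\<forall>g\<in>carrier F. \<exists>Y. finite Y \<and> Y \<subseteq> X \<and> supp1 Y (d1 g) \<and> supp2 Y (d2 g) \<and> supp3 Y (d3 g)"
    using magnus_expansion[OF F X] by metis
  \<comment> \<open>Any linear order serves for the choice of smallest letters; the well-ordering
    theorem supplies one on the whole type.\<close>
  obtain r :: "'a rel" where "well_order_on UNIV r"
    using well_order_on by blast
  then have r: "linear_order r"
    by (simp add: well_order_on_def)
  define lt where "lt = (\<lambda>x y. (x, y) \<in> r \<and> x \<noteq> y)"
  have lt: "\<not> lt x x" "lt x y \<Longrightarrow> lt y z \<Longrightarrow> lt x z" "lt x y \<or> x = y \<or> lt y x" for x y z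
    using r by (auto simp: lt_def linear_order_on_def partial_order_on_def preorder_on_def
        total_on_def antisym_def trans_def)
  interpret group F by fact
  interpret magnus_coordinates F X lt d1 d2 d3
  proof
    show "X \<subseteq> carrier F" using X by (simp add: free_on_def)
    show "generate F X = carrier F" using X by (rule free_on_generate)
    show "lt x y \<Longrightarrow> lt y z \<Longrightarrow> lt x z" for x y z by (rule lt(2))
  qed (use d lt in simp_all)
  interpret magnus_normal F X lt d1 d2 d3 R
    by (intro magnus_normal.intro magnus_normal_axioms.intro magnus_coordinates_axioms assms(2))
  show ?thesis
    unfolding Let_def
    using group_inter_one_plus_aug_R_square group_inter_one_plus_aug_R_square_ideal lower_central_R
    by (simp add: numeral_3_eq_3 eval_nat_numeral)
qed

end
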